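(* Let $\alpha\in L^\infty([0,1];dx)$ be real-valued a.e., and let $\rho>0$ satisfy $\rho,\,1/\rho\in L^\infty([0,1];dx)$. Let $T$ be one of $T_{\min}$, $T_0$, $T_1$, or $T_\omega$ with $\omega\in\mathbb{C}\setminus\{0,1\}$, and let $D$ and $B$ be the associated operators in $L^2([0,1];\rho^2dx)^2$, $$D=\begin{pmatrix}0&T^*\\ T&0\end{pmatrix},\qquad B=\begin{pmatrix}-i\alpha/\rho^2&0\\ 0&0\end{pmatrix}.$$ Then for all $\zeta\in\mathbb{R}\setminus\{0\}$ with $|\zeta|$ sufficiently small, such that $\zeta\in\rho(D+B)$, one has $$\operatorname{tr}_{L^2([0,1];\rho^2dx)^2}\Big(\operatorname{Im}\big[(D+B-\zeta I_2)^{-1}\big]\Big)=\operatorname{Im}\Big[\operatorname{tr}_{L^2([0,1];\rho^2dx)}\Big(\big(2\zeta+i(\alpha/\rho^2)\big)\big(T^*T-\zeta^2I-\zeta i(\alpha/\rho^2)\big)^{-1}\Big)\Big]=\sum_{m=0}^\infty t_{2m}\,\zeta^{2m},$$ with coefficients $t_{2m}$ independent of $\zeta$, the first two of which are $$t_0=\operatorname{tr}_{L^2([0,1];\rho^2dx)}\big((\alpha/\rho^2)(T^*T)^{-1}\big),$$ $$t_2=-\operatorname{tr}_{L^2([0,1];\rho^2dx)}\big((\alpha/\rho^2)(T^*T)^{-1}(\alpha/\rho^2)(T^*T)^{-1}(\alpha/\rho^2)(T^*T)^{-1}\big)+3\operatorname{tr}_{L^2([0,1];\rho^2dx)}\big((\alpha/\rho^2)(T^*T)^{-2}\big).$$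 Explicitly, the coefficient $t_0$ is given by $$t_0=\int_0^1x(1-x)\alpha(x)\,dx\ \text{ if }T=T_{\min},\qquad t_0=\int_0^1x\,\alpha(x)\,dx\ \text{ if }T=T_0,\qquad t_0=\int_0^1(1-x)\alpha(x)\,dx\ \text{ if }T=T_1,$$ $$t_0=\frac1{|1-\omega|^2}\int_0^1\big[1-(1-|\omega|^2)x\big]\alpha(x)\,dx\ \text{ if }T=T_\omega,\ \omega\in\mathbb{C}\setminus\{0,1\}.$$
   Context: $L^2([0,1];\rho^2dx)$ carries the inner product $(f,g)=\int_0^1\overline{f}\,g\,\rho^2dx$; $L^2([0,1];\rho^2dx)^2$ is the orthogonal direct sum of two copies; $I$ and $I_2$ are the identity operators on $L^2([0,1];\rho^2dx)$ and $L^2([0,1];\rho^2dx)^2$. $AC([0,1])$ denotes the absolutely continuous functions on $[0,1]$. Each operator $T$ below is densely defined and closed in $L^2([0,1];\rho^2dx)$ and acts as $Tf=(i/\rho)f'$ on the set of $g\in AC([0,1])$ with $g'\in L^2([0,1];\rho^2dx)$ satisfying in addition: $g(0)=g(1)=0$ for $T_{\min}$; $g(0)=0$ for $T_0$; $g(1)=0$ for $T_1$; $g(1)=\omega g(0)$ for $T_\omega$. $T^*$ is the adjoint of $T$ in $L^2([0,1];\rho^2dx)$ (it acts as $T^*f=(i/\rho^2)(\rho f)'$). For each $T$ listed in the claim, $T^*T$ has a bounded inverse. $D$ has domain $\operatorname{dom}(T)\oplus\operatorname{dom}(T^* )$ and is self-adjoint; $D+B$ has the same domain. $\alpha/\rho^2$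 also denotes the bounded operator of multiplication by the function $\alpha/\rho^2$. For a bounded operator $S$, $\operatorname{Im}(S)=(S-S^* )/(2i)$; $\rho(\cdot)$ applied to an operator denotes the resolvent set. The operators whose traces are taken are trace class. *)

theory Defs
  imports "HOL-Analysis.Analysis"
begin

section \<open>Complex vector spaces\<close>

class complex_vs = ab_group_add +
  fixes cscale :: "complex \<Rightarrow> 'a \<Rightarrow> 'a"  (infixr \<open>*\<^sub>C\<close> 75)
  assumes cscale_add_right: "a *\<^sub>C (x + y) = a *\<^sub>C x + a *\<^sub>C y"
    and cscale_add_left: "(a + b) *\<^sub>C x = a *\<^sub>C x + b *\<^sub>C x"
    and cscale_cscale: "a *\<^sub>C (b *\<^sub>C x) = (a * b) *\<^sub>C x"
    and cscale_one: "1 *\<^sub>C x = x"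

instantiation prod :: (complex_vs, complex_vs) complex_vs
begin

definition cscale_prod_def: "c *\<^sub>C p = (c *\<^sub>C fst p, c *\<^sub>C snd p)"

instance
  by standard
    (simp_all add: cscale_prod_def prod_eq_iff cscale_add_right cscale_add_left
      cscale_cscale cscale_one)

end


section \<open>Unbounded and bounded operators in a Hilbert space\<close>

text \<open>A (possibly unbounded) operator is identified with its graph. The inverse of an operator
  is the converse \<open>S\<inverse>\<close> of its graph and the identity operator is \<^const>\<open>Id\<close>. The same vector
  space is used with several inner products, so the inner product \<open>ip\<close> (conjugate linear in the
  first argument) is an explicit parameter wherever it matters.\<close>

type_synonym 'v operator = "('v \<times> 'v) set"

definition op_add :: "'v::complex_vs operator \<Rightarrow> 'v operator \<Rightarrow> 'v operator"  (infixl \<open>+\<^sub>o\<close> 65)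
  where "S +\<^sub>o T = {(f, u + v) | f u v. (f, u) \<in> S \<and> (f, v) \<in> T}"

definition op_scale :: "complex \<Rightarrow> 'v::complex_vs operator \<Rightarrow> 'v operator"  (infixr \<open>*\<^sub>o\<close> 75)
  where "c *\<^sub>o S = {(f, c *\<^sub>C u) | f u. (f, u) \<in> S}"

definition op_diff :: "'v::complex_vs operator \<Rightarrow> 'v operator \<Rightarrow> 'v operator"  (infixl \<open>-\<^sub>o\<close> 65)
  where "S -\<^sub>o T = {(f, u - v) | f u v. (f, u) \<in> S \<and> (f, v) \<in> T}"

text \<open>Composition, in the order of operators: the right factor is applied first.\<close>

definition op_comp :: "'v operator \<Rightarrow> 'v operator \<Rightarrow> 'v operator"  (infixl \<open>\<circ>\<^sub>o\<close> 70)
  where "S \<circ>\<^sub>o T = T O S"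

definition op_zero :: "'v::complex_vs operator"
  where "op_zero = {(f, 0) | f. True}"

definition op_app :: "'v operator \<Rightarrow> 'v \<Rightarrow> 'v"
  where "op_app S f = (THE u. (f, u) \<in> S)"

definition adj_op :: "('v \<Rightarrow> 'v \<Rightarrow> complex) \<Rightarrow> 'v operator \<Rightarrow> 'v operator"
  where "adj_op ip T = {(f, h). \<forall>g k. (g, k) \<in> T \<longrightarrow> ip f k = ip h g}"

definition ip_norm :: "('v \<Rightarrow> 'v \<Rightarrow> complex) \<Rightarrow> 'v \<Rightarrow> real"
  where "ip_norm ip f = sqrt (Re (ip f f))"

text \<open>Everywhere defined bounded linear operators.\<close>

definition bounded_op :: "('v::complex_vs \<Rightarrow> 'v \<Rightarrow> complex) \<Rightarrow> 'v operator \<Rightarrow> bool"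
  where "bounded_op ip S \<longleftrightarrow>
    (\<forall>f. \<exists>!u. (f, u) \<in> S) \<and>
    (\<forall>f u g v a b. (f, u) \<in> S \<and> (g, v) \<in> S \<longrightarrow>
       (a *\<^sub>C f + b *\<^sub>C g, a *\<^sub>C u + b *\<^sub>C v) \<in> S) \<and>
    (\<exists>C. \<forall>f u. (f, u) \<in> S \<longrightarrow> ip_norm ip u \<le> C * ip_norm ip f)"

definition resolvent_set :: "('v::complex_vs \<Rightarrow> 'v \<Rightarrow> complex) \<Rightarrow> 'v operator \<Rightarrow> complex set"
  where "resolvent_set ip S = {z. bounded_op ip ((S -\<^sub>o z *\<^sub>o Id)\<inverse>)}"

definition op_Im :: "('v::complex_vs \<Rightarrow> 'v \<Rightarrow> complex) \<Rightarrow> 'v operator \<Rightarrow> 'v operator"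
  where "op_Im ip S = (1 / (2 * \<i>)) *\<^sub>o (S -\<^sub>o adj_op ip S)"

subsection \<open>Trace class operators and the trace\<close>

text \<open>An orthonormal basis is a maximal orthonormal set.\<close>

definition is_onb :: "('v::complex_vs \<Rightarrow> 'v \<Rightarrow> complex) \<Rightarrow> 'v set \<Rightarrow> bool"
  where "is_onb ip E \<longleftrightarrow>
    (\<forall>e\<in>E. \<forall>e'\<in>E. ip e e' = (if e = e' then 1 else 0)) \<and>
    (\<forall>f. (\<forall>e\<in>E. ip e f = 0) \<longrightarrow> f = 0)"

definition positive_op :: "('v \<Rightarrow> 'v \<Rightarrow> complex) \<Rightarrow> 'v operator \<Rightarrow> bool"
  where "positive_op ip P \<longleftrightarrow> (\<forall>f u. (f, u) \<in> P \<longrightarrow> ip f u \<in> \<real> \<and> 0 \<le> Re (ip f u))"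

text \<open>\<open>P\<close> is the absolute value \<open>(S\<^sup>* S)\<^bsup>1/2\<^esup>\<close> of the bounded operator \<open>S\<close>.\<close>

definition is_abs_op :: "('v::complex_vs \<Rightarrow> 'v \<Rightarrow> complex) \<Rightarrow> 'v operator \<Rightarrow> 'v operator \<Rightarrow> bool"
  where "is_abs_op ip S P \<longleftrightarrow>
    bounded_op ip P \<and> positive_op ip P \<and> P \<circ>\<^sub>o P = adj_op ip S \<circ>\<^sub>o S"

definition trace_class :: "('v::complex_vs \<Rightarrow> 'v \<Rightarrow> complex) \<Rightarrow> 'v operator \<Rightarrow> bool"
  where "trace_class ip S \<longleftrightarrow> bounded_op ip S \<and>
    (\<exists>P E. is_abs_op ip S P \<and> is_onb ip E \<and> (\<lambda>e. ip e (op_app P e)) summable_on E)"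

text \<open>The basis-independent value of \<open>\<Sum>\<^sub>e (e, S e)\<close>; meaningful for trace class operators.\<close>

definition op_trace :: "('v::complex_vs \<Rightarrow> 'v \<Rightarrow> complex) \<Rightarrow> 'v operator \<Rightarrow> complex"
  where "op_trace ip S =
    (THE t. \<forall>E. is_onb ip E \<longrightarrow> ((\<lambda>e. ip e (op_app S e)) has_sum t) E)"

subsection \<open>Orthogonal direct sum of two copies\<close>

definition ip2 :: "('v \<Rightarrow> 'v \<Rightarrow> complex) \<Rightarrow> 'v \<times> 'v \<Rightarrow> 'v \<times> 'v \<Rightarrow> complex"
  where "ip2 ip p q = ip (fst p) (fst q) + ip (snd p) (snd q)"

definition block_op ::
  "'v::complex_vs operator \<Rightarrow> 'v operator \<Rightarrow> 'v operator \<Rightarrow> 'v operator \<Rightarrow> ('v \<times> 'v) operator"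
  where "block_op S11 S12 S21 S22 =
    {((f, g), (u1 + u2, v1 + v2)) | f g u1 u2 v1 v2.
       (f, u1) \<in> S11 \<and> (g, u2) \<in> S12 \<and> (f, v1) \<in> S21 \<and> (g, v2) \<in> S22}"


section \<open>The Hilbert space \<open>L\<^sup>2([0,1]; \<rho>\<^sup>2 dx)\<close>\<close>

abbreviation leb01 :: "real measure"
  where "leb01 \<equiv> lebesgue_on {0..1}"

definition Linfty :: "(real \<Rightarrow> 'a::real_normed_vector) \<Rightarrow> bool"
  where "Linfty f \<longleftrightarrow> f \<in> borel_measurable leb01 \<and> (\<exists>C. AE x in leb01. norm (f x) \<le> C)"

definition sq_integrable :: "(real \<Rightarrow> complex) \<Rightarrow> bool"
  where "sq_integrable f \<longleftrightarrow>
    f \<in> borel_measurable leb01 \<and> integrable leb01 (\<lambda>x. (cmod (f x))\<^sup>2)"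

lemma sq_integrable_zero: "sq_integrable (\<lambda>x. 0)"
  by (simp add: sq_integrable_def)

lemma sq_integrable_cmult:
  assumes "sq_integrable f"
  shows "sq_integrable (\<lambda>x. c * f x)"
  using assms by (auto simp: sq_integrable_def norm_mult power_mult_distrib)

lemma sq_integrable_add:
  assumes f: "sq_integrable f" and g: "sq_integrable g"
  shows "sq_integrable (\<lambda>x. f x + g x)"
  unfolding sq_integrable_def
proof
  show meas: "(\<lambda>x. f x + g x) \<in> borel_measurable leb01"
    using f g by (auto simp: sq_integrable_def)
  have bound: "(cmod (f x + g x))\<^sup>2 \<le> 2 * (cmod (f x))\<^sup>2 + 2 * (cmod (g x))\<^sup>2" for x
  proof -
    have "(cmod (f x + g x))\<^sup>2 \<le> (cmod (f x) + cmod (g x))\<^sup>2"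
      by (intro power_mono norm_triangle_ineq) auto
    also have "\<dots> \<le> 2 * (cmod (f x))\<^sup>2 + 2 * (cmod (g x))\<^sup>2"
      using sum_squares_bound[of "cmod (f x)" "cmod (g x)"] by (simp add: power2_sum)
    finally show ?thesis .
  qed
  show "integrable leb01 (\<lambda>x. (cmod (f x + g x))\<^sup>2)"
  proof (rule Bochner_Integration.integrable_bound)
    show "integrable leb01 (\<lambda>x. 2 * (cmod (f x))\<^sup>2 + 2 * (cmod (g x))\<^sup>2)"
      using f g by (auto simp: sq_integrable_def)
    show "(\<lambda>x. (cmod (f x + g x))\<^sup>2) \<in> borel_measurable leb01"
      using meas by measurable
    show "AE x in leb01. norm ((cmod (f x + g x))\<^sup>2)
        \<le> norm (2 * (cmod (f x))\<^sup>2 + 2 * (cmod (g x))\<^sup>2)"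
      using bound by (intro AE_I2) auto
  qed
qed

definition l2_eq :: "(real \<Rightarrow> complex) \<Rightarrow> (real \<Rightarrow> complex) \<Rightarrow> bool"
  where "l2_eq f g \<longleftrightarrow> sq_integrable f \<and> sq_integrable g \<and> (AE x in leb01. f x = g x)"

text \<open>Since \<open>\<rho>\<close> and \<open>1/\<rho>\<close> are essentially bounded, the square integrable functions with respect
  to \<open>\<rho>\<^sup>2 dx\<close> and to \<open>dx\<close>, and the null sets of the two measures, are the same. So the vector
  space underlying \<open>L\<^sup>2([0,1]; \<rho>\<^sup>2 dx)\<close> is the type below for every \<open>\<rho>\<close>; the weight enters through
  the inner product \<open>wip \<rho>\<close>. \<open>l2_of f\<close> is the class of \<open>f\<close>, \<open>l2_fun F\<close> a representative of \<open>F\<close>.\<close>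

quotient_type l2 = "real \<Rightarrow> complex" / partial: l2_eq
  morphisms l2_fun l2_of
proof (rule part_equivpI)
  show "\<exists>f. l2_eq f f"
    using sq_integrable_zero by (auto simp: l2_eq_def)
  show "symp l2_eq"
    by (auto simp: symp_def l2_eq_def)
  show "transp l2_eq"
    by (auto simp: transp_def l2_eq_def)
qed

instantiation l2 :: complex_vs
begin

lift_definition zero_l2 :: l2 is "\<lambda>x. 0"
  by (simp add: l2_eq_def sq_integrable_zero)

lift_definition plus_l2 :: "l2 \<Rightarrow> l2 \<Rightarrow> l2" is "\<lambda>f g x. f x + g x"
  by (auto simp: l2_eq_def intro!: sq_integrable_add)

lift_definition cscale_l2 :: "complex \<Rightarrow> l2 \<Rightarrow> l2" is "\<lambda>c f x. c * f x"
  by (auto simp: l2_eq_def intro!: sq_integrable_cmult)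

definition uminus_l2 :: "l2 \<Rightarrow> l2" where "uminus_l2 F = (- 1) *\<^sub>C F"

definition minus_l2 :: "l2 \<Rightarrow> l2 \<Rightarrow> l2" where "minus_l2 F G = F + (- 1) *\<^sub>C G"

instance
proof
  fix F G H :: l2 and a b :: complex
  show "F + G + H = F + (G + H)"
    by transfer (auto simp: l2_eq_def add.assoc intro!: sq_integrable_add)
  show "F + G = G + F"
    by transfer (auto simp: l2_eq_def add.commute intro!: sq_integrable_add)
  show "0 + F = F"
    by transfer (auto simp: l2_eq_def)
  show "- F + F = 0"
    unfolding uminus_l2_def
    by transfer (auto simp: l2_eq_def sq_integrable_zero)
  show "F - G = F + - G"
    by (simp add: uminus_l2_def minus_l2_def)
  show "a *\<^sub>C (F + G) = a *\<^sub>C F + a *\<^sub>C G"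
    by transfer (auto simp: l2_eq_def distrib_left intro!: sq_integrable_add sq_integrable_cmult)
  show "(a + b) *\<^sub>C F = a *\<^sub>C F + b *\<^sub>C F"
    by transfer
      (auto simp: l2_eq_def distrib_right intro!: sq_integrable_add sq_integrable_cmult)
  show "a *\<^sub>C (b *\<^sub>C F) = (a * b) *\<^sub>C F"
    by transfer (auto simp: l2_eq_def mult.assoc intro!: sq_integrable_cmult)
  show "1 *\<^sub>C F = F"
    by transfer (auto simp: l2_eq_def)
qed

end

definition wip :: "(real \<Rightarrow> real) \<Rightarrow> l2 \<Rightarrow> l2 \<Rightarrow> complex"
  where "wip \<rho> F G =
    (LINT x|leb01. cnj (l2_fun F x) * l2_fun G x * complex_of_real ((\<rho> x)\<^sup>2))"

text \<open>Multiplication by an essentially bounded function.\<close>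

definition mult_op :: "(real \<Rightarrow> complex) \<Rightarrow> l2 operator"
  where "mult_op \<phi> = {(F, G). AE x in leb01. l2_fun G x = \<phi> x * l2_fun F x}"


section \<open>The differential operators\<close>

definition AC01 :: "(real \<Rightarrow> complex) \<Rightarrow> bool"
  where "AC01 g \<longleftrightarrow> (\<forall>\<epsilon>>0. \<exists>\<delta>>0. \<forall>J :: (real \<times> real) set.
    finite J \<and> (\<forall>(a, b)\<in>J. 0 \<le> a \<and> a < b \<and> b \<le> 1) \<and>
    pairwise (\<lambda>(a, b) (c, d). {a<..<b} \<inter> {c<..<d} = {}) J \<and>
    (\<Sum>(a, b)\<in>J. b - a) < \<delta>
    \<longrightarrow> (\<Sum>(a, b)\<in>J. cmod (g b - g a)) < \<epsilon>)"

text \<open>The operator \<open>g \<mapsto> (i/\<rho>) g'\<close> with boundary condition \<open>bc\<close> on the pair \<open>(g(0), g(1))\<close>;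
  \<open>g'\<close> is the almost everywhere defined derivative of the absolutely continuous function \<open>g\<close>.\<close>

definition diff_op :: "(real \<Rightarrow> real) \<Rightarrow> (complex \<Rightarrow> complex \<Rightarrow> bool) \<Rightarrow> l2 operator"
  where "diff_op \<rho> bc =
    {(l2_of g, l2_of (\<lambda>x. (\<i> / complex_of_real (\<rho> x)) * g' x)) | g g'.
       AC01 g \<and> (AE x in leb01. (g has_vector_derivative g' x) (at x within {0..1})) \<and>
       sq_integrable g' \<and> bc (g 0) (g 1)}"

definition T_min :: "(real \<Rightarrow> real) \<Rightarrow> l2 operator"
  where "T_min \<rho> = diff_op \<rho> (\<lambda>g0 g1. g0 = 0 \<and> g1 = 0)"

definition T_0 :: "(real \<Rightarrow> real) \<Rightarrow> l2 operator"
  where "T_0 \<rho> = diff_op \<rho> (\<lambda>g0 g1. g0 = 0)"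

definition T_1 :: "(real \<Rightarrow> real) \<Rightarrow> l2 operator"
  where "T_1 \<rho> = diff_op \<rho> (\<lambda>g0 g1. g1 = 0)"

definition T_omega :: "(real \<Rightarrow> real) \<Rightarrow> complex \<Rightarrow> l2 operator"
  where "T_omega \<rho> \<omega> = diff_op \<rho> (\<lambda>g0 g1. g1 = \<omega> * g0)"

end

theory Submission
  imports Defs
begin

text \<open>Conjugation with multiplication by \<open>\<rho>\<close> turns \<open>T\<close> into the inverse of an integral operator \<open>G\<close>
  with bounded kernel, restricted to the range of a projection (which is \<open>1\<close> unless
  \<open>T = T_min\<close>). Hence \<open>(T\<^sup>* T)\<^sup>-\<^sup>1 = G G\<^sup>*\<close> is a product of two Hilbert--Schmidt operators, and for
  small \<open>\<zeta>\<close> the resolvent \<open>R\<close> of \<open>D + B\<close> is an explicit block operator built from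
  \<open>K(\<zeta>) = (T\<^sup>* T - \<zeta>\<^sup>2 - i \<zeta> M)\<^sup>-\<^sup>1\<close>, where \<open>M\<close> is multiplication by \<open>\<alpha>/\<rho>\<^sup>2\<close>. It satisfies
  \<open>Im R = J (M \<oplus> 0) J\<^sup>*\<close> with \<open>J\<close> Hilbert--Schmidt, so cyclicity of the trace gives the trace
  identity. A Neumann series for \<open>K\<close> gives the power series in \<open>\<zeta>\<close>; since \<open>M\<close> is self-adjoint,
  \<open>K(\<zeta>)\<^sup>* = K(-\<zeta>)\<close>, and this removes the odd coefficients from the imaginary part of the trace.
  Finally, Parseval's identity evaluates \<open>tr (M G G\<^sup>*)\<close> as the integral of \<open>\<alpha>/\<rho>\<^sup>2\<close> against the
  squared norms of the rows of the kernel of \<open>G\<close>.\<close>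

section \<open>Complex Hilbert spaces and the algebra of their bounded operators\<close>

text \<open>Off the diagonal the resolvent of D + B contains \<open>G\<close>, which is only known
  to be Hilbert--Schmidt. Its trace therefore cannot be formed first and then split into real and
  imaginary parts; the imaginary part has to be factored as an operator before any trace is taken.
  Since B has a single entry, in the upper left corner, only the first column of the resolvent
  enters this factor. The projection \<open>P\<close> is forced by the minimal operator: its range
  has codimension one, so the adjoint has a kernel, on which the resolvent is -1/\<zeta>. This
  contribution is self-adjoint and drops out of the imaginary part. Two obstacles come from the
  definitions. An orthonormal basis is any maximal orthonormal set, so Parseval's identity, basis
  independence and the exchange of sum and integral must cope with possibly uncountable index sets.
  And trace class is defined through the absolute value, so for a product of two Hilbert--Schmidt
  operators the absolute value has to be constructed and its diagonal shown summable; this is done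
  with the power series of 1 - sqrt(1 - x), whose coefficients are nonnegative with sum at most
  1.\<close>

class complex_hilbert = complex_vs + real_inner + complete_space +
  assumes scaleR_cscale: "r *\<^sub>R x = complex_of_real r *\<^sub>C x"
    and inner_imaginary_unit: "inner (\<i> *\<^sub>C x) (\<i> *\<^sub>C y) = inner x y"
    and nontrivial: "\<exists>x. x \<noteq> 0"

instance complex_hilbert \<subseteq> banach ..

lemma cscale_zero_right [simp]: "c *\<^sub>C (0::'a::complex_vs) = 0"
  using cscale_add_right[of c 0 "0::'a"] by simp

lemma cscale_zero_left [simp]: "0 *\<^sub>C (x::'a::complex_vs) = 0"
  using cscale_add_left[of 0 0 x] by simp

lemma cscale_minus_left: "(- c) *\<^sub>C (x::'a::complex_vs) = - (c *\<^sub>C x)"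
  using cscale_add_left[of "- c" c x] by (simp add: eq_neg_iff_add_eq_0)

lemma cscale_cartesian:
  "c *\<^sub>C (x::'a::complex_hilbert) = Re c *\<^sub>R x + Im c *\<^sub>R (\<i> *\<^sub>C x)"
  by (metis scaleR_cscale cscale_add_left cscale_cscale complex_eq mult.commute)

text \<open>Conjugate linearity in the first argument makes the imaginary part of the product of x
  and y equal to the real part of the product of ix and y, so the real inner product determines the
  complex one. Taking the real one as primitive makes the topology of real inner product spaces
  available.\<close>

definition cip :: "'a::complex_hilbert \<Rightarrow> 'a \<Rightarrow> complex"
  where "cip x y = Complex (inner x y) (inner (\<i> *\<^sub>C x) y)"

lemma inner_imaginary_unit_left:
  "inner (\<i> *\<^sub>C x) (y::'a::complex_hilbert) = - inner x (\<i> *\<^sub>C y)"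
proof -
  have "inner (\<i> *\<^sub>C x) y = inner (\<i> *\<^sub>C \<i> *\<^sub>C x) (\<i> *\<^sub>C y)"
    by (simp add: inner_imaginary_unit)
  also have "\<dots> = inner (- x) (\<i> *\<^sub>C y)"
    by (simp add: cscale_cscale cscale_minus_left cscale_one)
  finally show ?thesis by simp
qed

lemma cip_commute: "cip y x = cnj (cip x y)"
  using inner_imaginary_unit_left[of x y] inner_commute[of "\<i> *\<^sub>C y" x]
  by (simp add: cip_def complex_eq_iff inner_commute)

lemma cip_add_right: "cip x (y + z) = cip x y + cip x z"
  by (simp add: cip_def complex_eq_iff inner_add_right)

lemma cip_cscale_right: "cip x (c *\<^sub>C y) = c * cip x y"
  unfolding cscale_cartesian[of c]
  by (simp add: cip_def complex_eq_iff inner_add_right inner_imaginary_unit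
      inner_imaginary_unit_left[of x y])

lemma cip_add_left: "cip (x + y) z = cip x z + cip y z"
  by (metis cip_add_right cip_commute complex_cnj_add)

lemma cip_cscale_left: "cip (c *\<^sub>C x) y = cnj c * cip x y"
  by (metis cip_cscale_right cip_commute complex_cnj_mult)

lemma cip_zero [simp]: "cip x 0 = 0" "cip 0 x = 0"
  by (simp_all add: cip_def zero_complex.code)

lemma cip_minus_right: "cip x (- y) = - cip x y"
  by (simp add: cip_def complex_eq_iff)

lemma cip_minus_left: "cip (- x) y = - cip x y"
  by (metis cip_minus_right cip_commute complex_cnj_minus)

lemma cip_diff_right: "cip x (y - z) = cip x y - cip x z"
  by (simp add: cip_def complex_eq_iff inner_diff_right)

lemma cip_diff_left: "cip (x - y) z = cip x z - cip y z"
  by (metis cip_diff_right cip_commute complex_cnj_diff)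

lemma cip_sum_right: "cip x (\<Sum>i\<in>A. f i) = (\<Sum>i\<in>A. cip x (f i))"
  by (induction A rule: infinite_finite_induct) (auto simp: cip_add_right)

lemma cip_sum_left: "cip (\<Sum>i\<in>A. f i) x = (\<Sum>i\<in>A. cip (f i) x)"
  by (induction A rule: infinite_finite_induct) (auto simp: cip_add_left)

lemma cip_self: "cip x x = complex_of_real ((norm x)\<^sup>2)"
proof -
  have "inner (\<i> *\<^sub>C x) x = 0"
    using inner_imaginary_unit_left[of x x] by (simp add: inner_commute)
  then show ?thesis
    by (simp add: cip_def complex_eq_iff power2_norm_eq_inner)
qed

lemma Re_cip: "Re (cip x y) = inner x y"
  by (simp add: cip_def)

lemma norm_cscale: "norm (c *\<^sub>C x) = cmod c * norm (x::'a::complex_hilbert)"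
proof -
  have "complex_of_real ((norm (c *\<^sub>C x))\<^sup>2) = (c * cnj c) * complex_of_real ((norm x)\<^sup>2)"
    by (simp only: cip_self[symmetric] cip_cscale_left cip_cscale_right mult_ac)
  also have "\<dots> = complex_of_real ((cmod c)\<^sup>2 * (norm x)\<^sup>2)"
    by (simp only: complex_norm_square[symmetric] of_real_mult)
  finally have "(norm (c *\<^sub>C x))\<^sup>2 = (cmod c * norm x)\<^sup>2"
    unfolding of_real_eq_iff by (simp add: power_mult_distrib)
  then show ?thesis
    by (simp add: power2_eq_iff_nonneg)
qed

text \<open>A unimodular multiple of y makes the inner product real and nonnegative, and the real
  Cauchy--Schwarz inequality applies to it.\<close>

lemma cmod_cip_le: "cmod (cip x y) \<le> norm x * norm y"
proof (cases "cip x y = 0")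
  case False
  define c where "c = cnj (cip x y) / cmod (cip x y)"
  have c: "cmod c = 1"
    using False by (simp add: c_def norm_divide)
  have "cip x (c *\<^sub>C y) = (cip x y * cnj (cip x y)) / cmod (cip x y)"
    by (simp add: cip_cscale_right c_def)
  also have "\<dots> = cmod (cip x y)"
    unfolding complex_norm_square[symmetric] using False by (simp add: power2_eq_square)
  finally have "cmod (cip x y) = inner x (c *\<^sub>C y)"
    by (metis Re_complex_of_real Re_cip)
  also have "\<dots> \<le> norm x * norm (c *\<^sub>C y)"
    by (rule norm_cauchy_schwarz)
  finally show ?thesis
    by (simp add: norm_cscale c)
qed simp

lemma cip_eqI:
  assumes "\<And>z. cip z x = cip z y"
  shows "x = y"
proof -
  have "cip (x - y) (x - y) = 0"
    by (simp add: cip_diff_right assms)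
  then show ?thesis
    by (simp add: cip_self)
qed

lemma bounded_bilinear_cip: "bounded_bilinear cip"
proof
  fix x y z :: 'a and r :: real
  show "cip (x + y) z = cip x z + cip y z" "cip x (y + z) = cip x y + cip x z"
    by (simp_all add: cip_add_left cip_add_right)
  show "cip (r *\<^sub>R x) y = r *\<^sub>R cip x y" "cip x (r *\<^sub>R y) = r *\<^sub>R cip x y"
    by (simp_all add: scaleR_cscale[of r x] scaleR_cscale[of r y] cip_cscale_left
        cip_cscale_right scaleR_conv_of_real)
  show "\<exists>K. \<forall>(a::'a) b. norm (cip a b) \<le> norm a * norm b * K"
    by (rule exI[of _ 1]) (simp add: cmod_cip_le)
qed

lemmas tendsto_cip = bounded_bilinear.tendsto[OF bounded_bilinear_cip]

instance prod :: (complex_hilbert, complex_hilbert) complex_hilbert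
proof
  fix r :: real and x y :: "'a \<times> 'b"
  show "r *\<^sub>R x = complex_of_real r *\<^sub>C x"
    by (simp add: cscale_prod_def scaleR_cscale prod_eq_iff)
  show "inner (\<i> *\<^sub>C x) (\<i> *\<^sub>C y) = inner x y"
    by (simp add: cscale_prod_def inner_imaginary_unit inner_prod_def)
  obtain z :: 'a where "z \<noteq> 0" using nontrivial by blast
  then show "\<exists>x::'a \<times> 'b. x \<noteq> 0"
    by (intro exI[of _ "(z, 0)"]) (auto simp: zero_prod_def)
qed

lemma cip_prod: "cip p q = cip (fst p) (fst q) + cip (snd p) (snd q)"
  by (simp add: cip_def complex_eq_iff inner_prod_def cscale_prod_def)

text \<open>The operators of the following type are those with an adjoint (which is automatic, but the
  Riesz representation theorem is not needed when adjoints are supplied explicitly).\<close>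

definition is_adjoint :: "('a::complex_hilbert \<Rightarrow>\<^sub>L 'a) \<Rightarrow> ('a \<Rightarrow>\<^sub>L 'a) \<Rightarrow> bool"
  where "is_adjoint s s' \<longleftrightarrow> (\<forall>x y. cip (blinfun_apply s' x) y = cip x (blinfun_apply s y))"

definition adjointable :: "('a::complex_hilbert \<Rightarrow>\<^sub>L 'a) \<Rightarrow> bool"
  where "adjointable s \<longleftrightarrow> (\<exists>s'. is_adjoint s s')"

lemma adjointableI:
  fixes s :: "'a::complex_hilbert \<Rightarrow>\<^sub>L 'a"
  assumes "\<And>x y. cip (blinfun_apply s' x) y = cip x (blinfun_apply s y)"
  shows "adjointable s"
  unfolding adjointable_def is_adjoint_def using assms by blast

lemma is_adjoint_sym: "is_adjoint s t \<Longrightarrow> is_adjoint t s"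
  unfolding is_adjoint_def by (metis cip_commute)

section \<open>The normed algebra of operators with an adjoint\<close>

typedef (overloaded) 'a cbo = "{s :: 'a::complex_hilbert \<Rightarrow>\<^sub>L 'a. adjointable s}"
  by (rule exI[of _ 0]) (auto intro: adjointableI[of 0])

setup_lifting type_definition_cbo

lift_definition app :: "'a::complex_hilbert cbo \<Rightarrow> 'a \<Rightarrow> 'a" is blinfun_apply .

lift_definition star :: "'a::complex_hilbert cbo \<Rightarrow> 'a cbo" is "\<lambda>s. SOME s'. is_adjoint s s'"
  unfolding adjointable_def by (blast intro: is_adjoint_sym someI_ex)

lemma cip_star_left: "cip (app (star s) x) y = cip x (app s y)"
proof -
  have "is_adjoint (Rep_cbo s) (Rep_cbo (star s))"
    using Rep_cbo[of s] unfolding star.rep_eq adjointable_def by (auto intro: someI_ex)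
  then show ?thesis
    by (simp add: is_adjoint_def app.rep_eq)
qed

lemma cip_star_right: "cip x (app (star s) y) = cip (app s x) y"
  by (metis cip_star_left cip_commute)

lemma cbo_eqI: "(\<And>x. app s x = app t x) \<Longrightarrow> s = t"
  by transfer (rule blinfun_eqI)

lemma star_unique:
  assumes "\<And>x y. cip (app t x) y = cip x (app s y)"
  shows "star s = t"
  by (rule cbo_eqI, rule cip_eqI) (metis assms cip_star_left cip_commute)

lemma star_star [simp]: "star (star s) = s"
  by (rule star_unique) (simp add: cip_star_right)

instantiation cbo :: (complex_hilbert) ring_1
begin

lift_definition zero_cbo :: "'a cbo" is 0
  by (rule adjointableI[of 0]) simp

lift_definition one_cbo :: "'a cbo" is id_blinfun
  by (rule adjointableI[of id_blinfun]) simp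

lift_definition plus_cbo :: "'a cbo \<Rightarrow> 'a cbo \<Rightarrow> 'a cbo" is "(+)"
proof -
  fix s t :: "'a \<Rightarrow>\<^sub>L 'a"
  assume "adjointable s" "adjointable t"
  then obtain s' t' where "\<forall>x y. cip (blinfun_apply s' x) y = cip x (blinfun_apply s y)"
      "\<forall>x y. cip (blinfun_apply t' x) y = cip x (blinfun_apply t y)"
    unfolding adjointable_def is_adjoint_def by blast
  then show "adjointable (s + t)"
    by (intro adjointableI[of "s' + t'"])
      (simp add: blinfun.add_left cip_add_left cip_add_right)
qed

lift_definition minus_cbo :: "'a cbo \<Rightarrow> 'a cbo \<Rightarrow> 'a cbo" is "(-)"
proof -
  fix s t :: "'a \<Rightarrow>\<^sub>L 'a"
  assume "adjointable s" "adjointable t"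
  then obtain s' t' where "\<forall>x y. cip (blinfun_apply s' x) y = cip x (blinfun_apply s y)"
      "\<forall>x y. cip (blinfun_apply t' x) y = cip x (blinfun_apply t y)"
    unfolding adjointable_def is_adjoint_def by blast
  then show "adjointable (s - t)"
    by (intro adjointableI[of "s' - t'"])
      (simp add: blinfun.diff_left cip_diff_left cip_diff_right)
qed

lift_definition uminus_cbo :: "'a cbo \<Rightarrow> 'a cbo" is uminus
proof -
  fix s :: "'a \<Rightarrow>\<^sub>L 'a"
  assume "adjointable s"
  then obtain s' where "\<forall>x y. cip (blinfun_apply s' x) y = cip x (blinfun_apply s y)"
    unfolding adjointable_def is_adjoint_def by blast
  then show "adjointable (- s)"
    by (intro adjointableI[of "- s'"])
      (simp add: blinfun.minus_left cip_minus_left cip_minus_right)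
qed

lift_definition times_cbo :: "'a cbo \<Rightarrow> 'a cbo \<Rightarrow> 'a cbo" is "(o\<^sub>L)"
proof -
  fix s t :: "'a \<Rightarrow>\<^sub>L 'a"
  assume "adjointable s" "adjointable t"
  then obtain s' t' where "\<forall>x y. cip (blinfun_apply s' x) y = cip x (blinfun_apply s y)"
      "\<forall>x y. cip (blinfun_apply t' x) y = cip x (blinfun_apply t y)"
    unfolding adjointable_def is_adjoint_def by blast
  then show "adjointable (s o\<^sub>L t)"
    by (intro adjointableI[of "t' o\<^sub>L s'"]) simp
qed

instance
proof
  fix a b c :: "'a cbo"
  show "a * b * c = a * (b * c)"
    by transfer (rule blinfun_eqI, simp)
  show "1 * a = a" "a * 1 = a"
    by (transfer, rule blinfun_eqI, simp)+
  show "a + b + c = a + (b + c)" "a + b = b + a" "0 + a = a" "- a + a = 0" "a - b = a + - b"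
    by (transfer, simp add: algebra_simps)+
  show "(a + b) * c = a * c + b * c" "a * (b + c) = a * b + a * c"
    by (transfer, rule blinfun_eqI, simp add: blinfun.add_left blinfun.add_right)+
  obtain z :: 'a where "z \<noteq> 0" using nontrivial by blast
  then have "blinfun_apply 0 z \<noteq> blinfun_apply id_blinfun z" by simp
  then have "(0 :: 'a \<Rightarrow>\<^sub>L 'a) \<noteq> id_blinfun" by metis
  then show "(0::'a cbo) \<noteq> 1"
    by transfer
qed

end

instantiation cbo :: (complex_hilbert) real_vector
begin

lift_definition scaleR_cbo :: "real \<Rightarrow> 'a cbo \<Rightarrow> 'a cbo" is "scaleR"
proof -
  fix r and s :: "'a \<Rightarrow>\<^sub>L 'a"
  assume "adjointable s"
  then obtain s' where "\<forall>x y. cip (blinfun_apply s' x) y = cip x (blinfun_apply s y)"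
    unfolding adjointable_def is_adjoint_def by blast
  then show "adjointable (r *\<^sub>R s)"
    by (intro adjointableI[of "r *\<^sub>R s'"])
      (simp add: blinfun.scaleR_left bounded_bilinear.scaleR_left[OF bounded_bilinear_cip]
        bounded_bilinear.scaleR_right[OF bounded_bilinear_cip])
qed

instance
  by standard (transfer, simp add: algebra_simps)+

end

instantiation cbo :: (complex_hilbert) real_normed_algebra_1
begin

lift_definition norm_cbo :: "'a cbo \<Rightarrow> real" is norm .

definition dist_cbo :: "'a cbo \<Rightarrow> 'a cbo \<Rightarrow> real" where "dist_cbo s t = norm (s - t)"
definition sgn_cbo :: "'a cbo \<Rightarrow> 'a cbo" where "sgn_cbo s = inverse (norm s) *\<^sub>R s"
definition uniformity_cbo :: "('a cbo \<times> 'a cbo) filter"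
  where "uniformity_cbo = (INF e\<in>{0 <..}. principal {(x, y). dist x y < e})"
definition open_cbo :: "'a cbo set \<Rightarrow> bool"
  where "open_cbo S = (\<forall>x\<in>S. \<forall>\<^sub>F (x', y) in uniformity. x' = x \<longrightarrow> y \<in> S)"

instance
proof
  fix s t u :: "'a cbo" and a b :: real and U :: "'a cbo set"
  show "dist s t = norm (s - t)" "sgn s = s /\<^sub>R norm s"
    "uniformity = (INF e\<in>{0 <..}. principal {(x, y :: 'a cbo). dist x y < e})"
    "open U = (\<forall>x\<in>U. \<forall>\<^sub>F (x', y) in uniformity. x' = x \<longrightarrow> y \<in> U)"
    by (simp_all add: dist_cbo_def sgn_cbo_def uniformity_cbo_def open_cbo_def)
  show "(norm s = 0) = (s = 0)" "norm (s + t) \<le> norm s + norm t" "norm (a *\<^sub>R s) = \<bar>a\<bar> * norm s"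
    by (transfer, simp add: norm_triangle_ineq)+
  show "norm (s * t) \<le> norm s * norm t"
    by transfer (rule norm_blinfun_compose)
  show "a *\<^sub>R s * t = a *\<^sub>R (s * t)" "s * a *\<^sub>R t = a *\<^sub>R (s * t)"
    by (transfer, rule blinfun_eqI, simp add: blinfun.scaleR_left blinfun.scaleR_right)+
  obtain z :: 'a where z: "z \<noteq> 0" using nontrivial by blast
  have "norm (id_blinfun :: 'a \<Rightarrow>\<^sub>L 'a) = 1"
  proof (rule antisym)
    show "norm (id_blinfun :: 'a \<Rightarrow>\<^sub>L 'a) \<le> 1"
      by (rule norm_blinfun_bound) auto
    show "1 \<le> norm (id_blinfun :: 'a \<Rightarrow>\<^sub>L 'a)"
      using norm_blinfun[of id_blinfun z] z by simp
  qed
  then show "norm (1 :: 'a cbo) = 1"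
    by transfer
qed

end

lemma app_simps [simp]:
  "app 0 x = 0" "app 1 x = x" "app (s + t) x = app s x + app t x"
  "app (s - t) x = app s x - app t x" "app (- s) x = - app s x"
  "app (s * t) x = app s (app t x)" "app (r *\<^sub>R s) x = r *\<^sub>R app s x"
  by (transfer, simp add: blinfun.add_left blinfun.diff_left blinfun.minus_left
      blinfun.scaleR_left)+

text \<open>The underlying maps are only real linear by their type; an adjoint with respect to the
  complex inner product forces complex linearity.\<close>

lemma app_cscale [simp]: "app s (c *\<^sub>C x) = c *\<^sub>C app s x"
  by (rule cip_eqI) (simp flip: cip_star_left add: cip_cscale_right)

lemma app_linear [simp]:
  "app s (x + y) = app s x + app s y" "app s (x - y) = app s x - app s y" "app s 0 = 0"
  "app s (- x) = - app s x"
  by (transfer, simp add: blinfun.add_right blinfun.diff_right blinfun.minus_right)+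

lemma app_scaleR [simp]: "app s (r *\<^sub>R x) = r *\<^sub>R app s x"
  by (simp add: scaleR_cscale)

lemma norm_app: "norm (app s x) \<le> norm s * norm x"
  by transfer (rule norm_blinfun)

lemma norm_cbo_le: "0 \<le> b \<Longrightarrow> (\<And>x. norm (app s x) \<le> b * norm x) \<Longrightarrow> norm s \<le> b"
  by transfer (rule norm_blinfun_bound)

lemma bounded_linear_app: "bounded_linear (app s)"
  by transfer (rule blinfun.bounded_linear_right)

lemma bounded_linear_app_left: "bounded_linear (\<lambda>s. app s x)"
  by (rule bounded_linear_intro[of _ "norm x"])
     (auto intro: order.trans[OF norm_app] simp: mult.commute)

lemma star_simps [simp]:
  "star 0 = 0" "star 1 = 1" "star (s + t) = star s + star t" "star (s - t) = star s - star t"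
  "star (- s) = - star s" "star (s * t) = star t * star s" "star (r *\<^sub>R s) = r *\<^sub>R star s"
  by (rule star_unique;
      simp add: cip_add_left cip_add_right cip_diff_left cip_diff_right cip_minus_left
        cip_minus_right cip_star_left scaleR_cscale[of r] cip_cscale_left cip_cscale_right)+

text \<open>The squared norm of \<open>app (star s) x\<close> is the inner product of
  \<open>app s (app (star s) x)\<close> with x; one factor cancels, and applying the resulting bound
  to \<open>star s\<close> as well gives equality.\<close>

lemma norm_star: "norm (star s) = norm s"
proof -
  have "norm (star s) \<le> norm s" for s :: "'a cbo"
  proof (rule norm_cbo_le)
    fix x
    have "(norm (app (star s) x))\<^sup>2 = cmod (cip (app (star s) x) (app (star s) x))"
      by (simp only: cip_self norm_of_real abs_power2)
    also have "\<dots> = cmod (cip (app s (app (star s) x)) x)"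
      by (simp add: cip_star_right)
    also have "\<dots> \<le> norm (app s (app (star s) x)) * norm x"
      by (rule cmod_cip_le)
    also have "\<dots> \<le> norm s * norm (app (star s) x) * norm x"
      by (intro mult_right_mono norm_app) auto
    finally have "norm (app (star s) x) * norm (app (star s) x) \<le> norm s * norm x * norm (app (star s) x)"
      by (simp add: power2_eq_square mult_ac)
    then show "norm (app (star s) x) \<le> norm s * norm x"
      by (cases "norm (app (star s) x) = 0") (auto simp: mult_le_cancel_right)
  qed simp
  from this[of s] this[of "star s"] show ?thesis by simp
qed

text \<open>Because \<open>star\<close> is isometric, the adjoints of a Cauchy sequence converge
  too, and the limit of the adjoint relation shows that the limit operator has an adjoint.\<close>

instance cbo :: (complex_hilbert) banach
proof
  fix X :: "nat \<Rightarrow> 'a cbo"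
  assume X: "Cauchy X"
  have rep: "Cauchy (\<lambda>n. Rep_cbo (Y n))" if "Cauchy Y" for Y :: "nat \<Rightarrow> 'a cbo"
    using that unfolding Cauchy_def dist_norm minus_cbo.rep_eq[symmetric] norm_cbo.rep_eq[symmetric] .
  have star_X: "Cauchy (\<lambda>n. star (X n))"
    using X unfolding Cauchy_def dist_norm star_simps(4)[symmetric] norm_star .
  obtain s where s: "(\<lambda>n. Rep_cbo (X n)) \<longlonglongrightarrow> s"
    using Cauchy_convergent[OF rep[OF X]] by (auto simp: convergent_def)
  obtain s' where s': "(\<lambda>n. Rep_cbo (star (X n))) \<longlonglongrightarrow> s'"
    using Cauchy_convergent[OF rep[OF star_X]] by (auto simp: convergent_def)
  have "adjointable s"
  proof (rule adjointableI)
    fix x y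
    have "(\<lambda>n. cip (blinfun_apply (Rep_cbo (star (X n))) x) y) \<longlonglongrightarrow> cip (blinfun_apply s' x) y"
      by (intro tendsto_cip blinfun.tendsto tendsto_const s')
    moreover have "(\<lambda>n. cip x (blinfun_apply (Rep_cbo (X n)) y)) \<longlonglongrightarrow> cip x (blinfun_apply s y)"
      by (intro tendsto_cip blinfun.tendsto tendsto_const s)
    moreover have "cip (blinfun_apply (Rep_cbo (star (X n))) x) y =
        cip x (blinfun_apply (Rep_cbo (X n)) y)" for n
      using cip_star_left[of "X n" x y] by (simp add: app.rep_eq)
    ultimately show "cip (blinfun_apply s' x) y = cip x (blinfun_apply s y)"
      using LIMSEQ_unique by fastforce
  qed
  then have "Rep_cbo (Abs_cbo s) = s"
    by (simp add: Abs_cbo_inverse)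
  then have "X \<longlonglongrightarrow> Abs_cbo s"
    using s unfolding tendsto_iff dist_norm by (simp add: minus_cbo.rep_eq norm_cbo.rep_eq)
  then show "convergent X"
    by (auto simp: convergent_def)
qed

text \<open>Complex multiples in the operator algebra are products with central elements.\<close>

lift_definition scal :: "complex \<Rightarrow> 'a::complex_hilbert cbo" is "\<lambda>c. Blinfun (\<lambda>x. c *\<^sub>C x)"
proof -
  fix c :: complex
  have bl: "bounded_linear (\<lambda>x::'a. c *\<^sub>C x)" for c
    by (rule bounded_linear_intro[of _ "cmod c"])
      (auto simp: cscale_add_right scaleR_cscale cscale_cscale norm_cscale mult.commute)
  show "adjointable (Blinfun (\<lambda>x::'a. c *\<^sub>C x))"
    by (rule adjointableI[of "Blinfun (\<lambda>x. cnj c *\<^sub>C x)"])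
      (simp add: bounded_linear_Blinfun_apply bl cip_cscale_left cip_cscale_right)
qed

lemma app_scal [simp]: "app (scal c) x = c *\<^sub>C x"
proof (transfer fixing: c x)
  have bl: "bounded_linear (\<lambda>x::'a. c *\<^sub>C x)"
    by (rule bounded_linear_intro[of _ "cmod c"])
      (auto simp: cscale_add_right scaleR_cscale cscale_cscale norm_cscale mult.commute)
  then show "blinfun_apply (Blinfun (\<lambda>x. c *\<^sub>C x)) x = c *\<^sub>C x"
    by (simp add: bounded_linear_Blinfun_apply)
qed

lemma scal_simps:
  "scal (a + b) = scal a + scal b" "scal (a * b) = scal a * scal b"
  "scal 1 = 1" "scal 0 = 0" "scal (- a) = - scal a" "scal (complex_of_real r) = r *\<^sub>R 1"
  "scal (a - b) = scal a - scal b"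
  using cscale_add_left[of a "- b"]
  by (auto intro!: cbo_eqI simp: cscale_add_left cscale_cscale cscale_one cscale_minus_left
      scaleR_cscale mult.commute)

lemma star_scal [simp]: "star (scal c) = scal (cnj c)"
  by (rule star_unique) (simp add: cip_cscale_left cip_cscale_right)

lemma scal_commute: "s * scal c = scal c * s"
  by (rule cbo_eqI) simp

section \<open>Orthonormal bases, Hilbert--Schmidt operators and traces\<close>

definition orthonormal :: "'a::complex_hilbert set \<Rightarrow> bool"
  where "orthonormal E \<longleftrightarrow> (\<forall>e\<in>E. \<forall>e'\<in>E. cip e e' = (if e = e' then 1 else 0))"

lemma orthonormal_subset: "orthonormal E \<Longrightarrow> F \<subseteq> E \<Longrightarrow> orthonormal F"
  unfolding orthonormal_def by (meson subsetD)

lemma is_onb_orthonormal: "is_onb cip E \<Longrightarrow> orthonormal E"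
  by (simp add: is_onb_def orthonormal_def)

lemma orthonormal_norm:
  assumes "orthonormal E" "e \<in> E"
  shows "norm e = 1"
proof -
  have "complex_of_real ((norm e)\<^sup>2) = 1"
    using assms unfolding cip_self[symmetric] orthonormal_def by auto
  then have "(norm e)\<^sup>2 = 1"
    by (simp only: of_real_eq_1_iff)
  then show ?thesis
    by (simp add: power2_eq_1_iff) (smt (verit) norm_ge_zero)
qed

lemma cip_orthonormal_sum:
  assumes "orthonormal F" "finite F" "e \<in> F"
  shows "cip e (\<Sum>f\<in>F. c f *\<^sub>C f) = c e"
proof -
  have "cip e (\<Sum>f\<in>F. c f *\<^sub>C f) = (\<Sum>f\<in>F. if f = e then c f else 0)"
    unfolding cip_sum_right cip_cscale_right
    using assms by (intro sum.cong) (auto simp: orthonormal_def)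
  then show ?thesis
    using assms by simp
qed

lemma norm_orthonormal_sum:
  assumes "orthonormal F" "finite F"
  shows "(norm (\<Sum>e\<in>F. c e *\<^sub>C e))\<^sup>2 = (\<Sum>e\<in>F. (cmod (c e))\<^sup>2)"
proof -
  have "complex_of_real ((norm (\<Sum>e\<in>F. c e *\<^sub>C e))\<^sup>2) = (\<Sum>e\<in>F. cnj (c e) * c e)"
    unfolding cip_self[symmetric] cip_sum_left cip_cscale_left
    using assms by (intro sum.cong) (simp_all add: cip_orthonormal_sum)
  also have "\<dots> = complex_of_real (\<Sum>e\<in>F. (cmod (c e))\<^sup>2)"
    by (simp only: of_real_sum complex_norm_square mult.commute)
  finally show ?thesis
    by (simp only: of_real_eq_iff)
qed

lemma bessel_finite:
  assumes "orthonormal F" "finite F"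
  shows "(\<Sum>e\<in>F. (cmod (cip e x))\<^sup>2) \<le> (norm x)\<^sup>2"
proof -
  define y where "y = (\<Sum>e\<in>F. cip e x *\<^sub>C e)"
  have norm_y: "(norm y)\<^sup>2 = (\<Sum>e\<in>F. (cmod (cip e x))\<^sup>2)"
    unfolding y_def by (rule norm_orthonormal_sum[OF assms])
  have "cip y x = (\<Sum>e\<in>F. cnj (cip e x) * cip e x)"
    by (simp add: y_def cip_sum_left cip_cscale_left)
  also have "\<dots> = complex_of_real ((norm y)\<^sup>2)"
    by (simp only: norm_y of_real_sum complex_norm_square mult.commute)
  finally have "inner y x = (norm y)\<^sup>2"
    by (metis Re_cip Re_complex_of_real)
  moreover have "0 \<le> (norm (x - y))\<^sup>2" by simp
  ultimately have "0 \<le> (norm x)\<^sup>2 - (norm y)\<^sup>2"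
    by (simp add: power2_norm_eq_inner inner_diff_left inner_diff_right inner_commute)
  then show ?thesis by (simp add: norm_y)
qed

lemma bessel_summable:
  assumes "orthonormal E"
  shows "(\<lambda>e. (cmod (cip e x))\<^sup>2) summable_on E"
    and "(\<Sum>\<^sub>\<infinity>e\<in>E. (cmod (cip e x))\<^sup>2) \<le> (norm x)\<^sup>2"
proof -
  have *: "(\<Sum>e\<in>F. (cmod (cip e x))\<^sup>2) \<le> (norm x)\<^sup>2" if "finite F" "F \<subseteq> E" for F
    by (rule bessel_finite) (use that assms orthonormal_subset in auto)
  show summable: "(\<lambda>e. (cmod (cip e x))\<^sup>2) summable_on E"
    by (rule nonneg_bdd_above_summable_on) (use * in \<open>auto intro!: bdd_aboveI[of _ "(norm x)\<^sup>2"]\<close>)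
  show "(\<Sum>\<^sub>\<infinity>e\<in>E. (cmod (cip e x))\<^sup>2) \<le> (norm x)\<^sup>2"
    by (rule infsum_le_finite_sums[OF summable]) (use * in auto)
qed

lemma countable_finite_exhaustion:
  assumes "countable A"
  shows "\<exists>F :: nat \<Rightarrow> 'a set. (\<forall>n. finite (F n)) \<and> (\<forall>n. F n \<subseteq> A) \<and> incseq F \<and> (\<Union>n. F n) = A"
proof (intro exI conjI allI)
  let ?F = "\<lambda>n. {a \<in> A. to_nat_on A a < n}"
  show "finite (?F n)" for n
  proof (rule inj_on_finite[of "to_nat_on A" _ "{..<n}"])
    show "inj_on (to_nat_on A) (?F n)"
      using inj_on_to_nat_on[OF assms] by (rule inj_on_subset) auto
  qed auto
  show "?F n \<subseteq> A" for n by auto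
  show "incseq ?F" by (auto simp: incseq_def)
  show "(\<Union>n. ?F n) = A" by auto
qed

text \<open>Only countably many coefficients are nonzero, so the expansion of x can be summed along
  a sequence of finite sets. By Pythagoras the partial sums are Cauchy, and x minus their limit is
  orthogonal to E, hence 0 by maximality. Bessel's inequality is the other half.\<close>

lemma parseval:
  assumes E: "is_onb cip E"
  shows "((\<lambda>e. (cmod (cip e x))\<^sup>2) has_sum (norm x)\<^sup>2) E"
proof -
  let ?c = "\<lambda>e. cip e x"
  note on = is_onb_orthonormal[OF E]
  note summable = bessel_summable(1)[OF on, of x]
  have "countable {e \<in> E. (cmod (?c e))\<^sup>2 \<noteq> 0}"
    by (rule summable_countable_real) (use summable in auto)
  then have "countable {e \<in> E. ?c e \<noteq> 0}" by simp
  from countable_finite_exhaustion[OF this] obtain F where F': "\<forall>n. finite (F n)"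
      "\<forall>n. F n \<subseteq> {e \<in> E. ?c e \<noteq> 0}" "incseq F" "(\<Union>n. F n) = {e \<in> E. ?c e \<noteq> 0}"
    by (elim exE conjE)
  note F = F'(1,2)[rule_format] F'(3,4)
  define a where "a n = (\<Sum>e\<in>F n. (cmod (?c e))\<^sup>2)" for n
  define y where "y n = (\<Sum>e\<in>F n. ?c e *\<^sub>C e)" for n
  have onF: "orthonormal (F n)" for n
    using on F(2) orthonormal_subset by blast
  have a_inc: "incseq a"
    unfolding a_def incseq_def using F(1,3) by (auto intro!: sum_mono2 dest: incseqD)
  have "a n \<le> (norm x)\<^sup>2" for n
    unfolding a_def by (rule bessel_finite[OF onF F(1)])
  then have "convergent a"
    using a_inc by (metis incseq_convergent convergentI)
  then have a_Cauchy: "Cauchy a"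
    by (rule convergent_Cauchy)
  have norm_diff: "(norm (y n - y m))\<^sup>2 = a n - a m" if "m \<le> n" for m n
  proof -
    have sub: "F m \<subseteq> F n" using F(3) that by (simp add: incseqD)
    have "y n - y m = (\<Sum>e\<in>F n - F m. ?c e *\<^sub>C e)"
      unfolding y_def using sum_diff[OF F(1) sub, of "\<lambda>e. ?c e *\<^sub>C e"] by simp
    then have "(norm (y n - y m))\<^sup>2 = (\<Sum>e\<in>F n - F m. (cmod (?c e))\<^sup>2)"
      by (simp add: norm_orthonormal_sum F(1) orthonormal_subset[OF onF Diff_subset])
    also have "\<dots> = a n - a m"
      unfolding a_def using sum_diff[OF F(1) sub] by simp
    finally show ?thesis .
  qed
  have "Cauchy y"
  proof (rule metric_CauchyI)
    fix \<epsilon> :: real assume "0 < \<epsilon>"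
    then obtain N where N: "\<And>m n. N \<le> m \<Longrightarrow> N \<le> n \<Longrightarrow> dist (a m) (a n) < \<epsilon>\<^sup>2"
      using metric_CauchyD[OF a_Cauchy, of "\<epsilon>\<^sup>2"] by auto
    have *: "dist (y n) (y m) < \<epsilon>" if "N \<le> m" "m \<le> n" for m n
    proof -
      have "(norm (y n - y m))\<^sup>2 < \<epsilon>\<^sup>2"
        using norm_diff[OF that(2)] N[of n m] that by (auto simp: dist_real_def)
      then show ?thesis
        using \<open>0 < \<epsilon>\<close> by (simp add: dist_norm power2_less_imp_less)
    qed
    show "\<exists>M. \<forall>m\<ge>M. \<forall>n\<ge>M. dist (y m) (y n) < \<epsilon>"
      using * by (metis dist_commute nle_le)
  qed
  then obtain z where z: "y \<longlonglongrightarrow> z"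
    using Cauchy_convergent by (auto simp: convergent_def)
  \<comment> \<open>A basis vector with zero coefficient lies in no \<open>F n\<close> and is
    orthogonal to every partial sum; any other lies in \<open>F n\<close> from some n on.\<close>
  have "cip e (x - z) = 0" if e: "e \<in> E" for e
  proof -
    have "\<forall>\<^sub>F n in sequentially. cip e (y n) = ?c e"
    proof (cases "?c e = 0")
      case True
      then have "cip e f = 0" if "f \<in> F n" for f n
        using that F(2) e on unfolding orthonormal_def by fastforce
      then show ?thesis
        using True by (simp add: y_def cip_sum_right cip_cscale_right)
    next
      case False
      then obtain N where "e \<in> F N" using F(4) e by blast
      then have "e \<in> F n" if "N \<le> n" for n
        using incseqD[OF F(3) that] by (rule subsetD[rotated])
      then show ?thesis
        unfolding eventually_sequentially y_def
        by (intro exI[of _ N] allI impI cip_orthonormal_sum[OF onF F(1)])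
    qed
    then have lim: "(\<lambda>n. cip e (y n)) \<longlonglongrightarrow> ?c e"
      by (rule tendsto_eventually)
    have "(\<lambda>n. cip e (y n)) \<longlonglongrightarrow> cip e z"
      by (intro tendsto_cip tendsto_const z)
    from LIMSEQ_unique[OF lim this] show ?thesis
      by (simp add: cip_diff_right)
  qed
  then have "x - z = 0"
    using E unfolding is_onb_def by blast
  then have "(\<lambda>n. (norm (y n))\<^sup>2) \<longlonglongrightarrow> (norm x)\<^sup>2"
    using z by (auto intro!: tendsto_intros)
  moreover have "(norm (y n))\<^sup>2 = a n" for n
    unfolding y_def a_def by (rule norm_orthonormal_sum[OF onF F(1)])
  ultimately have "a \<longlonglongrightarrow> (norm x)\<^sup>2" by simp
  moreover have "a n \<le> (\<Sum>\<^sub>\<infinity>e\<in>E. (cmod (?c e))\<^sup>2)" for n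
    unfolding a_def by (rule finite_sum_le_infsum[OF summable]) (use F(1,2) in auto)
  ultimately have "(norm x)\<^sup>2 \<le> (\<Sum>\<^sub>\<infinity>e\<in>E. (cmod (?c e))\<^sup>2)"
    using LIMSEQ_le_const2 by blast
  then show ?thesis
    using bessel_summable[OF on, of x] by (metis antisym has_sum_infsum)
qed

text \<open>A nonzero vector orthogonal to a maximal orthonormal set could be normalised and added
  to it, so the set given by Zorn's lemma is a basis, possibly an uncountable one.\<close>

lemma onb_exists: "\<exists>E :: 'a::complex_hilbert set. is_onb cip E"
proof -
  have "\<exists>M\<in>Collect orthonormal. \<forall>X\<in>Collect orthonormal. M \<subseteq> X \<longrightarrow> X = (M :: 'a set)"
  proof (rule subset_Zorn')
    fix C :: "'a set set"
    assume C: "subset.chain (Collect orthonormal) C"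
    have "cip e e' = (if e = e' then 1 else 0)" if "e \<in> \<Union>C" "e' \<in> \<Union>C" for e e'
    proof -
      obtain X Y where XY: "X \<in> C" "e \<in> X" "Y \<in> C" "e' \<in> Y" using \<open>e \<in> \<Union>C\<close> \<open>e' \<in> \<Union>C\<close> by blast
      then have "X \<subseteq> Y \<or> Y \<subseteq> X" using C by (auto simp: subset.chain_def)
      then obtain Z where "Z \<in> C" "e \<in> Z" "e' \<in> Z" using XY by blast
      then show ?thesis using C by (auto simp: subset.chain_def orthonormal_def)
    qed
    then show "\<Union>C \<in> Collect orthonormal" by (simp add: orthonormal_def)
  qed
  then obtain M :: "'a set" where M: "orthonormal M" "\<And>X. orthonormal X \<Longrightarrow> M \<subseteq> X \<Longrightarrow> X = M"
    by auto
  have "f = 0" if f: "\<forall>e\<in>M. cip e f = 0" for f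
  proof (rule ccontr)
    assume "f \<noteq> 0"
    define g where "g = complex_of_real (1 / norm f) *\<^sub>C f"
    have g: "cip g g = 1"
      using \<open>f \<noteq> 0\<close> by (simp add: cip_self g_def norm_cscale norm_divide)
    have ge: "cip e g = 0" "cip g e = 0" if "e \<in> M" for e
      using f that cip_commute[of f e] by (simp_all add: g_def cip_cscale_right cip_cscale_left)
    have "orthonormal (insert g M)"
      using M(1) ge g unfolding orthonormal_def by auto
    then have "g \<in> M" using M(2) by blast
    then show False using ge g by fastforce
  qed
  then show ?thesis
    using M(1) unfolding is_onb_def orthonormal_def by blast
qed

section \<open>Hilbert--Schmidt operators\<close>

definition hs :: "'a::complex_hilbert cbo \<Rightarrow> bool"
  where "hs s \<longleftrightarrow> (\<exists>C. \<forall>F. finite F \<and> orthonormal F \<longrightarrow> (\<Sum>e\<in>F. (norm (app s e))\<^sup>2) \<le> C)"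

definition some_onb :: "'a::complex_hilbert set"
  where "some_onb = (SOME E. is_onb cip E)"

lemma is_onb_some_onb: "is_onb cip some_onb"
  unfolding some_onb_def by (rule someI_ex[OF onb_exists])

lemma hs_summable:
  assumes "hs s" "orthonormal E"
  shows "(\<lambda>e. (norm (app s e))\<^sup>2) summable_on E"
proof -
  obtain C where "\<And>F. finite F \<Longrightarrow> orthonormal F \<Longrightarrow> (\<Sum>e\<in>F. (norm (app s e))\<^sup>2) \<le> C"
    using assms unfolding hs_def by blast
  then show ?thesis
    using assms(2) orthonormal_subset
    by (intro nonneg_bdd_above_summable_on) (auto intro!: bdd_aboveI[of _ C])
qed

text \<open>Expand each \<open>app (star s) f\<close> in E by Parseval, exchange the sums, and apply
  Bessel's inequality over F to \<open>app s e\<close>. Basis independence of the Hilbert--Schmidt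
  norm and its invariance under adjoints both rest on this inequality.\<close>

lemma star_sum_le:
  assumes F: "orthonormal F" "finite F" and E: "is_onb cip E"
    and summable: "(\<lambda>e. (norm (app s e))\<^sup>2) summable_on E"
  shows "(\<Sum>f\<in>F. (norm (app (star s) f))\<^sup>2) \<le> (\<Sum>\<^sub>\<infinity>e\<in>E. (norm (app s e))\<^sup>2)"
proof -
  have "((\<lambda>e. \<Sum>f\<in>F. (cmod (cip e (app (star s) f)))\<^sup>2) has_sum
      (\<Sum>f\<in>F. (norm (app (star s) f))\<^sup>2)) E"
    using F(2) by (induction F) (auto intro!: has_sum_add parseval[OF E])
  moreover have "(\<Sum>f\<in>F. (cmod (cip e (app (star s) f)))\<^sup>2) \<le> (norm (app s e))\<^sup>2" for e
  proof -
    have "cmod (cip e (app (star s) f)) = cmod (cip f (app s e))" for f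
      by (metis cip_star_right cip_commute complex_mod_cnj)
    then show ?thesis
      using bessel_finite[OF F, of "app s e"] by simp
  qed
  ultimately show ?thesis
    using has_sum_infsum[OF summable] has_sum_mono by blast
qed

lemma hs_star: "hs s \<Longrightarrow> hs (star s)"
  unfolding hs_def[of "star s"]
  using star_sum_le[OF _ _ is_onb_some_onb]
    hs_summable[OF _ is_onb_orthonormal[OF is_onb_some_onb]] by blast

text \<open>The norm is evaluated in one fixed basis; \<open>hs_norm2_has_sum\<close> shows that any
  other gives the same value.\<close>

definition hs_norm2 :: "'a::complex_hilbert cbo \<Rightarrow> real"
  where "hs_norm2 s = (\<Sum>\<^sub>\<infinity>e\<in>some_onb. (norm (app s e))\<^sup>2)"

lemma hs_norm2_star_le:
  assumes "hs s" "is_onb cip E" "is_onb cip E'"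
  shows "(\<Sum>\<^sub>\<infinity>e\<in>E'. (norm (app (star s) e))\<^sup>2) \<le> (\<Sum>\<^sub>\<infinity>e\<in>E. (norm (app s e))\<^sup>2)"
proof (rule infsum_le_finite_sums)
  show "(\<lambda>e. (norm (app (star s) e))\<^sup>2) summable_on E'"
    using assms by (intro hs_summable hs_star is_onb_orthonormal)
  fix F assume "finite F" "F \<subseteq> E'"
  then show "(\<Sum>e\<in>F. (norm (app (star s) e))\<^sup>2) \<le> (\<Sum>\<^sub>\<infinity>e\<in>E. (norm (app s e))\<^sup>2)"
    using assms by (intro star_sum_le hs_summable)
      (auto intro: is_onb_orthonormal orthonormal_subset)
qed

text \<open>Two bases are compared by passing to the adjoint and back, which closes the inequalities
  of \<open>hs_norm2_star_le\<close> into an equality.\<close>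

lemma hs_norm2_has_sum:
  assumes "hs s" "is_onb cip E"
  shows "((\<lambda>e. (norm (app s e))\<^sup>2) has_sum hs_norm2 s) E"
proof -
  have "(\<Sum>\<^sub>\<infinity>e\<in>E. (norm (app s e))\<^sup>2) = hs_norm2 s"
    unfolding hs_norm2_def
    using hs_norm2_star_le[OF assms(1) is_onb_some_onb assms(2)]
      hs_norm2_star_le[OF hs_star[OF assms(1)] assms(2) assms(2)]
      hs_norm2_star_le[OF assms(1) assms(2) is_onb_some_onb]
      hs_norm2_star_le[OF hs_star[OF assms(1)] is_onb_some_onb is_onb_some_onb]
    by simp
  then show ?thesis
    using hs_summable[OF assms(1) is_onb_orthonormal[OF assms(2)]] by (metis has_sum_infsum)
qed

lemma hs_norm2_star: "hs s \<Longrightarrow> hs_norm2 (star s) = hs_norm2 s"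
  unfolding hs_norm2_def
  using hs_norm2_star_le[of s, OF _ is_onb_some_onb is_onb_some_onb]
    hs_norm2_star_le[of "star s", OF _ is_onb_some_onb is_onb_some_onb] hs_star[of s]
  by fastforce

lemma hs_norm2_nonneg: "0 \<le> hs_norm2 s"
  unfolding hs_norm2_def by (rule infsum_nonneg) simp

lemma hs_mult_left:
  assumes "hs s"
  shows "hs (t * s)"
proof -
  obtain C where C: "\<And>F. finite F \<Longrightarrow> orthonormal F \<Longrightarrow> (\<Sum>e\<in>F. (norm (app s e))\<^sup>2) \<le> C"
    using assms unfolding hs_def by blast
  have "(\<Sum>e\<in>F. (norm (app (t * s) e))\<^sup>2) \<le> (norm t)\<^sup>2 * C" if F: "finite F" "orthonormal F" for F
  proof -
    have "(\<Sum>e\<in>F. (norm (app (t * s) e))\<^sup>2) \<le> (\<Sum>e\<in>F. (norm t)\<^sup>2 * (norm (app s e))\<^sup>2)"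
      by (intro sum_mono) (simp add: norm_app power_mono flip: power_mult_distrib)
    also have "\<dots> \<le> (norm t)\<^sup>2 * C"
      using C[OF F] by (simp add: mult_left_mono flip: sum_distrib_left)
    finally show ?thesis .
  qed
  then show ?thesis unfolding hs_def by blast
qed

lemma hs_mult_right: "hs s \<Longrightarrow> hs (s * t)"
  using hs_star[OF hs_mult_left[OF hs_star[of s], of "star t"]] by simp

lemma hs_norm2_mult_left: "hs s \<Longrightarrow> hs_norm2 (t * s) \<le> (norm t)\<^sup>2 * hs_norm2 s"
proof (rule has_sum_mono)
  assume s: "hs s"
  show "((\<lambda>e. (norm (app (t * s) e))\<^sup>2) has_sum hs_norm2 (t * s)) some_onb"
    by (intro hs_norm2_has_sum hs_mult_left s is_onb_some_onb)
  show "((\<lambda>e. (norm t)\<^sup>2 * (norm (app s e))\<^sup>2) has_sum (norm t)\<^sup>2 * hs_norm2 s) some_onb"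
    by (intro has_sum_cmult_right hs_norm2_has_sum s is_onb_some_onb)
qed (simp add: norm_app power_mono flip: power_mult_distrib)

lemma hs_add:
  assumes "hs s" "hs t"
  shows "hs (s + t)"
proof -
  obtain C where C: "\<And>F. finite F \<Longrightarrow> orthonormal F \<Longrightarrow> (\<Sum>e\<in>F. (norm (app s e))\<^sup>2) \<le> C"
    using assms unfolding hs_def by blast
  obtain D where D: "\<And>F. finite F \<Longrightarrow> orthonormal F \<Longrightarrow> (\<Sum>e\<in>F. (norm (app t e))\<^sup>2) \<le> D"
    using assms unfolding hs_def by blast
  have "(\<Sum>e\<in>F. (norm (app (s + t) e))\<^sup>2) \<le> 2 * C + 2 * D" if F: "finite F" "orthonormal F" for F
  proof -
    have "(norm (x + y))\<^sup>2 \<le> 2 * (norm x)\<^sup>2 + 2 * (norm y)\<^sup>2" for x y :: 'a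
    proof -
      have "(norm (x + y))\<^sup>2 \<le> (norm x + norm y)\<^sup>2"
        by (intro power_mono norm_triangle_ineq) auto
      then show ?thesis
        using sum_squares_bound[of "norm x" "norm y"] by (simp add: power2_sum)
    qed
    then have "(\<Sum>e\<in>F. (norm (app (s + t) e))\<^sup>2) \<le>
        (\<Sum>e\<in>F. 2 * (norm (app s e))\<^sup>2 + 2 * (norm (app t e))\<^sup>2)"
      by (intro sum_mono) simp
    also have "\<dots> \<le> 2 * C + 2 * D"
      using C[OF F] D[OF F] by (simp add: sum.distrib flip: sum_distrib_left)
    finally show ?thesis .
  qed
  then show ?thesis unfolding hs_def by blast
qed

lemma hs_uminus: "hs s \<Longrightarrow> hs (- s)"
  by (simp add: hs_def)

lemma hs_diff: "hs s \<Longrightarrow> hs t \<Longrightarrow> hs (s - t)"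
  using hs_add[of s "- t"] hs_uminus[of t] by simp

text \<open>The Hilbert--Schmidt inner product, defined by polarization so that its independence of the
  basis and its behaviour under adjoints are inherited from those of the norm.\<close>

definition hs_ip :: "'a::complex_hilbert cbo \<Rightarrow> 'a cbo \<Rightarrow> complex"
  where "hs_ip s t = Complex ((hs_norm2 (s + t) - hs_norm2 (s - t)) / 4)
    ((hs_norm2 (s - scal \<i> * t) - hs_norm2 (s + scal \<i> * t)) / 4)"

lemma cip_polarization:
  "cip x y = Complex (((norm (x + y))\<^sup>2 - (norm (x - y))\<^sup>2) / 4)
    (((norm (x - \<i> *\<^sub>C y))\<^sup>2 - (norm (x + \<i> *\<^sub>C y))\<^sup>2) / 4)"
  unfolding cip_def complex_eq_iff
  using inner_imaginary_unit_left[of x y]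
  by (simp add: power2_norm_eq_inner inner_add_left inner_add_right inner_diff_left
      inner_diff_right inner_commute)

lemma has_sum_Complex:
  assumes "(f has_sum a) A" "(g has_sum b) A"
  shows "((\<lambda>x. Complex (f x) (g x)) has_sum Complex a b) A"
proof -
  have "((\<lambda>x. complex_of_real (f x) + \<i> * complex_of_real (g x)) has_sum
      complex_of_real a + \<i> * complex_of_real b) A"
    by (intro has_sum_add has_sum_cmult_right has_sum_of_real assms)
  then show ?thesis by (simp add: Complex_eq)
qed

lemma hs_ip_has_sum:
  assumes "hs s" "hs t" "is_onb cip E"
  shows "((\<lambda>e. cip (app s e) (app t e)) has_sum hs_ip s t) E"
proof -
  have sum: "((\<lambda>e. (norm (app u e))\<^sup>2 / 4 - (norm (app v e))\<^sup>2 / 4) has_sum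
      (hs_norm2 u / 4 - hs_norm2 v / 4)) E" if "hs u" "hs v" for u v
    using has_sum_add[OF has_sum_cmult_left[OF hs_norm2_has_sum[OF that(1) assms(3)], of "1/4"]
      has_sum_cmult_left[OF hs_norm2_has_sum[OF that(2) assms(3)], of "- 1/4"]] by simp
  have "hs (scal \<i> * t)" by (rule hs_mult_left) fact
  then show ?thesis
    unfolding hs_ip_def cip_polarization diff_divide_distrib
    using has_sum_Complex[OF sum[OF hs_add hs_diff, OF assms(1,2,1,2)]
        sum[OF hs_diff hs_add, OF assms(1) _ assms(1)], of "scal \<i> * t" "scal \<i> * t"]
    by simp
qed

lemma hs_ip_commute:
  assumes "hs s" "hs t"
  shows "hs_ip t s = cnj (hs_ip s t)"
proof -
  have "((\<lambda>e. cnj (cip (app s e) (app t e))) has_sum cnj (hs_ip s t)) some_onb"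
    unfolding has_sum_cnj_iff by (intro hs_ip_has_sum assms is_onb_some_onb)
  then show ?thesis
    using hs_ip_has_sum[OF assms(2,1) is_onb_some_onb] has_sum_unique
    by (metis (no_types, lifting) cip_commute has_sum_cong)
qed

text \<open>The norm is blind to adjoints, while \<open>star\<close> turns the factor
  \<open>scal \<i>\<close> into its negative. So the two terms of the imaginary part change places,
  which is complex conjugation.\<close>

lemma hs_ip_star:
  assumes "hs s" "hs t"
  shows "hs_ip (star s) (star t) = cnj (hs_ip s t)"
proof -
  have it: "hs (scal \<i> * t)" by (rule hs_mult_left) fact
  have eq: "star (s + scal \<i> * t) = star s - scal \<i> * star t"
       "star (s - scal \<i> * t) = star s + scal \<i> * star t"
    by (simp_all add: scal_commute scal_simps)
  have "hs_norm2 (star s - scal \<i> * star t) = hs_norm2 (s + scal \<i> * t)"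
      "hs_norm2 (star s + scal \<i> * star t) = hs_norm2 (s - scal \<i> * t)"
      "hs_norm2 (star s + star t) = hs_norm2 (s + t)" "hs_norm2 (star s - star t) = hs_norm2 (s - t)"
    using hs_norm2_star[OF hs_add[OF assms(1) it]] hs_norm2_star[OF hs_diff[OF assms(1) it]]
      hs_norm2_star[OF hs_add[OF assms]] hs_norm2_star[OF hs_diff[OF assms]]
    unfolding eq by simp_all
  then show ?thesis
    unfolding hs_ip_def complex_cnj by (simp only: minus_divide_left minus_diff_eq)
qed

text \<open>The arithmetic--geometric mean inequality, applied basis vector by basis vector.
  Homogeneity later turns this bound, used on a unit ball, into an operator norm bound.\<close>

lemma cmod_hs_ip_le:
  assumes "hs s" "hs t"
  shows "cmod (hs_ip s t) \<le> (hs_norm2 s + hs_norm2 t) / 2"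
proof -
  have sum: "((\<lambda>e. ((norm (app s e))\<^sup>2 + (norm (app t e))\<^sup>2) * (1/2)) has_sum
      (hs_norm2 s + hs_norm2 t) * (1/2)) some_onb"
    by (intro has_sum_cmult_left has_sum_add hs_norm2_has_sum assms is_onb_some_onb)
  have le: "cmod (cip (app s e) (app t e)) \<le> ((norm (app s e))\<^sup>2 + (norm (app t e))\<^sup>2) * (1/2)" for e
    using cmod_cip_le[of "app s e" "app t e"] sum_squares_bound[of "norm (app s e)" "norm (app t e)"]
    by simp
  have abs: "((\<lambda>e. cmod (cip (app s e) (app t e))) has_sum
      (\<Sum>\<^sub>\<infinity>e\<in>some_onb. cmod (cip (app s e) (app t e)))) some_onb"
    by (intro has_sum_infsum summable_on_comparison_test[OF has_sum_imp_summable[OF sum]] le) auto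
  show ?thesis
    using norm_has_sum_bound[OF abs hs_ip_has_sum[OF assms is_onb_some_onb]]
      has_sum_mono[OF abs sum le] by simp
qed

section \<open>The trace on products of two Hilbert--Schmidt operators\<close>

definition tc :: "'a::complex_hilbert cbo \<Rightarrow> bool"
  where "tc s \<longleftrightarrow> (\<exists>x y. hs x \<and> hs y \<and> s = x * y)"

text \<open>On products of two Hilbert--Schmidt operators the sum is a Hilbert--Schmidt inner
  product, hence the same in every basis (\<open>tr_has_sum\<close>).\<close>

definition tr :: "'a::complex_hilbert cbo \<Rightarrow> complex"
  where "tr s = (\<Sum>\<^sub>\<infinity>e\<in>some_onb. cip e (app s e))"

lemma tcI: "hs x \<Longrightarrow> hs y \<Longrightarrow> tc (x * y)"
  unfolding tc_def by blast

lemma tr_has_sum_hs_ip: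
  assumes "hs x" "hs y" "is_onb cip E"
  shows "((\<lambda>e. cip e (app (x * y) e)) has_sum hs_ip (star x) y) E"
  using hs_ip_has_sum[OF hs_star[OF assms(1)] assms(2,3)] by (simp add: cip_star_left)

lemma tr_mult: "hs x \<Longrightarrow> hs y \<Longrightarrow> tr (x * y) = hs_ip (star x) y"
  unfolding tr_def by (intro infsumI tr_has_sum_hs_ip is_onb_some_onb)

lemma tr_has_sum: "tc s \<Longrightarrow> is_onb cip E \<Longrightarrow> ((\<lambda>e. cip e (app s e)) has_sum tr s) E"
  unfolding tc_def by (metis tr_has_sum_hs_ip tr_mult)

text \<open>The trace of a product is the Hilbert--Schmidt inner product of \<open>star x\<close>
  and y. Taking adjoints conjugates it, and so does exchanging the arguments; both together exchange
  the factors.\<close>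

lemma tr_commute_hs:
  assumes "hs x" "hs y"
  shows "tr (x * y) = tr (y * x)"
  using assms hs_ip_star[OF assms(1) hs_star[OF assms(2)]]
    hs_ip_commute[OF assms(1) hs_star[OF assms(2)]]
  by (simp add: tr_mult)

lemma tc_mult: "tc s \<Longrightarrow> tc (b * s)" "tc s \<Longrightarrow> tc (s * b)"
  unfolding tc_def by (metis hs_mult_left mult.assoc) (metis hs_mult_right mult.assoc)

lemma tr_commute:
  assumes "tc s"
  shows "tr (b * s) = tr (s * b)"
proof -
  obtain x y where xy: "hs x" "hs y" "s = x * y" using assms unfolding tc_def by blast
  have "tr (b * s) = tr ((b * x) * y)" by (simp add: xy mult.assoc)
  also have "\<dots> = tr ((y * b) * x)"
    using tr_commute_hs[OF hs_mult_left[OF xy(1), of b] xy(2)] by (simp add: mult.assoc)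
  also have "\<dots> = tr (s * b)"
    using tr_commute_hs[OF hs_mult_right[OF xy(2), of b] xy(1)] by (simp add: xy mult.assoc)
  finally show ?thesis .
qed

lemma tc_star: "tc s \<Longrightarrow> tc (star s)"
  unfolding tc_def by (metis hs_star star_simps(6))

lemma tr_star:
  assumes "tc s"
  shows "tr (star s) = cnj (tr s)"
proof -
  have "((\<lambda>e. cnj (cip e (app s e))) has_sum cnj (tr s)) some_onb"
    unfolding has_sum_cnj_iff by (intro tr_has_sum assms is_onb_some_onb)
  moreover have "cnj (cip e (app s e)) = cip e (app (star s) e)" for e
    by (metis cip_commute cip_star_right)
  ultimately show ?thesis
    unfolding tr_def[of "star s"] by (intro infsumI) simp
qed

lemma tr_add:
  assumes "tc s" "tc t"
  shows "tr (s + t) = tr s + tr t"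
  unfolding tr_def[of "s + t"]
  using has_sum_add[OF tr_has_sum[OF assms(1) is_onb_some_onb] tr_has_sum[OF assms(2) is_onb_some_onb]]
  by (intro infsumI) (simp add: cip_add_right)

lemma tr_scal:
  assumes "tc s"
  shows "tr (scal c * s) = c * tr s"
  unfolding tr_def[of "scal c * s"]
  using has_sum_cmult_right[OF tr_has_sum[OF assms is_onb_some_onb]]
  by (intro infsumI) (simp add: cip_cscale_right)

lemma tc_scaleR: "tc s \<Longrightarrow> tc (r *\<^sub>R s)"
  using tc_mult(1)[of s "scal (complex_of_real r)"] by (simp add: scal_simps)

lemma tr_scaleR: "tc s \<Longrightarrow> tr (r *\<^sub>R s) = complex_of_real r * tr s"
  using tr_scal[of s "complex_of_real r"] by (simp add: scal_simps)

text \<open>Continuity in the operator norm is what allows the trace of the Neumann series to be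
  taken term by term.\<close>

lemma bounded_linear_tr:
  assumes "tc s"
  shows "bounded_linear (\<lambda>b. tr (s * b))"
proof -
  obtain x y where xy: "hs x" "hs y" "s = x * y" using assms unfolding tc_def by blast
  define C where "C = (hs_norm2 x + hs_norm2 y) / 2"
  have tcb: "tc (s * b)" for b using assms by (rule tc_mult)
  have scale: "tr (s * (r *\<^sub>R b)) = r *\<^sub>R tr (s * b)" for r b
    using tr_scaleR[OF tcb[of b], of r] by (simp add: scaleR_conv_of_real[of r "tr (s * b)"])
  have bound: "cmod (tr (s * b)) \<le> C" if "norm b \<le> 1" for b
  proof -
    \<comment> \<open>Cyclicity moves b next to x, so that a single Hilbert--Schmidt norm absorbs
      it.\<close>
    have "tr (s * b) = tr (y * (b * x))"
      using tr_commute[OF tcI[OF xy(1,2)], of b] tr_commute_hs[OF hs_mult_left[OF xy(1), of b] xy(2)]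
      by (simp add: xy(3) mult.assoc)
    then have "cmod (tr (s * b)) \<le> (hs_norm2 y + hs_norm2 (b * x)) / 2"
      using cmod_hs_ip_le[OF hs_star[OF xy(2)] hs_mult_left[OF xy(1)]] xy hs_mult_left[OF xy(1), of b]
      by (simp add: tr_mult hs_norm2_star)
    moreover have "(norm b)\<^sup>2 * hs_norm2 x \<le> 1 * hs_norm2 x"
      using that by (intro mult_right_mono hs_norm2_nonneg) (simp add: power_le_one)
    ultimately show ?thesis
      using hs_norm2_mult_left[OF xy(1), of b] by (simp add: C_def)
  qed
  show ?thesis
  proof (rule bounded_linear_intro[of _ C])
    show "tr (s * (b + c)) = tr (s * b) + tr (s * c)" for b c
      by (simp add: distrib_left tr_add tcb)
    show "tr (s * (r *\<^sub>R b)) = r *\<^sub>R tr (s * b)" for r b by (rule scale)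
    show "norm (tr (s * b)) \<le> norm b * C" for b
    proof (cases "b = 0")
      case True
      then show ?thesis using scale[of 0 0] by simp
    next
      case False
      have "norm (tr (s * b)) = norm b * cmod (tr (s * (inverse (norm b) *\<^sub>R b)))"
        using False unfolding scale by simp
      also have "\<dots> \<le> norm b * C"
        using False by (intro mult_left_mono bound) auto
      finally show ?thesis .
    qed
  qed
qed

section \<open>Absolute values of trace class operators\<close>

text \<open>The coefficients of the power series \<open>z(x) = 1 - sqrt (1 - x)\<close>, determined by
  \<open>z = (x + z\<^sup>2) / 2\<close>.\<close>

function sqrt_coeff :: "nat \<Rightarrow> real"
  where "sqrt_coeff n = (if n = 0 then 0 else if n = 1 then 1 / 2
    else (\<Sum>i\<in>{1..<n}. sqrt_coeff i * sqrt_coeff (n - i)) / 2)"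
  by pat_completeness auto
termination by (relation "Wellfounded.measure id") auto

declare sqrt_coeff.simps [simp del]

lemma sqrt_coeff_0: "sqrt_coeff 0 = 0"
  by (simp add: sqrt_coeff.simps)

text \<open>As the constant coefficient is 0, the convolution may run over all i; in this form it is
  the Cauchy product of the series with itself.\<close>

lemma sqrt_coeff_rec:
  "sqrt_coeff n = (if n = 1 then 1 / 2 else 0) + (\<Sum>i\<le>n. sqrt_coeff i * sqrt_coeff (n - i)) / 2"
proof -
  have "(\<Sum>i\<le>n. sqrt_coeff i * sqrt_coeff (n - i)) =
      (\<Sum>i\<in>{1..<n}. sqrt_coeff i * sqrt_coeff (n - i))"
  proof (rule sum.mono_neutral_right)
    show "\<forall>i\<in>{..n} - {1..<n}. sqrt_coeff i * sqrt_coeff (n - i) = 0"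
    proof
      fix i assume "i \<in> {..n} - {1..<n}"
      then have "i = 0 \<or> i = n" by auto
      then show "sqrt_coeff i * sqrt_coeff (n - i) = 0" by (auto simp: sqrt_coeff_0)
    qed
  qed auto
  then show ?thesis
    by (cases "n = 0 \<or> n = 1") (auto simp: sqrt_coeff_0 sqrt_coeff.simps[of n])
qed

lemma sqrt_coeff_nonneg: "0 \<le> sqrt_coeff n"
  by (induction n rule: less_induct)
    (subst sqrt_coeff.simps, auto intro!: divide_nonneg_nonneg sum_nonneg)

text \<open>In the convolutions of order at most N every nonzero term has both indices below N.
  Hence each partial sum is at most 1/2 plus half the square of the previous one, and the bound 1
  reproduces itself.\<close>

lemma sum_sqrt_coeff_le: "(\<Sum>n<N. sqrt_coeff n) \<le> 1"
proof (induction N)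
  case (Suc N)
  let ?c = sqrt_coeff
  have "(\<Sum>n\<le>N. \<Sum>i\<le>n. ?c i * ?c (n - i)) = (\<Sum>(i, j)\<in>{(i, j). i + j \<le> N}. ?c i * ?c j)"
    by (rule sum.triangle_reindex_eq[symmetric])
  also have "\<dots> = (\<Sum>(i, j)\<in>{(i, j). i + j \<le> N} \<inter> {..<N} \<times> {..<N}. ?c i * ?c j)"
  proof (rule sum.mono_neutral_right)
    show "finite {(i, j). i + j \<le> N}"
      by (rule finite_subset[of _ "{..N} \<times> {..N}"]) auto
    show "\<forall>p\<in>{(i, j). i + j \<le> N} - {(i, j). i + j \<le> N} \<inter> {..<N} \<times> {..<N}.
        (case p of (i, j) \<Rightarrow> ?c i * ?c j) = 0"
    proof safe
      fix i j assume "i + j \<le> N" "?c i * ?c j \<noteq> 0"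
      then have "i \<noteq> 0 \<and> j \<noteq> 0"
        by (cases "i = 0"; cases "j = 0"; simp add: sqrt_coeff_0)
      then show "i < N" "j < N" using \<open>i + j \<le> N\<close> by auto
    qed
  qed auto
  also have "\<dots> \<le> (\<Sum>(i, j)\<in>{..<N} \<times> {..<N}. ?c i * ?c j)"
    by (rule sum_mono2) (auto intro: mult_nonneg_nonneg sqrt_coeff_nonneg)
  also have "\<dots> = (\<Sum>n<N. ?c n) * (\<Sum>n<N. ?c n)"
    by (simp add: sum_product sum.cartesian_product)
  also have "\<dots> \<le> 1 * 1"
    using Suc by (intro mult_mono sum_nonneg sqrt_coeff_nonneg) auto
  finally have "(\<Sum>n\<le>N. \<Sum>i\<le>n. ?c i * ?c (n - i)) \<le> 1" by simp
  moreover have "(\<Sum>n\<le>N. ?c n) =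
      (\<Sum>n\<le>N. if n = 1 then 1 / 2 else 0) + (\<Sum>n\<le>N. \<Sum>i\<le>n. ?c i * ?c (n - i)) / 2"
    by (subst sqrt_coeff_rec) (simp add: sum.distrib sum_divide_distrib)
  moreover have "(\<Sum>n\<le>N. if n = 1 then 1 / 2 else (0::real)) \<le> 1 / 2"
    by (simp add: sum.delta)
  ultimately show ?case by (simp add: lessThan_Suc_atMost)
qed simp

lemma summable_sqrt_coeff: "summable sqrt_coeff"
  by (rule summableI_nonneg_bounded[of _ 1]) (auto intro: sqrt_coeff_nonneg sum_sqrt_coeff_le)

lemma suminf_sqrt_coeff_le: "suminf sqrt_coeff \<le> 1"
  by (rule suminf_le_const[OF summable_sqrt_coeff]) (rule sum_sqrt_coeff_le)

lemma bounded_linear_star: "bounded_linear star"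
  by (rule bounded_linear_intro[of _ 1]) (auto simp: norm_star)

lemma bounded_linear_inner_app: "bounded_linear (\<lambda>s. inner x (app s x))"
  by (rule bounded_linear_compose[OF bounded_linear_inner_right bounded_linear_app_left])

lemma star_power: "star (s ^ n) = star s ^ n"
  by (induction n) (simp_all add: power_commutes)

lemma inner_star: "inner x (app s y) = inner (app (star s) x) y"
  by (metis Re_cip cip_star_left)

lemma inner_star_self: "inner x (app (star s * s) x) = (norm (app s x))\<^sup>2"
  using inner_star[of x "star s" "app s x"] by (simp add: power2_norm_eq_inner)

text \<open>Split the power symmetrically: an even power is the square of a self-adjoint operator,
  an odd one is s between two equal self-adjoint powers.\<close>

lemma inner_power_nonneg:
  assumes "star s = s" "\<And>x. 0 \<le> inner x (app s x)"
  shows "0 \<le> inner x (app (s ^ n) x)"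
proof (cases "even n")
  case True
  then obtain k where "n = k + k" by (metis mult_2 evenE)
  then have "inner x (app (s ^ n) x) = inner (app (s ^ k) x) (app (s ^ k) x)"
    using inner_star[of x "s ^ k"] by (simp add: power_add star_power assms(1))
  then show ?thesis by simp
next
  case False
  then obtain k where "n = k + (1 + k)" by (metis oddE mult_2 add.assoc add.commute)
  then have "s ^ n = s ^ k * (s * s ^ k)"
    by (simp only: power_add power_one_right)
  then have "inner x (app (s ^ n) x) = inner (app (s ^ k) x) (app s (app (s ^ k) x))"
    using inner_star[of x "s ^ k"] by (simp add: star_power assms(1))
  then show ?thesis by (simp add: assms(2))
qed

text \<open>Z is 1 minus the square root of 1 - X. Since the coefficients are nonnegative with sum
  at most 1, the series converges up to and including norm 1, its sum is a contraction, and
  positivity passes from the powers of X to Z.\<close>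

lemma sqrt_series:
  fixes X :: "'a::complex_hilbert cbo"
  assumes X: "star X = X" "\<And>x. 0 \<le> inner x (app X x)" "norm X \<le> 1"
  obtains Z where "star Z = Z" "\<And>x. 0 \<le> inner x (app Z x)" "norm Z \<le> 1"
    "(1 - Z) * (1 - Z) = 1 - X"
proof -
  define a where "a n = sqrt_coeff n *\<^sub>R X ^ n" for n
  have norm_a: "norm (a n) \<le> sqrt_coeff n" for n
  proof -
    have "norm (X ^ n) \<le> norm X ^ n" by (rule norm_power_ineq)
    also have "\<dots> \<le> 1" using X(3) by (intro power_le_one) auto
    finally have "sqrt_coeff n * norm (X ^ n) \<le> sqrt_coeff n * 1"
      by (intro mult_left_mono sqrt_coeff_nonneg)
    then show ?thesis by (simp add: a_def sqrt_coeff_nonneg)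
  qed
  have abs: "summable (\<lambda>n. norm (a n))"
    by (rule summable_comparison_test'[OF summable_sqrt_coeff, of 0]) (simp add: norm_a)
  then have summable: "summable a" by (rule summable_norm_cancel)
  define Z where "Z = suminf a"
  have sums: "a sums Z" unfolding Z_def by (rule summable_sums[OF summable])
  have "(\<lambda>n. \<Sum>i\<le>n. a i * a (n - i)) sums (Z * Z)"
    unfolding Z_def by (rule Cauchy_product_sums[OF abs abs])
  also have "(\<lambda>n. \<Sum>i\<le>n. a i * a (n - i)) =
      (\<lambda>n. (\<Sum>i\<le>n. sqrt_coeff i * sqrt_coeff (n - i)) *\<^sub>R X ^ n)"
    by (auto simp: a_def scaleR_sum_left fun_eq_iff simp flip: power_add intro!: sum.cong)
  finally have "(\<lambda>n. (\<Sum>i\<le>n. sqrt_coeff i * sqrt_coeff (n - i)) *\<^sub>R X ^ n) sums (Z * Z)" .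
  then have "(\<lambda>n. (1/2) *\<^sub>R (\<Sum>i\<le>n. sqrt_coeff i * sqrt_coeff (n - i)) *\<^sub>R X ^ n) sums ((1/2) *\<^sub>R (Z * Z))"
    by (rule sums_scaleR_right)
  moreover have "(\<lambda>n. (if n = 1 then 1/2 else 0) *\<^sub>R X ^ n) sums ((1/2) *\<^sub>R X)"
    using sums_single[of 1 "\<lambda>n. (1/2) *\<^sub>R X ^ n"] by (simp add: if_distrib if_distribR cong: if_cong)
  ultimately have "(\<lambda>n. (if n = 1 then 1/2 else 0) *\<^sub>R X ^ n +
      (1/2) *\<^sub>R (\<Sum>i\<le>n. sqrt_coeff i * sqrt_coeff (n - i)) *\<^sub>R X ^ n) sums ((1/2) *\<^sub>R X + (1/2) *\<^sub>R (Z * Z))"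
    by (intro sums_add)
  also have "(\<lambda>n. (if n = 1 then 1/2 else 0) *\<^sub>R X ^ n +
      (1/2) *\<^sub>R (\<Sum>i\<le>n. sqrt_coeff i * sqrt_coeff (n - i)) *\<^sub>R X ^ n) = a"
    unfolding a_def by (subst sqrt_coeff_rec) (simp add: fun_eq_iff scaleR_add_left)
  finally have Z_eq: "Z = (1/2) *\<^sub>R X + (1/2) *\<^sub>R (Z * Z)"
    by (rule sums_unique2[OF sums])
  show ?thesis
  proof
    have "(\<lambda>n. star (a n)) sums star Z"
      by (rule bounded_linear.sums[OF bounded_linear_star sums])
    also have "(\<lambda>n. star (a n)) = a"
      by (simp add: fun_eq_iff a_def star_power X(1))
    finally show "star Z = Z"
      by (rule sums_unique2[OF _ sums])
    show "0 \<le> inner x (app Z x)" for x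
    proof -
      have lim: "(\<lambda>n. inner x (app (a n) x)) sums inner x (app Z x)"
        by (rule bounded_linear.sums[OF bounded_linear_inner_app sums])
      have nonneg: "0 \<le> inner x (app (a n) x)" for n
        using mult_nonneg_nonneg[OF sqrt_coeff_nonneg inner_power_nonneg[OF X(1,2)]]
        by (simp add: a_def)
      show ?thesis
        by (rule sums_le[OF nonneg sums_zero lim])
    qed
    have "norm Z \<le> (\<Sum>n. norm (a n))"
      unfolding Z_def by (rule summable_norm[OF abs])
    also have "\<dots> \<le> suminf sqrt_coeff"
      by (rule suminf_le[OF norm_a abs summable_sqrt_coeff])
    finally show "norm Z \<le> 1"
      using suminf_sqrt_coeff_le by linarith
    have "2 *\<^sub>R Z = X + Z * Z"
      by (subst Z_eq) (simp add: scaleR_add_right)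
    then have "X = Z + Z - Z * Z"
      by (simp add: scaleR_2 eq_diff_eq)
    then show "(1 - Z) * (1 - Z) = 1 - X"
      by (simp add: algebra_simps)
  qed
qed

lemma hs_finite_le:
  assumes "hs s" "finite F" "orthonormal F"
  shows "(\<Sum>e\<in>F. (norm (app s e))\<^sup>2) \<le> hs_norm2 s"
  using star_sum_le[OF assms(3,2) is_onb_some_onb
      hs_summable[OF hs_star[OF assms(1)] is_onb_orthonormal[OF is_onb_some_onb]]]
  by (simp add: hs_norm2_star[OF assms(1), symmetric]) (simp add: hs_norm2_def)

text \<open>Test positivity of Z at x - Zx: the cubic term that appears is at most the squared norm
  of Zx, because Z is a contraction. In operator form this says that Z squared is at most Z.\<close>

lemma norm_le_of_inner:
  assumes "star Z = Z" "\<And>x. 0 \<le> inner x (app Z x)" "norm Z \<le> 1"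
  shows "(norm (app Z x))\<^sup>2 \<le> inner x (app Z x)"
proof -
  let ?y = "app Z x"
  have "inner ?y (app Z ?y) \<le> norm ?y * norm (app Z ?y)"
    by (rule norm_cauchy_schwarz)
  also have "\<dots> \<le> norm ?y * (1 * norm ?y)"
    using assms(3) order.trans[OF norm_app mult_right_mono[OF assms(3)]]
    by (intro mult_left_mono) auto
  finally have 1: "inner ?y (app Z ?y) \<le> (norm ?y)\<^sup>2" by (simp add: power2_eq_square)
  have "inner x (app Z ?y) = (norm ?y)\<^sup>2"
    using inner_star[of x Z ?y] by (simp add: assms(1) power2_norm_eq_inner)
  moreover have "0 \<le> inner (x - ?y) (app Z (x - ?y))"
    by (rule assms(2))
  ultimately show ?thesis
    using 1 by (simp add: inner_diff_left inner_diff_right power2_norm_eq_inner)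
qed

text \<open>Since \<open>S (1 + Z + \<dots> + Z\<^bsup>n-1\<^esup>)\<close> with \<open>Z = 1 - P\<close> is bounded by \<open>2\<close> uniformly in \<open>n\<close>, it
  can replace the partial isometry of the polar decomposition.\<close>

lemma abs_contraction_exists:
  fixes S :: "'a::complex_hilbert cbo"
  assumes "tc S" and S1: "norm S \<le> 1"
  obtains P C where "star P = P" "\<And>x. 0 \<le> inner x (app P x)" "P * P = star S * S"
    "\<And>F. finite F \<Longrightarrow> orthonormal F \<Longrightarrow> (\<Sum>e\<in>F. inner e (app P e)) \<le> C"
proof -
  obtain x y where xy: "hs x" "hs y" "S = x * y" using assms(1) unfolding tc_def by blast
  have norm_S: "norm (app S v) \<le> norm v" "norm (app (star S) v) \<le> norm v" for v
    using norm_app[of S v] norm_app[of "star S" v] mult_right_mono[OF S1, of "norm v"]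
    by (simp_all add: norm_star)
  \<comment> \<open>For a contraction S this is a positive contraction, so the square root series
    applies and 1 - Z becomes the absolute value of S.\<close>
  define X where "X = 1 - star S * S"
  have inner_S: "inner v (app (star S) (app S v)) = (norm (app S v))\<^sup>2" for v
    using inner_star_self[of v S] by simp
  have "star X = X" by (simp add: X_def)
  moreover have "0 \<le> inner v (app X v)" for v
    using norm_S(1)[of v] by (simp add: X_def inner_diff_right inner_S flip: power2_norm_eq_inner)
  moreover have "norm X \<le> 1"
  proof (rule norm_cbo_le)
    fix v
    let ?w = "app (star S) (app S v)"
    \<comment> \<open>The middle term is twice the squared norm of Sv, and the last is at most one
      such square.\<close>
    have "(norm (v - ?w))\<^sup>2 = (norm v)\<^sup>2 - 2 * inner v ?w + (norm ?w)\<^sup>2"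
      unfolding power2_norm_eq_inner inner_diff_left inner_diff_right
      using inner_commute[of v ?w] by simp
    moreover have "(norm ?w)\<^sup>2 \<le> (norm (app S v))\<^sup>2"
      by (rule power_mono[OF norm_S(2)]) simp
    moreover have "0 \<le> (norm (app S v))\<^sup>2" by simp
    moreover have "app X v = v - ?w" by (simp add: X_def)
    ultimately have "(norm (app X v))\<^sup>2 \<le> (norm v)\<^sup>2"
      unfolding inner_S by (smt (verit))
    then show "norm (app X v) \<le> 1 * norm v"
      by (simp add: power2_le_iff_abs_le)
  qed simp
  ultimately obtain Z where Z: "star Z = Z" "\<And>v. 0 \<le> inner v (app Z v)" "norm Z \<le> 1"
      "(1 - Z) * (1 - Z) = 1 - X"
    using sqrt_series by blast
  define P where "P = 1 - Z"
  have PP: "P * P = star S * S" using Z(4) by (simp add: P_def X_def)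
  have starP: "star P = P" by (simp add: P_def Z(1))
  have norm_Z: "norm (app Z v) \<le> norm v" for v
    using norm_app[of Z v] mult_right_mono[OF Z(3), of "norm v"] by simp
  have posP: "0 \<le> inner v (app P v)" for v
  proof -
    have "inner v (app Z v) \<le> norm v * norm v"
      using norm_cauchy_schwarz[of v "app Z v"] mult_left_mono[OF norm_Z[of v], of "norm v"]
      by simp
    then show ?thesis
      by (simp add: P_def inner_diff_right power2_eq_square flip: power2_norm_eq_inner)
  qed
  have comm: "Z ^ n * P = P * Z ^ n" for n
    by (simp add: P_def algebra_simps power_commutes)
  \<comment> \<open>Z and P commute, so the product can be written symmetrically around P, or for
    odd n around Z - Z squared, which is nonnegative by \<open>norm_le_of_inner\<close>.\<close>
  have nonneg: "0 \<le> inner v (app (Z ^ n * P) v)" for v n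
  proof -
    have move: "inner v (app (Z ^ k * s * Z ^ k) v) = inner (app (Z ^ k) v) (app s (app (Z ^ k) v))"
      for k s using inner_star[of v "Z ^ k"] by (simp add: star_power Z(1))
    show ?thesis
    proof (cases "even n")
      case True
      then obtain k where k: "n = k + k" by (metis mult_2 evenE)
      have "Z ^ n * P = Z ^ k * (Z ^ k * P)" by (simp only: k power_add mult.assoc)
      also have "\<dots> = Z ^ k * P * Z ^ k" by (subst comm) (simp only: mult.assoc)
      finally show ?thesis by (simp only: move posP)
    next
      case False
      then obtain k where k: "n = k + (1 + k)" by (metis oddE mult_2 add.assoc add.commute)
      have "Z ^ n * P = Z ^ k * (Z * (Z ^ k * P))"
        by (simp only: k power_add power_one_right mult.assoc)
      also have "\<dots> = Z ^ k * (Z - Z * Z) * Z ^ k"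
        by (subst comm) (simp add: P_def algebra_simps)
      finally have "Z ^ n * P = Z ^ k * (Z - Z * Z) * Z ^ k" .
      moreover have "0 \<le> inner w (app (Z - Z * Z) w)" for w
        using norm_le_of_inner[OF Z(1-3), of w] inner_star[of w Z "app Z w"]
        by (simp add: inner_diff_right Z(1) power2_norm_eq_inner)
      ultimately show ?thesis by (simp only: move)
    qed
  qed
  have geom: "(\<Sum>k<n. Z ^ k) * P = 1 - Z ^ n" for n
  proof (induction n)
    case (Suc n)
    have "Z ^ n * P = Z ^ n - Z ^ Suc n"
      by (simp add: P_def right_diff_distrib power_commutes)
    then show ?case
      using Suc by (simp add: distrib_right)
  qed simp
  have norm_1Z: "norm (1 - Z ^ n) \<le> 2" for n
  proof -
    have "norm (Z ^ n) \<le> 1"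
      using norm_power_ineq[of Z n] power_le_one[of "norm Z" n] Z(3) by simp
    then show ?thesis using norm_triangle_ineq4[of 1 "Z ^ n"] by simp
  qed
  \<comment> \<open>The terms are nonnegative and their partial sums telescope to the quadratic form
    of \<open>1 - Z ^ n\<close>, which is bounded in n. So the terms tend to 0, and the defect
    \<open>Z ^ n * P\<close> disappears in the limit.\<close>
  have lim: "(\<lambda>n. inner v (app (Z ^ n * P) v)) \<longlonglongrightarrow> 0" for v
  proof (rule summable_LIMSEQ_zero, rule summableI_nonneg_bounded)
    fix n
    show "0 \<le> inner v (app (Z ^ n * P) v)" by (rule nonneg)
    have "(\<Sum>k<n. inner v (app (Z ^ k * P) v)) = inner v (app ((\<Sum>k<n. Z ^ k) * P) v)"
      by (induction n) (simp_all add: distrib_right inner_add_right)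
    also have "\<dots> \<le> norm v * norm (app (1 - Z ^ n) v)"
      unfolding geom by (rule norm_cauchy_schwarz)
    also have "\<dots> \<le> norm v * (2 * norm v)"
      using norm_app[of "1 - Z ^ n" v] mult_right_mono[OF norm_1Z[of n], of "norm v"]
      by (intro mult_left_mono) auto
    finally show "(\<Sum>k<n. inner v (app (Z ^ k * P) v)) \<le> norm v * (2 * norm v)" .
  qed
  \<comment> \<open>The 4 is the square of the bound 2 on the norm of U below; the half comes from
    the arithmetic--geometric mean inequality.\<close>
  define C where "C = (4 * hs_norm2 x + hs_norm2 y) / 2"
  have "(\<Sum>e\<in>F. inner e (app P e)) \<le> C" if F: "finite F" "orthonormal F" for F
  proof -
    have bound: "(\<Sum>e\<in>F. inner e (app P e) - inner e (app (Z ^ n * P) e)) \<le> C" for n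
    proof -
      define h where "h = (\<Sum>k<n. Z ^ k)"
      define U where "U = S * h"
      have starh: "star h = h"
        unfolding h_def by (induction n) (simp_all add: star_power Z(1))
      have hP: "h * P = P * h"
        unfolding h_def by (simp add: sum_distrib_left sum_distrib_right comm)
      have Ph: "P * h = 1 - Z ^ n"
        using geom[of n] by (simp only: h_def hP[unfolded h_def])
      \<comment> \<open>U stands in for the partial isometry: \<open>star U * S\<close> is P up to
        the defect, while U stays bounded because \<open>star U * U\<close> is the square of
        \<open>1 - Z ^ n\<close>.\<close>
      have "star U * S = h * P * P"
        by (simp add: U_def starh mult.assoc PP)
      also have "\<dots> = P - Z ^ n * P"
        unfolding h_def geom by (simp add: algebra_simps)
      finally have US: "star U * S = P - Z ^ n * P" .
      have "norm (star U) \<le> 2"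
        unfolding norm_star
      proof (rule norm_cbo_le)
        fix v
        have "(norm (app U v))\<^sup>2 = inner v (app (star U * U) v)"
          by (simp only: inner_star_self)
        also have "star U * U = h * (star S * S) * h"
          by (simp add: U_def starh mult.assoc)
        also have "\<dots> = star (P * h) * (P * h)"
          by (simp add: starh starP mult.assoc flip: PP)
        also have "inner v (app \<dots> v) = (norm (app (P * h) v))\<^sup>2"
          by (rule inner_star_self)
        finally have "norm (app U v) = norm (app (1 - Z ^ n) v)"
          unfolding Ph by (simp only: power2_eq_iff_nonneg norm_ge_zero)
        also have "\<dots> \<le> 2 * norm v"
          using norm_app[of "1 - Z ^ n" v] mult_right_mono[OF norm_1Z[of n], of "norm v"] by simp
        finally show "norm (app U v) \<le> 2 * norm v" .
      qed simp
      then have "hs_norm2 (star U * x) \<le> 2\<^sup>2 * hs_norm2 x"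
        using hs_norm2_mult_left[OF xy(1), of "star U"]
          mult_right_mono[OF power_mono[of "norm (star U)" 2 2] hs_norm2_nonneg[of x]]
        by fastforce
      then have "(\<Sum>e\<in>F. (norm (app (star (star U * x)) e))\<^sup>2) \<le> 4 * hs_norm2 x"
        using hs_finite_le[OF hs_star[OF hs_mult_left[OF xy(1), of "star U"]] F]
        unfolding hs_norm2_star[OF hs_mult_left[OF xy(1)]] by (simp del: star_simps)
      moreover have "(\<Sum>e\<in>F. (norm (app y e))\<^sup>2) \<le> hs_norm2 y"
        by (rule hs_finite_le[OF xy(2) F])
      moreover have "inner e (app P e) - inner e (app (Z ^ n * P) e) \<le>
          ((norm (app (star (star U * x)) e))\<^sup>2 + (norm (app y e))\<^sup>2) / 2" for e
      proof -
        have "inner e (app P e) - inner e (app (Z ^ n * P) e) = inner e (app (star U * x) (app y e))"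
          using arg_cong[OF US, of "\<lambda>s. inner e (app s e)"]
          by (simp add: xy(3) inner_diff_right)
        also have "\<dots> \<le> norm (app (star (star U * x)) e) * norm (app y e)"
          unfolding inner_star[of e "star U * x"] by (rule norm_cauchy_schwarz)
        finally show ?thesis
          using sum_squares_bound[of "norm (app (star (star U * x)) e)" "norm (app y e)"] by simp
      qed
      then have "(\<Sum>e\<in>F. inner e (app P e) - inner e (app (Z ^ n * P) e)) \<le>
          (\<Sum>e\<in>F. ((norm (app (star (star U * x)) e))\<^sup>2 + (norm (app y e))\<^sup>2) / 2)"
        by (intro sum_mono)
      ultimately show ?thesis
        by (simp add: C_def sum.distrib flip: sum_divide_distrib)
    qed
    have "(\<lambda>n. \<Sum>e\<in>F. inner e (app P e) - inner e (app (Z ^ n * P) e)) \<longlonglongrightarrow>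
        (\<Sum>e\<in>F. inner e (app P e) - 0)"
      by (intro tendsto_intros lim)
    then show ?thesis
      using bound LIMSEQ_le_const2 by fastforce
  qed
  then show ?thesis
    using that starP posP PP by blast
qed

lemma abs_exists:
  fixes S :: "'a::complex_hilbert cbo"
  assumes "tc S"
  obtains P where "star P = P" "\<And>x. 0 \<le> inner x (app P x)" "P * P = star S * S"
    "\<And>E. orthonormal E \<Longrightarrow> (\<lambda>e. inner e (app P e)) summable_on E"
proof -
  \<comment> \<open>Scaling makes S a contraction; the maximum with 1 keeps the divisor away from
    0.\<close>
  define r where "r = max 1 (norm S)"
  have r: "1 \<le> r" "norm S \<le> r" by (auto simp: r_def)
  have eq: "(1 / r) *\<^sub>R S = scal (complex_of_real (1 / r)) * S"
    by (rule cbo_eqI) (simp add: scaleR_cscale)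
  have "tc ((1 / r) *\<^sub>R S)"
    unfolding eq by (rule tc_mult(1)[OF assms])
  moreover have "norm ((1 / r) *\<^sub>R S) \<le> 1" using r by simp
  ultimately obtain P C where P: "star P = P" "\<And>x. 0 \<le> inner x (app P x)"
    "P * P = star ((1 / r) *\<^sub>R S) * ((1 / r) *\<^sub>R S)"
    "\<And>F. finite F \<Longrightarrow> orthonormal F \<Longrightarrow> (\<Sum>e\<in>F. inner e (app P e)) \<le> C"
    using abs_contraction_exists by blast
  show ?thesis
  proof
    show "star (r *\<^sub>R P) = r *\<^sub>R P" by (simp add: P(1))
    show "0 \<le> inner x (app (r *\<^sub>R P) x)" for x using P(2) r by simp
    show "(r *\<^sub>R P) * (r *\<^sub>R P) = star S * S" using P(3) r by simp
    show "(\<lambda>e. inner e (app (r *\<^sub>R P) e)) summable_on E" if "orthonormal E" for E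
    proof -
      have "(\<lambda>e. inner e (app P e)) summable_on E"
        using P(2,4) orthonormal_subset[OF that]
        by (intro nonneg_bdd_above_summable_on) (auto intro!: bdd_aboveI[of _ C])
      then show ?thesis by (simp add: summable_on_cmult_right)
    qed
  qed
qed

section \<open>Operators on the direct sum of two copies\<close>

definition cbo_of :: "('a::complex_hilbert \<Rightarrow> 'a) \<Rightarrow> 'a cbo"
  where "cbo_of f = Abs_cbo (Blinfun f)"

lemma app_cbo_of:
  assumes "bounded_linear f" "bounded_linear g" "\<And>x y. cip (g x) y = cip x (f y)"
  shows "app (cbo_of f) x = f x"
proof -
  have "adjointable (Blinfun f)"
    by (rule adjointableI[of "Blinfun g"]) (simp add: bounded_linear_Blinfun_apply assms)
  then show ?thesis
    by (simp add: cbo_of_def app.rep_eq Abs_cbo_inverse bounded_linear_Blinfun_apply assms)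
qed

definition blk :: "'a::complex_hilbert cbo \<Rightarrow> 'a cbo \<Rightarrow> 'a cbo \<Rightarrow> 'a cbo \<Rightarrow> ('a \<times> 'a) cbo"
  where "blk a b c d = cbo_of (\<lambda>p. (app a (fst p) + app b (snd p), app c (fst p) + app d (snd p)))"

lemma app_blk [simp]:
  "app (blk a b c d) p = (app a (fst p) + app b (snd p), app c (fst p) + app d (snd p))"
  unfolding blk_def
proof (rule app_cbo_of)
  have bl: "bounded_linear (\<lambda>p. (app a (fst p) + app b (snd p), app c (fst p) + app d (snd p)))"
    for a b c d :: "'a cbo"
    by (intro bounded_linear_Pair bounded_linear_add
        bounded_linear_compose[OF bounded_linear_app bounded_linear_fst]
        bounded_linear_compose[OF bounded_linear_app bounded_linear_snd])
  show "bounded_linear (\<lambda>p. (app a (fst p) + app b (snd p), app c (fst p) + app d (snd p)))"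
    by (rule bl)
  show "bounded_linear (\<lambda>p. (app (star a) (fst p) + app (star c) (snd p),
      app (star b) (fst p) + app (star d) (snd p)))"
    by (rule bl)
qed (simp add: cip_prod cip_add_left cip_add_right cip_star_left)

lemma blk_simps:
  "blk a b c d * blk a' b' c' d' =
    blk (a * a' + b * c') (a * b' + b * d') (c * a' + d * c') (c * b' + d * d')"
  "blk a b c d - blk a' b' c' d' = blk (a - a') (b - b') (c - c') (d - d')"
  "scal z * blk a b c d = blk (scal z * a) (scal z * b) (scal z * c) (scal z * d)"
  by (auto intro!: cbo_eqI simp: cscale_prod_def cscale_add_right)

lemma star_blk: "star (blk a b c d) = blk (star a) (star c) (star b) (star d)"
  by (rule star_unique) (simp add: cip_prod cip_add_left cip_add_right cip_star_left)

lemma is_onb_prod: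
  assumes "is_onb cip E"
  shows "is_onb cip ((\<lambda>e. (e, 0)) ` E \<union> Pair 0 ` E)"
  unfolding is_onb_def
proof (intro conjI allI impI)
  have E: "cip e e' = (if e = e' then 1 else 0)" if "e \<in> E" "e' \<in> E" for e e'
    using assms that by (simp add: is_onb_def)
  then have "e \<noteq> 0" if "e \<in> E" for e using that by force
  then show "\<forall>e\<in>(\<lambda>e. (e, 0)) ` E \<union> Pair 0 ` E. \<forall>e'\<in>(\<lambda>e. (e, 0)) ` E \<union> Pair 0 ` E.
      cip e e' = (if e = e' then 1 else 0)"
    using E by (auto simp: cip_prod split: if_splits)
  fix f assume f: "\<forall>e\<in>(\<lambda>e. (e, 0)) ` E \<union> Pair 0 ` E. cip e f = 0"
  have "fst f = 0" "snd f = 0"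
    using assms f unfolding is_onb_def by (auto simp: cip_prod ball_Un)
  then show "f = 0" by (simp add: prod_eq_iff)
qed

lemma has_sum_prod_onb:
  fixes f :: "'a::complex_hilbert \<times> 'a \<Rightarrow> 'b::topological_comm_monoid_add"
  assumes "is_onb cip E" "((\<lambda>e. f (e, 0)) has_sum s) E" "\<And>e. f (0, e) = 0"
  shows "(f has_sum s) ((\<lambda>e. (e, 0)) ` E \<union> Pair 0 ` E)"
proof -
  have "e \<noteq> 0" if "e \<in> E" for e
    using orthonormal_norm[OF is_onb_orthonormal[OF assms(1)] that] by auto
  then have disj: "(\<lambda>e. (e, 0)) ` E \<inter> Pair 0 ` E = {}" by auto
  have "(f has_sum s) ((\<lambda>e. (e, 0)) ` E)"
    using assms(2) by (subst has_sum_reindex) (auto simp: inj_on_def o_def)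
  moreover have "(f has_sum 0) (Pair 0 ` E)"
    by (rule has_sum_0) (auto simp: assms(3))
  ultimately have "(f has_sum (s + 0)) ((\<lambda>e. (e, 0)) ` E \<union> Pair 0 ` E)"
    by (rule has_sum_Un_disjoint) (rule disj)
  then show ?thesis by simp
qed

text \<open>Summability over a single basis bounds the adjoint on all finite orthonormal sets; one
  more adjoint returns to s.\<close>

lemma hsI_onb:
  assumes E: "is_onb cip E" "(\<lambda>e. (norm (app s e))\<^sup>2) summable_on E"
  shows "hs s"
proof -
  have "hs (star s)"
    unfolding hs_def using star_sum_le[OF _ _ E] by blast
  then show ?thesis using hs_star by fastforce
qed

text \<open>The second column vanishes, so in a basis adapted to the direct sum only the vectors of
  the first copy contribute.\<close>

lemma hs_blk:
  assumes "hs a" "hs c"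
  shows "hs (blk a 0 c 0)"
proof (rule hsI_onb[OF is_onb_prod[OF is_onb_some_onb]])
  have "((\<lambda>e. (norm (app a e))\<^sup>2 + (norm (app c e))\<^sup>2) has_sum (hs_norm2 a + hs_norm2 c)) some_onb"
    by (intro has_sum_add hs_norm2_has_sum assms is_onb_some_onb)
  then have "((\<lambda>e. (norm (app (blk a 0 c 0) e))\<^sup>2) has_sum (hs_norm2 a + hs_norm2 c))
      ((\<lambda>e. (e, 0)) ` some_onb \<union> Pair 0 ` some_onb)"
    by (intro has_sum_prod_onb is_onb_some_onb) (simp_all add: norm_Pair)
  then show "(\<lambda>e. (norm (app (blk a 0 c 0) e))\<^sup>2) summable_on
      ((\<lambda>e. (e, 0)) ` some_onb \<union> Pair 0 ` some_onb)"
    by (rule has_sum_imp_summable)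
qed

lemma tc_blk:
  assumes "tc s"
  shows "tc (blk s 0 0 0)"
proof -
  obtain x y where "hs x" "hs y" "s = x * y" using assms unfolding tc_def by blast
  moreover have "hs (0 :: 'a cbo)" by (simp add: hs_def exI[of _ 0])
  ultimately show ?thesis
    using tcI[OF hs_blk[of x 0] hs_blk[of y 0]] by (simp add: blk_simps)
qed

lemma tr_blk:
  assumes "tc s"
  shows "tr (blk s 0 0 0) = tr s"
proof -
  have "((\<lambda>e. cip e (app (blk s 0 0 0) e)) has_sum tr s)
      ((\<lambda>e. (e, 0)) ` some_onb \<union> Pair 0 ` some_onb)"
    using tr_has_sum[OF assms is_onb_some_onb]
    by (intro has_sum_prod_onb is_onb_some_onb) (simp_all add: cip_prod)
  then show ?thesis
    using tr_has_sum[OF tc_blk[OF assms] is_onb_prod[OF is_onb_some_onb]] has_sum_unique by blast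
qed


section \<open>Operators given by graphs\<close>

text \<open>The inner products of the statement are carried over to a complex Hilbert space by a
  bijection \<open>V\<close>, under which everywhere defined bounded operators become elements of the operator
  algebra.\<close>

locale hilbert_representation =
  fixes V :: "'v::complex_vs \<Rightarrow> 'h::complex_hilbert" and ip :: "'v \<Rightarrow> 'v \<Rightarrow> complex"
  assumes bij_V: "bij V"
    and V_add: "V (f + g) = V f + V g"
    and V_cscale: "V (c *\<^sub>C f) = c *\<^sub>C V f"
    and ip_V: "ip f g = cip (V f) (V g)"
begin

definition op_of :: "'h cbo \<Rightarrow> 'v operator"
  where "op_of s = {(f, u). V u = app s (V f)}"

lemma op_of_iff [simp]: "(f, u) \<in> op_of s \<longleftrightarrow> V u = app s (V f)"
  by (simp add: op_of_def)

lemma V_eq_iff [simp]: "V f = V g \<longleftrightarrow> f = g"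
  using bij_V by (simp add: bij_def inj_eq)

lemma V_inv [simp]: "V (inv V x) = x"
  using bij_V by (simp add: bij_def surj_f_inv_f)

lemma V_surj: "\<exists>f. V f = x"
  using V_inv by blast

lemma V_zero [simp]: "V 0 = 0"
  using V_add[of 0 0] by simp

lemma V_minus: "V (- f) = - V f"
  using V_add[of f "- f"] by (simp add: eq_neg_iff_add_eq_0 add.commute)

lemma V_diff: "V (f - g) = V f - V g"
  using V_add[of f "- g"] by (simp add: V_minus)

lemma ip_norm_V: "ip_norm ip f = norm (V f)"
  by (simp add: ip_norm_def ip_V cip_self)

lemma op_eqI: "(\<And>f u. (f, u) \<in> S \<longleftrightarrow> V u = app s (V f)) \<Longrightarrow> S = op_of s"
  by (auto simp: op_of_def)

lemma bounded_op_of: "bounded_op ip (op_of s)"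
  unfolding bounded_op_def ip_norm_V
proof (intro conjI allI)
  show "\<exists>!u. (f, u) \<in> op_of s" for f
    by (rule ex1I[of _ "inv V (app s (V f))"]) (simp_all flip: V_eq_iff)
  show "\<exists>C. \<forall>f u. (f, u) \<in> op_of s \<longrightarrow> norm (V u) \<le> C * norm (V f)"
    by (rule exI[of _ "norm s"]) (simp add: norm_app)
qed (simp add: V_add V_cscale)

lemma op_of_comp: "op_of s \<circ>\<^sub>o op_of t = op_of (s * t)"
proof (rule op_eqI)
  fix f u
  have "(f, u) \<in> op_of s \<circ>\<^sub>o op_of t \<longleftrightarrow> (\<exists>g. V g = app t (V f) \<and> V u = app s (V g))"
    by (auto simp: op_comp_def)
  then show "(f, u) \<in> op_of s \<circ>\<^sub>o op_of t \<longleftrightarrow> V u = app (s * t) (V f)"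
    using V_surj[of "app t (V f)"] by auto
qed

lemma op_of_add: "op_of s +\<^sub>o op_of t = op_of (s + t)"
proof (rule op_eqI)
  fix f u
  show "(f, u) \<in> op_of s +\<^sub>o op_of t \<longleftrightarrow> V u = app (s + t) (V f)"
  proof
    assume "V u = app (s + t) (V f)"
    moreover obtain a b where "V a = app s (V f)" "V b = app t (V f)"
      using V_surj by metis
    ultimately have "u = a + b" "V a = app s (V f)" "V b = app t (V f)"
      by (simp_all add: V_add flip: V_eq_iff)
    then show "(f, u) \<in> op_of s +\<^sub>o op_of t"
      unfolding op_add_def by auto
  qed (auto simp: op_add_def V_add)
qed

lemma op_of_diff: "op_of s -\<^sub>o op_of t = op_of (s - t)"
proof (rule op_eqI)
  fix f u
  show "(f, u) \<in> op_of s -\<^sub>o op_of t \<longleftrightarrow> V u = app (s - t) (V f)"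
  proof
    assume "V u = app (s - t) (V f)"
    moreover obtain a b where "V a = app s (V f)" "V b = app t (V f)"
      using V_surj by metis
    ultimately have "u = a - b" "V a = app s (V f)" "V b = app t (V f)"
      by (simp_all add: V_diff flip: V_eq_iff)
    then show "(f, u) \<in> op_of s -\<^sub>o op_of t"
      unfolding op_diff_def by auto
  qed (auto simp: op_diff_def V_diff)
qed

lemma op_of_scale: "c *\<^sub>o op_of s = op_of (scal c * s)"
proof (rule op_eqI)
  fix f u
  show "(f, u) \<in> c *\<^sub>o op_of s \<longleftrightarrow> V u = app (scal c * s) (V f)"
  proof
    assume "V u = app (scal c * s) (V f)"
    moreover obtain a where "V a = app s (V f)"
      using V_surj by metis
    ultimately have "u = c *\<^sub>C a" "V a = app s (V f)"
      by (simp_all add: V_cscale flip: V_eq_iff)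
    then show "(f, u) \<in> c *\<^sub>o op_of s"
      unfolding op_scale_def by auto
  qed (auto simp: op_scale_def V_cscale)
qed

lemma Id_op_of: "Id = op_of 1"
  by (rule op_eqI) auto

lemma adj_op_of: "adj_op ip (op_of s) = op_of (star s)"
proof (rule op_eqI)
  fix f u
  have "(f, u) \<in> adj_op ip (op_of s) \<longleftrightarrow> (\<forall>g. cip (V f) (app s (V g)) = cip (V u) (V g))"
    unfolding adj_op_def ip_V using V_surj by auto
  also have "\<dots> \<longleftrightarrow> (\<forall>x. cip (app (star s) (V f)) x = cip (V u) x)"
    unfolding cip_star_left using V_surj by metis
  also have "\<dots> \<longleftrightarrow> V u = app (star s) (V f)"
    using cip_eqI cip_commute by metis
  finally show "(f, u) \<in> adj_op ip (op_of s) \<longleftrightarrow> V u = app (star s) (V f)" .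
qed

lemma V_op_app: "V (op_app (op_of s) f) = app s (V f)"
proof -
  have "op_app (op_of s) f = inv V (app s (V f))"
    unfolding op_app_def by (rule the_equality) (simp_all flip: V_eq_iff)
  then show ?thesis by simp
qed

lemma is_onb_V: "is_onb ip E \<longleftrightarrow> is_onb cip (V ` E)"
proof -
  have "(\<forall>f. (\<forall>e\<in>E. cip (V e) (V f) = 0) \<longrightarrow> f = 0) \<longleftrightarrow>
      (\<forall>x. (\<forall>e\<in>E. cip (V e) x = 0) \<longrightarrow> x = 0)"
    using V_surj V_zero V_eq_iff by metis
  then show ?thesis
    unfolding is_onb_def ip_V by (simp add: ball_simps)
qed

lemma inj_V: "inj_on V E"
  by (simp add: inj_on_def)

lemma onb_ip_exists: "\<exists>E. is_onb ip E"
proof -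
  have "is_onb ip (inv V ` some_onb)"
    unfolding is_onb_V image_image by (simp add: is_onb_some_onb)
  then show ?thesis by blast
qed

text \<open>The description in \<open>op_trace\<close> denotes: the sum has the same value in every
  basis, and a basis exists to pin this value down.\<close>

lemma op_trace_op_of:
  assumes "tc s"
  shows "op_trace ip (op_of s) = tr s"
proof -
  have has_sum: "((\<lambda>e. ip e (op_app (op_of s) e)) has_sum tr s) E" if "is_onb ip E" for E
  proof -
    have "((\<lambda>e. cip e (app s e)) has_sum tr s) (V ` E)"
      by (rule tr_has_sum[OF assms]) (use that is_onb_V in blast)
    then show ?thesis
      by (simp add: has_sum_reindex[OF inj_V] o_def ip_V V_op_app)
  qed
  show ?thesis
    unfolding op_trace_def
    by (rule the_equality) (use has_sum onb_ip_exists has_sum_unique in blast)+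
qed

text \<open>Connects the factorisation into two Hilbert--Schmidt operators with the definition
  through the absolute value, for which \<open>abs_exists\<close> provides the witness.\<close>

lemma trace_class_op_of:
  assumes "tc s"
  shows "trace_class ip (op_of s)"
proof -
  obtain P where P: "star P = P" "\<And>x. 0 \<le> inner x (app P x)" "P * P = star s * s"
      "\<And>E. orthonormal E \<Longrightarrow> (\<lambda>e. inner e (app P e)) summable_on E"
    using abs_exists[OF assms] by metis
  have cip_P: "cip x (app P x) = complex_of_real (inner x (app P x))" for x
  proof -
    have "cip x (app P x) = cnj (cip x (app P x))"
      by (metis P(1) cip_star_left cip_commute)
    then show ?thesis
      by (simp add: complex_eq_iff Re_cip)
  qed
  have "positive_op ip (op_of P)"
    by (auto simp: positive_op_def ip_V cip_P P(2))
  then have "is_abs_op ip (op_of s) (op_of P)"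
    unfolding is_abs_op_def adj_op_of op_of_comp P(3) by (simp add: bounded_op_of)
  moreover obtain E where E: "is_onb ip E" using onb_ip_exists by blast
  moreover have "(\<lambda>e. ip e (op_app (op_of P) e)) summable_on E"
  proof -
    have "(\<lambda>e. inner e (app P e)) summable_on V ` E"
      by (rule P(4)) (use E is_onb_V is_onb_orthonormal in blast)
    then show ?thesis
      by (simp add: summable_on_reindex[OF inj_V] o_def ip_V V_op_app cip_P summable_on_of_real)
  qed
  ultimately show ?thesis
    unfolding trace_class_def using bounded_op_of by blast
qed

lemma representation_prod: "hilbert_representation (map_prod V V) (ip2 ip)"
proof
  show "bij (map_prod V V)"
    using bij_betw_map_prod[OF bij_V bij_V] by simp
qed (auto simp: V_add V_cscale cscale_prod_def ip2_def ip_V cip_prod split_beta)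

end

section \<open>Neumann series\<close>

text \<open>The coefficients of \<open>(1 - \<zeta> B - \<zeta>\<^sup>2 A)\<^sup>-\<^sup>1\<close> as a power series in \<open>\<zeta>\<close>.\<close>

fun neumann_coeff :: "'a::real_normed_algebra_1 \<Rightarrow> 'a \<Rightarrow> nat \<Rightarrow> 'a"
  where
    "neumann_coeff A B 0 = 1"
  | "neumann_coeff A B (Suc 0) = B"
  | "neumann_coeff A B (Suc (Suc n)) = B * neumann_coeff A B (Suc n) + A * neumann_coeff A B n"

text \<open>A series commutes with its inverse, so the recursion also holds with the factors on the
  right. This makes the inverse two-sided, and it is the form that the left recursion takes under
  adjoints.\<close>

lemma neumann_coeff_right:
  "neumann_coeff A B (Suc (Suc n)) = neumann_coeff A B (Suc n) * B + neumann_coeff A B n * A"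
proof (induction n rule: less_induct)
  case (less n)
  consider "n = 0" | "n = 1" | m where "n = Suc (Suc m)"
    by (metis One_nat_def old.nat.exhaust)
  then show ?case
  proof cases
    case (3 m)
    let ?c = "neumann_coeff A B"
    have right: "?c (Suc n) = ?c n * B + ?c (Suc m) * A" "?c n = ?c (Suc m) * B + ?c m * A"
      unfolding 3 by (rule less.IH, simp add: 3)+
    have "?c (Suc (Suc n)) = B * (?c n * B + ?c (Suc m) * A) + A * (?c (Suc m) * B + ?c m * A)"
      by (simp only: neumann_coeff.simps(3)[of A B n] right[symmetric])
    also have "\<dots> = (B * ?c n + A * ?c (Suc m)) * B + (B * ?c (Suc m) + A * ?c m) * A"
      by (simp add: algebra_simps)
    also have "B * ?c n + A * ?c (Suc m) = ?c (Suc n)" by (simp add: 3)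
    also have "B * ?c (Suc m) + A * ?c m = ?c n" by (simp add: 3)
    finally show ?thesis .
  qed (simp_all add: algebra_simps)
qed

text \<open>The summand 1 makes the base at least 1, so the lower of the two powers in the recursion
  can be raised to the higher one.\<close>

lemma norm_neumann_coeff: "norm (neumann_coeff A B n) \<le> (1 + norm A + norm B) ^ n"
proof (induction n rule: less_induct)
  case (less n)
  let ?C = "1 + norm A + norm B"
  consider "n = 0" | "n = 1" | m where "n = Suc (Suc m)"
    by (metis One_nat_def old.nat.exhaust)
  then show ?case
  proof cases
    case (3 m)
    have "norm (neumann_coeff A B n) \<le>
        norm B * norm (neumann_coeff A B (Suc m)) + norm A * norm (neumann_coeff A B m)"
      by (simp add: 3 norm_triangle_le add_mono norm_mult_ineq)
    also have "\<dots> \<le> norm B * ?C ^ Suc m + norm A * ?C ^ m"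
      using less[of "Suc m"] less[of m] 3 by (intro add_mono mult_left_mono) auto
    also have "norm A * ?C ^ m \<le> norm A * ?C ^ Suc m"
      by (intro mult_left_mono power_increasing) auto
    also have "norm B * ?C ^ Suc m + norm A * ?C ^ Suc m = (norm B + norm A) * ?C ^ Suc m"
      by (simp add: distrib_right)
    also have "\<dots> \<le> ?C * ?C ^ Suc m"
      by (intro mult_right_mono) auto
    finally show ?thesis by (simp add: 3)
  qed simp_all
qed

lemma neumann_series:
  fixes A B :: "'a::{real_normed_algebra_1, banach}"
  assumes "\<bar>\<zeta>\<bar> * (1 + norm A + norm B) < 1"
  obtains Y where "(\<lambda>n. \<zeta> ^ n *\<^sub>R neumann_coeff A B n) sums Y"
    "(1 - \<zeta> *\<^sub>R (B + \<zeta> *\<^sub>R A)) * Y = 1" "Y * (1 - \<zeta> *\<^sub>R (B + \<zeta> *\<^sub>R A)) = 1"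
proof -
  define y where "y n = \<zeta> ^ n *\<^sub>R neumann_coeff A B n" for n
  have "summable y"
  proof (rule summable_comparison_test')
    show "summable (\<lambda>n. (\<bar>\<zeta>\<bar> * (1 + norm A + norm B)) ^ n)"
      by (rule summable_geometric) (use assms in auto)
    show "norm (y n) \<le> (\<bar>\<zeta>\<bar> * (1 + norm A + norm B)) ^ n" if "n \<ge> 0" for n
      unfolding y_def power_mult_distrib
      by (simp add: power_abs mult_left_mono norm_neumann_coeff)
  qed
  then obtain Y where Y: "y sums Y" by (auto simp: summable_def)
  have y0: "y 0 = 1" "y (Suc 0) = \<zeta> *\<^sub>R B"
    by (simp_all add: y_def)
  have Y1: "(\<lambda>n. y (Suc n)) sums (Y - 1)"
    using Y by (subst sums_Suc_iff) (simp add: y0)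
  have Y2: "(\<lambda>n. y (Suc (Suc n))) sums (Y - 1 - \<zeta> *\<^sub>R B)"
    using Y1 by (subst sums_Suc_iff) (simp add: y0)
  \<comment> \<open>The recursion, multiplied by \<open>\<zeta> ^ (n + 2)\<close> and summed, is the
    inverse relation with the first two terms of Y split off.\<close>
  have "(\<lambda>n. \<zeta> *\<^sub>R (B * y (Suc n)) + \<zeta>\<^sup>2 *\<^sub>R (A * y n)) sums
      (\<zeta> *\<^sub>R (B * (Y - 1)) + \<zeta>\<^sup>2 *\<^sub>R (A * Y))"
    by (intro sums_add sums_scaleR_right sums_mult Y Y1)
  moreover have "\<zeta> *\<^sub>R (B * y (Suc n)) + \<zeta>\<^sup>2 *\<^sub>R (A * y n) = y (Suc (Suc n))" for n
    by (simp add: y_def scaleR_add_right power2_eq_square mult_ac)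
  ultimately have "\<zeta> *\<^sub>R (B * (Y - 1)) + \<zeta>\<^sup>2 *\<^sub>R (A * Y) = Y - 1 - \<zeta> *\<^sub>R B"
    using Y2 sums_unique2 by auto
  then have left: "(1 - \<zeta> *\<^sub>R (B + \<zeta> *\<^sub>R A)) * Y = 1"
    by (simp add: algebra_simps power2_eq_square)
  have "(\<lambda>n. \<zeta> *\<^sub>R (y (Suc n) * B) + \<zeta>\<^sup>2 *\<^sub>R (y n * A)) sums
      (\<zeta> *\<^sub>R ((Y - 1) * B) + \<zeta>\<^sup>2 *\<^sub>R (Y * A))"
    by (intro sums_add sums_scaleR_right sums_mult2 Y Y1)
  moreover have "\<zeta> *\<^sub>R (y (Suc n) * B) + \<zeta>\<^sup>2 *\<^sub>R (y n * A) = y (Suc (Suc n))" for n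
    unfolding y_def neumann_coeff_right by (simp add: scaleR_add_right power2_eq_square mult_ac)
  ultimately have "\<zeta> *\<^sub>R ((Y - 1) * B) + \<zeta>\<^sup>2 *\<^sub>R (Y * A) = Y - 1 - \<zeta> *\<^sub>R B"
    using Y2 sums_unique2 by auto
  then have "Y * (1 - \<zeta> *\<^sub>R (B + \<zeta> *\<^sub>R A)) = 1"
    by (simp add: algebra_simps power2_eq_square)
  with Y left show ?thesis
    using that unfolding y_def by blast
qed


section \<open>The trace identity for an abstract factored operator\<close>

text \<open>\<open>T\<close> is the inverse of the restriction of the Hilbert--Schmidt operator \<open>G\<close> to the range of
  the projection \<open>P\<close>, so that \<open>(T\<^sup>* T)\<^sup>-\<^sup>1 = G G\<^sup>*\<close>.\<close>

locale factored_operator = hilbert_representation V ip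
  for V :: "'v::complex_vs \<Rightarrow> 'h::complex_hilbert" and ip :: "'v \<Rightarrow> 'v \<Rightarrow> complex" +
  fixes G P M :: "'h cbo" and T :: "'v operator"
  assumes hs_G: "hs G"
    and star_M: "star M = M"
    and star_P: "star P = P"
    and P_idem: "P * P = P"
    and G_P: "G * P = G"
    and T_iff: "(f, h) \<in> T \<longleftrightarrow> app P (V h) = V h \<and> V f = app G (V h)"
begin

definition A :: "'h cbo" where "A = G * star G"

definition iM :: "'h cbo" where "iM = scal \<i> * M"

lemma star_A: "star A = A"
  by (simp add: A_def)

lemma star_iM: "star iM = - iM"
  by (simp add: iM_def star_M scal_simps scal_commute[of M])

lemma P_star_G: "P * star G = star G"
  by (metis G_P star_P star_simps(6))

lemma app_P_star_G: "app P (app (star G) x) = app (star G) x"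
  by (metis P_star_G app_simps(6))

lemma hs_star_G: "hs (star G)"
  by (rule hs_star[OF hs_G])

lemma tc_A: "tc A"
  unfolding A_def by (rule tcI[OF hs_G hs_star_G])

text \<open>The range of \<open>P\<close> consists of the vectors \<open>app P x\<close>, and
  \<open>G * P = G\<close> then frees the test vector x. The resulting equation leaves the component
  of v outside the range of \<open>P\<close> undetermined: this is the kernel of the
  adjoint.\<close>

lemma adj_T_iff: "(v, u) \<in> adj_op ip T \<longleftrightarrow> app P (V v) = app (star G) (V u)"
proof -
  have "(v, u) \<in> adj_op ip T \<longleftrightarrow>
      (\<forall>f h. app P (V h) = V h \<and> V f = app G (V h) \<longrightarrow> cip (V v) (V h) = cip (V u) (V f))"
    unfolding adj_op_def by (simp add: T_iff ip_V)
  also have "\<dots> \<longleftrightarrow> (\<forall>y. app P y = y \<longrightarrow> cip (V v) y = cip (V u) (app G y))"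
    using V_surj by metis
  also have "\<dots> \<longleftrightarrow> (\<forall>x. cip (V v) (app P x) = cip (V u) (app G x))"
    using P_idem G_P by (metis app_simps(6))
  also have "\<dots> \<longleftrightarrow> (\<forall>x. cip (app P (V v)) x = cip (app (star G) (V u)) x)"
    by (metis cip_star_left star_P)
  also have "\<dots> \<longleftrightarrow> app P (V v) = app (star G) (V u)"
    using cip_eqI cip_commute by metis
  finally show ?thesis .
qed

lemma T_star_T_iff: "(f, u) \<in> adj_op ip T \<circ>\<^sub>o T \<longleftrightarrow> V f = app A (V u)"
proof -
  have "(f, u) \<in> adj_op ip T \<circ>\<^sub>o T \<longleftrightarrow>
      (\<exists>h. app P (V h) = V h \<and> V f = app G (V h) \<and> app P (V h) = app (star G) (V u))"
    unfolding op_comp_def by (auto simp: T_iff adj_T_iff relcomp_unfold)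
  also have "\<dots> \<longleftrightarrow> (\<exists>y. app P y = y \<and> V f = app G y \<and> app P y = app (star G) (V u))"
    using V_surj by metis
  also have "\<dots> \<longleftrightarrow> V f = app A (V u)"
    using app_P_star_G by (auto simp: A_def)
  finally show ?thesis .
qed

lemma inverse_T_star_T: "(adj_op ip T \<circ>\<^sub>o T)\<inverse> = op_of A"
  by (rule op_eqI) (simp add: T_star_T_iff)

end

text \<open>All identities here are algebra with a two-sided inverse \<open>Y\<close>; the size of
  \<zeta> enters only when the Neumann series produces \<open>Y\<close>.\<close>

locale small_spectral_parameter = factored_operator V ip G P M T
  for V :: "'v::complex_vs \<Rightarrow> 'h::complex_hilbert" and ip G P M T +
  fixes \<zeta> :: real and Y
  assumes inv_left: "(1 - \<zeta> *\<^sub>R (iM * A + \<zeta> *\<^sub>R A)) * Y = 1"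
    and inv_right: "Y * (1 - \<zeta> *\<^sub>R (iM * A + \<zeta> *\<^sub>R A)) = 1"
begin

text \<open>The operator to be inverted is the inverse of \<open>A\<close> minus
  \<open>\<zeta> *\<^sub>R N\<close>. Formally its inverse is \<open>A\<close> times the inverse of
  \<open>1 - \<zeta> *\<^sub>R (N * A)\<close>, which is \<open>k\<close>.\<close>

definition N where "N = \<zeta> *\<^sub>R 1 + iM"
definition k where "k = A * Y"

lemma NA: "\<zeta> *\<^sub>R (iM * A + \<zeta> *\<^sub>R A) = \<zeta> *\<^sub>R (N * A)"
  by (simp add: N_def algebra_simps)

section \<open>Resolvent identities for k, Y and their adjoints\<close>

lemma Y_left: "Y = 1 + \<zeta> *\<^sub>R (N * A * Y)"
  using inv_left unfolding NA by (simp add: algebra_simps)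

lemma Y_right: "Y = 1 + \<zeta> *\<^sub>R (Y * N * A)"
  using inv_right unfolding NA by (simp add: algebra_simps)

lemma star_N: "star N = N - 2 *\<^sub>R iM"
  by (simp add: N_def star_iM scaleR_2)

lemma k_left: "k = A + \<zeta> *\<^sub>R (A * N * k)"
  unfolding k_def by (subst Y_left) (simp add: algebra_simps)

lemma k_right: "k = A + \<zeta> *\<^sub>R (k * N * A)"
  unfolding k_def by (subst Y_right) (simp add: algebra_simps)

lemma star_k_left: "star k = A + \<zeta> *\<^sub>R (A * star N * star k)"
  using arg_cong[OF k_right, of star] by (simp add: star_A mult.assoc)

lemma star_k_right: "star k = A + \<zeta> *\<^sub>R (star k * star N * A)"
  using arg_cong[OF k_left, of star] by (simp add: star_A mult.assoc)

lemma star_Y_left: "star Y = 1 + \<zeta> *\<^sub>R (A * star N * star Y)"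
  using arg_cong[OF Y_right, of star] by (simp add: star_A mult.assoc)

text \<open>This is the resolvent identity: the inverses of \<open>k\<close> and
  \<open>star k\<close> differ by \<open>(2 * \<zeta>) *\<^sub>R iM\<close>. As \<open>A\<close>
  need not have a bounded inverse, it is obtained by inserting the fixed point equations for
  \<open>k\<close> and \<open>star k\<close> and regrouping.\<close>

lemma k_diff_1: "k - star k = (2 * \<zeta>) *\<^sub>R (k * iM * star k)"
proof -
  have "k + \<zeta> *\<^sub>R (k * star N * star k) = star k + \<zeta> *\<^sub>R (k * N * star k)"
  proof -
    have "k + \<zeta> *\<^sub>R (k * star N * star k) =
        (A + \<zeta> *\<^sub>R (k * N * A)) + \<zeta> *\<^sub>R ((A + \<zeta> *\<^sub>R (k * N * A)) * star N * star k)"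
      using k_right by simp
    also have "\<dots> = (A + \<zeta> *\<^sub>R (A * star N * star k)) +
        \<zeta> *\<^sub>R (k * N * (A + \<zeta> *\<^sub>R (A * star N * star k)))"
      by (simp add: algebra_simps)
    also have "\<dots> = star k + \<zeta> *\<^sub>R (k * N * star k)"
      using star_k_left by simp
    finally show ?thesis .
  qed
  then have "k - star k = \<zeta> *\<^sub>R (k * N * star k - k * star N * star k)"
    by (simp add: algebra_simps)
  also have "k * N * star k - k * star N * star k = 2 *\<^sub>R (k * iM * star k)"
    by (simp add: star_N algebra_simps)
  finally show ?thesis
    by (simp add: mult.commute)
qed

lemma k_diff_2: "k - star k = (2 * \<zeta>) *\<^sub>R (star k * iM * k)"
proof -
  have "star k + \<zeta> *\<^sub>R (star k * N * k) = k + \<zeta> *\<^sub>R (star k * star N * k)"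
  proof -
    have "star k + \<zeta> *\<^sub>R (star k * N * k) =
        (A + \<zeta> *\<^sub>R (star k * star N * A)) + \<zeta> *\<^sub>R ((A + \<zeta> *\<^sub>R (star k * star N * A)) * N * k)"
      using star_k_right by simp
    also have "\<dots> = (A + \<zeta> *\<^sub>R (A * N * k)) + \<zeta> *\<^sub>R (star k * star N * (A + \<zeta> *\<^sub>R (A * N * k)))"
      by (simp add: algebra_simps)
    also have "\<dots> = k + \<zeta> *\<^sub>R (star k * star N * k)"
      using k_left by simp
    finally show ?thesis .
  qed
  then have "k - star k = \<zeta> *\<^sub>R (star k * N * k - star k * star N * k)"
    by (simp add: algebra_simps)
  also have "star k * N * k - star k * star N * k = 2 *\<^sub>R (star k * iM * k)"
    by (simp add: star_N algebra_simps)
  finally show ?thesis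
    by (simp add: mult.commute)
qed

text \<open>\<open>1 + \<zeta> *\<^sub>R (k * N)\<close> is the inverse of
  \<open>1 - \<zeta> *\<^sub>R (A * N)\<close>, and \<open>star Y\<close> is the inverse of the same
  expression with \<open>star N\<close>; the difference of two inverses factors as usual.\<close>

lemma resolvent_offdiagonal: "1 + \<zeta> *\<^sub>R (k * N) - star Y = (2 * \<zeta>) *\<^sub>R (k * iM * star Y)"
proof -
  have "(1 + \<zeta> *\<^sub>R (k * N)) * star Y - \<zeta> *\<^sub>R ((A + \<zeta> *\<^sub>R (k * N * A)) * star N * star Y) =
      (1 + \<zeta> *\<^sub>R (k * N)) * (star Y - \<zeta> *\<^sub>R (A * star N * star Y))"
    by (simp add: algebra_simps)
  also have "star Y - \<zeta> *\<^sub>R (A * star N * star Y) = 1"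
    using star_Y_left by (simp add: diff_eq_eq)
  finally have "(1 + \<zeta> *\<^sub>R (k * N)) * star Y - \<zeta> *\<^sub>R (k * star N * star Y) = 1 + \<zeta> *\<^sub>R (k * N)"
    using k_right by simp
  then have "1 + \<zeta> *\<^sub>R (k * N) = star Y + \<zeta> *\<^sub>R (k * (N - star N) * star Y)"
    by (simp add: algebra_simps)
  then show ?thesis
    by (simp add: star_N algebra_simps)
qed

lemma resolvent_offdiagonal': "Y - (1 + \<zeta> *\<^sub>R (star N * star k)) = (2 * \<zeta>) *\<^sub>R (Y * iM * star k)"
  using arg_cong[OF resolvent_offdiagonal, of "\<lambda>s. - star s"]
  by (simp add: star_iM mult.assoc)

text \<open>Insert 1, written through \<open>star Y\<close>, to the right of the first term, and 1,
  written through \<open>Y\<close>, to the left of the second; the parts containing \<open>A\<close>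
  cancel.\<close>

lemma resolvent_lower: "Y * N - star N * star Y = 2 *\<^sub>R (Y * iM * star Y)"
proof -
  have 1: "star Y - \<zeta> *\<^sub>R (A * star N * star Y) = 1" "Y - \<zeta> *\<^sub>R (Y * N * A) = 1"
    using star_Y_left Y_right by (simp_all add: diff_eq_eq)
  have "Y * N * (star Y - \<zeta> *\<^sub>R (A * star N * star Y)) -
      (Y - \<zeta> *\<^sub>R (Y * N * A)) * star N * star Y = Y * (N - star N) * star Y"
    by (simp add: algebra_simps)
  then show ?thesis
    unfolding 1 by (simp add: star_N algebra_simps)
qed

text \<open>Found by solving the system in \<open>resolvent_solution\<close>. The term with
  \<open>P - 1\<close> is the action on the kernel of the adjoint of \<open>T\<close>, where D + B -
  \<zeta> is multiplication by -\<zeta>.\<close>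

definition resolvent_blk where
  "resolvent_blk = blk (\<zeta> *\<^sub>R k) (G + \<zeta> *\<^sub>R (k * N * G))
    (star G * Y) ((1 / \<zeta>) *\<^sub>R (P - 1) + star G * Y * N * G)"

text \<open>The first column of \<open>resolvent_blk\<close>, the only one that meets the entry of
  B; both of its entries are Hilbert--Schmidt.\<close>

definition J where "J = blk (\<zeta> *\<^sub>R k) 0 (star G * Y) 0"

text \<open>Since D is symmetric, the inverses of the resolvent and of its adjoint differ only by
  the skew part of B, that is, by \<open>2 \<i> M\<close> in the upper left corner; this is the
  resolvent identity for them. It is verified entry by entry, and the term with \<open>P - 1\<close>
  cancels because it is self-adjoint.\<close>

lemma resolvent_blk_diff:
  "resolvent_blk - star resolvent_blk = scal (2 * \<i>) * (J * blk M 0 0 0 * star J)"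
proof -
  have J: "J * blk M 0 0 0 * star J = blk
      (\<zeta>\<^sup>2 *\<^sub>R (k * M * star k)) (\<zeta> *\<^sub>R (k * M * (star Y * G)))
      (\<zeta> *\<^sub>R ((star G * Y) * M * star k)) ((star G * Y) * M * (star Y * G))"
    by (simp add: J_def star_blk blk_simps power2_eq_square)
  have 11: "\<zeta> *\<^sub>R k - star (\<zeta> *\<^sub>R k) = scal (2 * \<i>) * (\<zeta>\<^sup>2 *\<^sub>R (k * M * star k))"
  proof -
    have eq: "\<zeta> *\<^sub>R k - star (\<zeta> *\<^sub>R k) = \<zeta> *\<^sub>R (k - star k)"
      by (simp add: scaleR_diff_right)
    show ?thesis
      unfolding eq k_diff_1
      by (rule cbo_eqI) (simp add: iM_def scaleR_cscale cscale_cscale power2_eq_square mult_ac)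
  qed
  have 12: "G + \<zeta> *\<^sub>R (k * N * G) - star (star G * Y) =
      scal (2 * \<i>) * (\<zeta> *\<^sub>R (k * M * (star Y * G)))"
  proof -
    have eq: "G + \<zeta> *\<^sub>R (k * N * G) - star (star G * Y) = (1 + \<zeta> *\<^sub>R (k * N) - star Y) * G"
      by (simp add: algebra_simps)
    show ?thesis
      unfolding eq resolvent_offdiagonal
      by (rule cbo_eqI) (simp add: iM_def scaleR_cscale cscale_cscale power2_eq_square mult_ac)
  qed
  have 21: "star G * Y - star (G + \<zeta> *\<^sub>R (k * N * G)) =
      scal (2 * \<i>) * (\<zeta> *\<^sub>R ((star G * Y) * M * star k))"
  proof -
    have eq: "star G * Y - star (G + \<zeta> *\<^sub>R (k * N * G)) = star G * (Y - (1 + \<zeta> *\<^sub>R (star N * star k)))"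
      by (simp add: algebra_simps)
    show ?thesis
      unfolding eq resolvent_offdiagonal'
      by (rule cbo_eqI) (simp add: iM_def scaleR_cscale cscale_cscale power2_eq_square mult_ac)
  qed
  have 22: "(1 / \<zeta>) *\<^sub>R (P - 1) + star G * Y * N * G -
      star ((1 / \<zeta>) *\<^sub>R (P - 1) + star G * Y * N * G) =
      scal (2 * \<i>) * ((star G * Y) * M * (star Y * G))"
  proof -
    have eq: "(1 / \<zeta>) *\<^sub>R (P - 1) + star G * Y * N * G -
        star ((1 / \<zeta>) *\<^sub>R (P - 1) + star G * Y * N * G) = star G * (Y * N - star N * star Y) * G"
      by (simp add: star_P algebra_simps)
    show ?thesis
      unfolding eq resolvent_lower
      by (rule cbo_eqI) (simp add: iM_def scaleR_cscale cscale_cscale power2_eq_square mult_ac)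
  qed
  show ?thesis
    unfolding resolvent_blk_def star_blk J blk_simps 11 12 21 22 ..
qed

section \<open>Solving for the resolvents on the level of graphs\<close>

lemma inverse_K:
  "(adj_op ip T \<circ>\<^sub>o T -\<^sub>o (complex_of_real \<zeta>)\<^sup>2 *\<^sub>o Id -\<^sub>o (complex_of_real \<zeta> * \<i>) *\<^sub>o op_of M)\<inverse>
    = op_of k"
proof (rule op_eqI)
  fix u f
  let ?S = "adj_op ip T \<circ>\<^sub>o T -\<^sub>o (complex_of_real \<zeta>)\<^sup>2 *\<^sub>o Id -\<^sub>o (complex_of_real \<zeta> * \<i>) *\<^sub>o op_of M"
  have L: "scal ((complex_of_real \<zeta>)\<^sup>2) * 1 + scal (complex_of_real \<zeta> * \<i>) * M = \<zeta> *\<^sub>R N"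
    by (simp add: N_def iM_def scal_simps power2_eq_square scaleR_add_right)
  let ?l = "app (\<zeta> *\<^sub>R N)"
  have "(u, f) \<in> ?S\<inverse> \<longleftrightarrow> (\<exists>a b c. u = a - b - c \<and> V f = app A (V a) \<and>
      V b = app (scal ((complex_of_real \<zeta>)\<^sup>2) * 1) (V f) \<and>
      V c = app (scal (complex_of_real \<zeta> * \<i>) * M) (V f))"
    unfolding Id_op_of op_of_scale op_diff_def by (auto simp: T_star_T_iff)
  also have "\<dots> \<longleftrightarrow> V f = app A (V u + ?l (V f))"
  proof
    assume "\<exists>a b c. u = a - b - c \<and> V f = app A (V a) \<and>
      V b = app (scal ((complex_of_real \<zeta>)\<^sup>2) * 1) (V f) \<and>
      V c = app (scal (complex_of_real \<zeta> * \<i>) * M) (V f)"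
    then obtain a b c where abc: "u = a - b - c" "V f = app A (V a)"
      "V b = app (scal ((complex_of_real \<zeta>)\<^sup>2) * 1) (V f)"
      "V c = app (scal (complex_of_real \<zeta> * \<i>) * M) (V f)" by blast
    then have "V u + ?l (V f) = V a"
      unfolding L[symmetric] app_simps(3) by (simp add: V_diff)
    then show "V f = app A (V u + ?l (V f))" using abc(2) by simp
  next
    assume *: "V f = app A (V u + ?l (V f))"
    obtain b c where bc: "V b = app (scal ((complex_of_real \<zeta>)\<^sup>2) * 1) (V f)"
      "V c = app (scal (complex_of_real \<zeta> * \<i>) * M) (V f)"
      using V_surj by metis
    have "V (u + b + c) = V u + ?l (V f)"
      unfolding L[symmetric] app_simps(3) by (simp add: V_add bc)
    then show "\<exists>a b c. u = a - b - c \<and> V f = app A (V a) \<and>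
      V b = app (scal ((complex_of_real \<zeta>)\<^sup>2) * 1) (V f) \<and>
      V c = app (scal (complex_of_real \<zeta> * \<i>) * M) (V f)"
      using * bc by (intro exI[of _ "u + b + c"] exI[of _ b] exI[of _ c]) simp
  qed
  also have "\<dots> \<longleftrightarrow> V f = app k (V u)"
  proof
    assume *: "V f = app A (V u + ?l (V f))"
    \<comment> \<open>In this variable the implicit equation for f becomes
      \<open>app (1 - \<zeta> *\<^sub>R (N * A)) w = V u\<close>, which \<open>Y\<close>
      solves.\<close>
    define w where "w = V u + ?l (V f)"
    have Aw: "app A w = V f"
      using *[symmetric] unfolding w_def .
    have "w = V u + \<zeta> *\<^sub>R app (N * A) w"
      by (simp add: Aw) (simp add: w_def)
    then have "app (1 - \<zeta> *\<^sub>R (N * A)) w = V u"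
      by (simp add: diff_eq_eq)
    then have "app Y (V u) = app (Y * (1 - \<zeta> *\<^sub>R (N * A))) w"
      by simp
    then have "w = app Y (V u)"
      using inv_right unfolding NA by simp
    then show "V f = app k (V u)"
      using Aw by (simp add: k_def)
  next
    assume *: "V f = app k (V u)"
    have "app Y (V u) = V u + ?l (V f)"
      by (subst Y_left) (simp add: * k_def)
    then show "V f = app A (V u + ?l (V f))"
      using * by (simp add: k_def)
  qed
  finally show "(u, f) \<in> ?S\<inverse> \<longleftrightarrow> V f = app k (V u)" .
qed

text \<open>Here s and h are the images of the components under the adjoint of \<open>T\<close> and
  under \<open>T\<close>. Applying \<open>P\<close> to the last equation expresses h through s and
  v; then x is known in terms of s, and the equation for u is solved for s by
  \<open>Y\<close>.\<close>

lemma resolvent_solution: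
  assumes "\<zeta> \<noteq> 0"
  shows "(\<exists>s h. app P y = app (star G) s \<and> app P h = h \<and> x = app G h \<and> u = s - app N x \<and>
      v = h - \<zeta> *\<^sub>R y) \<longleftrightarrow>
    x = app (\<zeta> *\<^sub>R k) u + app (G + \<zeta> *\<^sub>R (k * N * G)) v \<and>
    y = app (star G * Y) u + app ((1 / \<zeta>) *\<^sub>R (P - 1) + star G * Y * N * G) v"
    (is "?L \<longleftrightarrow> ?R")
proof
  assume ?L
  then obtain s h where sh: "app P y = app (star G) s" "app P h = h" "x = app G h"
    "u = s - app N x" "v = h - \<zeta> *\<^sub>R y" by blast
  have "app P h = app P (v + \<zeta> *\<^sub>R y)" by (simp add: sh(5))
  then have h: "h = app P v + \<zeta> *\<^sub>R app (star G) s"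
    by (simp add: sh(1,2))
  have "app G (app P v) = app G v" using G_P by (metis app_simps(6))
  then have x: "x = app G v + \<zeta> *\<^sub>R app A s"
    unfolding sh(3) h by (simp add: A_def)
  have "app (1 - \<zeta> *\<^sub>R (N * A)) s = u + app (N * G) v"
    by (simp add: sh(4) x)
  then have "app (Y * (1 - \<zeta> *\<^sub>R (N * A))) s = app Y (u + app (N * G) v)"
    by simp
  then have s: "s = app Y u + app (Y * N * G) v"
    using inv_right unfolding NA by simp
  have "\<zeta> *\<^sub>R y = h - v" by (simp add: sh(5))
  then have "(1 / \<zeta>) *\<^sub>R (\<zeta> *\<^sub>R y) = (1 / \<zeta>) *\<^sub>R (app (P - 1) v + \<zeta> *\<^sub>R app (star G) s)"
    unfolding h by simp
  then have "y = (1 / \<zeta>) *\<^sub>R app (P - 1) v + app (star G) s"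
    using assms by (simp add: scaleR_add_right)
  then show ?R
    unfolding x by (simp add: s k_def scaleR_add_right)
next
  assume ?R
  \<comment> \<open>The values of s and h found by elimination in the other direction.\<close>
  define s where "s = app Y (u + app (N * G) v)"
  define h where "h = app P v + \<zeta> *\<^sub>R app (star G) s"
  have x: "x = app G v + \<zeta> *\<^sub>R app A s"
    using \<open>?R\<close> by (simp add: s_def k_def scaleR_add_right)
  have y: "y = (1 / \<zeta>) *\<^sub>R app (P - 1) v + app (star G) s"
    using \<open>?R\<close> by (simp add: s_def)
  have PP: "app P (app P v) = app P v" using P_idem by (metis app_simps(6))
  have GP: "app G (app P v) = app G v" using G_P by (metis app_simps(6))
  have "app P y = app (star G) s"
    by (simp add: y PP app_P_star_G)
  moreover have "app P h = h"
    by (simp add: h_def PP app_P_star_G)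
  moreover have "x = app G h"
    by (simp add: h_def x GP A_def)
  moreover have "u = s - app N x"
  proof -
    have "s = app (1 + \<zeta> *\<^sub>R (N * A * Y)) (u + app (N * G) v)"
      using Y_left by (simp add: s_def)
    also have "\<dots> = u + app (N * G) v + \<zeta> *\<^sub>R app (N * A) s"
      by (simp add: s_def scaleR_add_right)
    finally show ?thesis
      by (simp add: x algebra_simps)
  qed
  moreover have "v = h - \<zeta> *\<^sub>R y"
    using assms by (simp add: h_def y scaleR_add_right)
  ultimately show ?L by blast
qed

interpretation prod: hilbert_representation "map_prod V V" "ip2 ip"
  by (rule representation_prod)

lemma resolvent_graph:
  "((u, v), (f, g)) \<in> (block_op op_zero (adj_op ip T) T op_zero +\<^sub>o
      block_op ((- \<i>) *\<^sub>o op_of M) op_zero op_zero op_zero -\<^sub>o z *\<^sub>o Id)\<inverse> \<longleftrightarrow>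
    (\<exists>s h. (g, s) \<in> adj_op ip T \<and> (f, h) \<in> T \<and>
      (\<exists>m. V m = app M (V f) \<and> u = s + (- \<i>) *\<^sub>C m - z *\<^sub>C f) \<and> v = h - z *\<^sub>C g)"
  unfolding op_diff_def op_add_def block_op_def op_zero_def op_scale_def cscale_prod_def
  by (simp add: cscale_prod_def) blast

lemma inverse_D_B:
  assumes "\<zeta> \<noteq> 0"
  shows "(block_op op_zero (adj_op ip T) T op_zero +\<^sub>o
      block_op ((- \<i>) *\<^sub>o op_of M) op_zero op_zero op_zero -\<^sub>o complex_of_real \<zeta> *\<^sub>o Id)\<inverse>
    = prod.op_of resolvent_blk" (is "?R = _")
proof (rule prod.op_eqI)
  fix q p :: "'v \<times> 'v"
  obtain u v f g where qp: "q = (u, v)" "p = (f, g)" by fastforce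
  have N_app: "app N x = \<zeta> *\<^sub>R x + \<i> *\<^sub>C app M x" for x
    by (simp add: N_def iM_def)
  have "(q, p) \<in> ?R \<longleftrightarrow> (\<exists>s h. app P (V g) = app (star G) (V s) \<and> app P (V h) = V h \<and>
      V f = app G (V h) \<and> V u = V s - app N (V f) \<and> V v = V h - \<zeta> *\<^sub>R V g)"
  proof -
    have 1: "(\<exists>m. V m = app M (V f) \<and> u = s + (- \<i>) *\<^sub>C m - complex_of_real \<zeta> *\<^sub>C f) \<longleftrightarrow>
        V u = V s - app N (V f)" for s
    proof -
      obtain m where m: "V m = app M (V f)" using V_surj by blast
      then have "V m' = app M (V f) \<longleftrightarrow> m' = m" for m'
        by (metis V_eq_iff)
      moreover have "u = s + (- \<i>) *\<^sub>C m - complex_of_real \<zeta> *\<^sub>C f \<longleftrightarrow> V u = V s - app N (V f)"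
        by (simp add: V_add V_diff V_minus V_cscale m N_app scaleR_cscale cscale_minus_left
            algebra_simps flip: V_eq_iff)
      ultimately show ?thesis by simp
    qed
    have 2: "v = h - complex_of_real \<zeta> *\<^sub>C g \<longleftrightarrow> V v = V h - \<zeta> *\<^sub>R V g" for h
      by (simp add: V_diff V_cscale scaleR_cscale flip: V_eq_iff)
    show ?thesis
      unfolding qp resolvent_graph 1 2 adj_T_iff T_iff by blast
  qed
  also have "\<dots> \<longleftrightarrow> (\<exists>s h. app P (V g) = app (star G) s \<and> app P h = h \<and>
      V f = app G h \<and> V u = s - app N (V f) \<and> V v = h - \<zeta> *\<^sub>R V g)"
    using V_surj by metis
  also have "\<dots> \<longleftrightarrow> map_prod V V p = app resolvent_blk (map_prod V V q)"
    unfolding resolvent_solution[OF assms] by (simp add: qp resolvent_blk_def)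
  finally show "(q, p) \<in> ?R \<longleftrightarrow> map_prod V V p = app resolvent_blk (map_prod V V q)" .
qed

lemma hs_J: "hs J"
  unfolding J_def
proof (rule hs_blk)
  have "\<zeta> *\<^sub>R k = (scal (complex_of_real \<zeta>) * G) * (star G * Y)"
    by (simp add: k_def A_def scal_simps mult.assoc)
  then show "hs (\<zeta> *\<^sub>R k)"
    using hs_mult_right[OF hs_mult_left[OF hs_G]] by simp
  show "hs (star G * Y)"
    by (rule hs_mult_right[OF hs_star_G])
qed

lemma op_Im_resolvent:
  assumes "\<zeta> \<noteq> 0"
  shows "op_Im (ip2 ip) ((block_op op_zero (adj_op ip T) T op_zero +\<^sub>o
      block_op ((- \<i>) *\<^sub>o op_of M) op_zero op_zero op_zero -\<^sub>o complex_of_real \<zeta> *\<^sub>o Id)\<inverse>)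
    = prod.op_of (J * blk M 0 0 0 * star J)"
proof -
  have "scal (1 / (2 * \<i>)) * (scal (2 * \<i>) * x) = x" for x :: "('h \<times> 'h) cbo"
  proof -
    have "scal (1 / (2 * \<i>)) * (scal (2 * \<i>) * x) = scal (1 / (2 * \<i>) * (2 * \<i>)) * x"
      by (simp only: scal_simps(2) mult.assoc)
    then show ?thesis by (simp add: scal_simps(3))
  qed
  then show ?thesis
    unfolding inverse_D_B[OF assms] op_Im_def prod.adj_op_of prod.op_of_diff prod.op_of_scale
      resolvent_blk_diff by simp
qed

lemma tc_k: "tc k"
  unfolding k_def by (rule tc_mult(2)[OF tc_A])

lemma tc_Im: "tc (J * blk M 0 0 0 * star J)"
  by (intro tcI hs_mult_right hs_J hs_star)

text \<open>Cyclicity moves the operator into the upper left block. The resolvent identities then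
  express both sides in the three traces a, b and c, and \<open>tr (star k)\<close> cancels when the
  conjugate is subtracted.\<close>

lemma tr_Im_resolvent:
  "tr (J * blk M 0 0 0 * star J) =
    complex_of_real (Im (tr ((scal (2 * complex_of_real \<zeta>) + iM) * k)))"
proof -
  define a where "a = tr (iM * star k)"
  define b where "b = tr (iM * star k * k)"
  define c where "c = tr (iM * star k * iM * k)"
  have tc_star_k: "tc (star k)" by (rule tc_star[OF tc_k])
  have tc_iMk: "tc (iM * k)" "tc (iM * star k)"
    by (intro tc_mult(1) tc_k tc_star_k)+
  \<comment> \<open>The upper left entry of \<open>blk M 0 0 0 * star J * J\<close>, whose other
    entries vanish.\<close>
  let ?q = "M * (\<zeta>\<^sup>2 *\<^sub>R (star k * k) + star Y * A * Y)"
  have tc_q: "tc ?q"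
  proof -
    have "?q = (M * (\<zeta>\<^sup>2 *\<^sub>R (star k * G) + star Y * G)) * (star G * Y)"
      by (simp add: k_def A_def algebra_simps)
    moreover have "hs (M * (\<zeta>\<^sup>2 *\<^sub>R (star k * G) + star Y * G))"
    proof (intro hs_mult_left hs_add)
      have "\<zeta>\<^sup>2 *\<^sub>R (star k * G) = (scal (complex_of_real (\<zeta>\<^sup>2)) * star k) * G"
        by (simp only: scal_simps mult_scaleR_left mult_1_left)
      then show "hs (\<zeta>\<^sup>2 *\<^sub>R (star k * G))"
        using hs_mult_left[OF hs_G] by simp
    qed (rule hs_G)
    ultimately show ?thesis
      by (simp only: tcI[OF _ hs_mult_right[OF hs_star_G]])
  qed
  have "tr (J * blk M 0 0 0 * star J) = tr (blk M 0 0 0 * star J * J)"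
    using tr_commute_hs[OF hs_J hs_mult_left[OF hs_star[OF hs_J]], of "blk M 0 0 0"]
    by (simp add: mult.assoc)
  also have "blk M 0 0 0 * star J * J = blk ?q 0 0 0"
    by (simp add: J_def star_blk blk_simps A_def power2_eq_square algebra_simps)
  also have "tr \<dots> = tr ?q"
    by (rule tr_blk[OF tc_q])
  finally have J: "tr (J * blk M 0 0 0 * star J) = tr ?q" .
  have "star Y * A * Y = star k + \<zeta> *\<^sub>R (star k * N * k)"
    using arg_cong[OF Y_left, of "\<lambda>y. star Y * A * y"]
    by (simp add: k_def star_A distrib_left mult.assoc)
  then have "scal (2 * \<i>) * ?q = 2 *\<^sub>R (iM * star k) + (4 * \<zeta>\<^sup>2) *\<^sub>R (iM * star k * k) +
      (2 * \<zeta>) *\<^sub>R (iM * star k * iM * k)"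
  proof -
    have iM2: "scal (2 * \<i>) * (M * x) = 2 *\<^sub>R (iM * x)" for x
      by (rule cbo_eqI) (simp add: iM_def scaleR_cscale cscale_cscale)
    show ?thesis
      unfolding iM2 \<open>star Y * A * Y = _\<close>
      by (simp add: N_def algebra_simps power2_eq_square)
        (simp flip: scaleR_add_left)
  qed
  also have "\<dots> = (iM * star k) * (2 *\<^sub>R 1 + ((4 * \<zeta>\<^sup>2) *\<^sub>R k + (2 * \<zeta>) *\<^sub>R (iM * k)))"
    by (simp add: distrib_left mult.assoc)
  also have "tr \<dots> = 2 * a + 4 * complex_of_real \<zeta> ^ 2 * b + 2 * complex_of_real \<zeta> * c"
  proof -
    interpret lin: bounded_linear "\<lambda>x. tr (iM * star k * x)"
      by (rule bounded_linear_tr[OF tc_iMk(2)])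
    show ?thesis
      unfolding lin.add lin.scaleR
      by (simp add: a_def b_def c_def scaleR_conv_of_real mult.assoc)
  qed
  finally have q: "2 * \<i> * tr ?q = 2 * a + 4 * complex_of_real \<zeta> ^ 2 * b + 2 * complex_of_real \<zeta> * c"
    by (simp add: tr_scal[OF tc_q])
  have tr_k: "tr k = tr (star k) + 2 * complex_of_real \<zeta> * b"
  proof -
    have "tr k = tr (star k + (2 * \<zeta>) *\<^sub>R (k * iM * star k))"
      using k_diff_1 by (simp add: diff_eq_eq add.commute)
    also have "\<dots> = tr (star k) + 2 * complex_of_real \<zeta> * tr (k * (iM * star k))"
      by (simp add: tr_add tc_scaleR tc_star_k tc_mult tc_iMk tr_scaleR mult.assoc)
    also have "tr (k * (iM * star k)) = b"
      unfolding b_def by (rule tr_commute[OF tc_iMk(2)])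
    finally show ?thesis .
  qed
  have tr_iMk: "tr (iM * k) = a + 2 * complex_of_real \<zeta> * c"
  proof -
    have "k = star k + (2 * \<zeta>) *\<^sub>R (star k * iM * k)"
      using k_diff_2 by (simp add: diff_eq_eq add.commute)
    then have "iM * k = iM * star k + (2 * \<zeta>) *\<^sub>R (iM * star k * iM * k)"
      by (metis distrib_left mult_scaleR_right mult.assoc)
    then have "tr (iM * k) = tr (iM * star k + (2 * \<zeta>) *\<^sub>R (iM * star k * iM * k))"
      by (rule arg_cong)
    also have "\<dots> = a + 2 * complex_of_real \<zeta> * c"
      by (simp add: tr_add tc_scaleR tc_iMk tc_mult tr_scaleR a_def c_def mult.assoc)
    finally show ?thesis .
  qed
  let ?S = "(scal (2 * complex_of_real \<zeta>) + iM) * k"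
  have S: "tr ?S = 2 * complex_of_real \<zeta> * tr k + tr (iM * k)"
    by (simp add: distrib_right tr_add tc_mult tc_k tc_iMk tr_scal)
  have "cnj (tr ?S) = 2 * complex_of_real \<zeta> * tr (star k) - a"
  proof -
    have "cnj (tr k) = tr (star k)" by (rule tr_star[OF tc_k, symmetric])
    moreover have "cnj (tr (iM * k)) = tr (star k * - iM)"
      using tr_star[OF tc_iMk(1)] by (simp add: star_iM)
    moreover have "tr (star k * - iM) = - tr (star k * iM)"
      using tr_scaleR[OF tc_mult(2)[OF tc_star_k, of iM], of "-1"] by simp
    moreover have "tr (star k * iM) = a"
      unfolding a_def by (rule tr_commute[OF tc_star_k, symmetric])
    ultimately show ?thesis by (simp add: S)
  qed
  then have "tr ?S - cnj (tr ?S) = 2 * \<i> * tr ?q"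
    unfolding q S tr_k tr_iMk by (simp add: algebra_simps power2_eq_square)
  then have "2 * \<i> * complex_of_real (Im (tr ?S)) = 2 * \<i> * tr ?q"
    by (simp add: complex_diff_cnj)
  then show ?thesis
    unfolding J by simp
qed

end

section \<open>The power series of the trace\<close>

context factored_operator
begin

text \<open>The coefficient of \<open>\<zeta> ^ n\<close> in \<open>k\<close>, because
  \<open>k\<close> is \<open>A\<close> times the Neumann series.\<close>

definition X :: "nat \<Rightarrow> 'h cbo" where "X n = A * neumann_coeff A (iM * A) n"

lemma X_0: "X 0 = A" and X_1: "X (Suc 0) = A * iM * A"
  by (simp_all add: X_def mult.assoc)

lemma X_left: "X (Suc (Suc n)) = A * iM * X (Suc n) + A * X n"
  by (simp add: X_def algebra_simps)

lemma X_right: "X (Suc (Suc n)) = X (Suc n) * iM * A + X n * A"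
  unfolding X_def neumann_coeff_right by (simp add: algebra_simps)

text \<open>The adjoint reverses products, hence exchanges the left and the right recursion, and
  every factor \<open>iM\<close> contributes a sign; in each term the number of these factors has
  the parity of n.\<close>

lemma star_X: "star (X n) = (- 1) ^ n *\<^sub>R X n"
proof (induction n rule: less_induct)
  case (less n)
  consider "n = 0" | "n = 1" | m where "n = Suc (Suc m)"
    by (metis One_nat_def old.nat.exhaust)
  then show ?case
  proof cases
    case (3 m)
    have "star (X n) = star (X (Suc m)) * star iM * star A + star (X m) * star A"
      unfolding 3 X_left by (simp add: mult.assoc)
    also have "\<dots> = (- 1) ^ Suc m *\<^sub>R X (Suc m) * - iM * A + (- 1) ^ m *\<^sub>R X m * A"
      using less[of m] less[of "Suc m"] by (simp add: star_iM star_A 3)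
    also have "\<dots> = (- 1) ^ n *\<^sub>R X n"
      unfolding 3 X_right by (simp add: scaleR_add_right)
    finally show ?thesis .
  qed (simp_all add: X_0 X_1 star_A star_iM mult.assoc)
qed

lemma tc_X: "tc (X n)" "tc (iM * X n)"
  unfolding X_def by (intro tc_mult tc_A)+

text \<open>\<open>trace_coeff n\<close> is the coefficient of \<open>\<zeta>\<^sup>n\<close> in the trace of
  \<open>(2\<zeta> + i M) (T\<^sup>* T - \<zeta>\<^sup>2 - \<zeta> i M)\<^sup>-\<^sup>1\<close>.\<close>

definition trace_coeff :: "nat \<Rightarrow> complex"
  where "trace_coeff n = tr (iM * X n) + (case n of 0 \<Rightarrow> 0 | Suc m \<Rightarrow> 2 * tr (X m))"

text \<open>The additional \<open>iM\<close> in the first summand costs one sign, and in the second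
  the index is shifted by one, so both follow the same rule. Even coefficients are imaginary and odd
  ones real.\<close>

lemma cnj_trace_coeff: "cnj (trace_coeff n) = (- 1) ^ Suc n * trace_coeff n"
proof -
  have X: "cnj (tr (X n)) = (- 1) ^ n * tr (X n)" for n
    using tr_star[OF tc_X(1), of n] tr_scaleR[OF tc_X(1), of "(- 1) ^ n" n]
    by (simp add: star_X)
  have iMX: "cnj (tr (iM * X n)) = (- 1) ^ Suc n * tr (iM * X n)" for n
  proof -
    have "star (iM * X n) = (- 1) ^ Suc n *\<^sub>R (X n * iM)"
      by (simp add: star_X star_iM)
    then show ?thesis
      using tr_star[OF tc_X(2), of n] tr_scaleR[OF tc_mult(2)[OF tc_X(1)], of "(- 1) ^ Suc n" n iM]
        tr_commute[OF tc_X(1), of iM n] by simp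
  qed
  show ?thesis
    unfolding trace_coeff_def using X iMX by (cases n) (simp_all add: distrib_left)
qed

lemma Im_trace_coeff_odd: "odd n \<Longrightarrow> Im (trace_coeff n) = 0"
  using arg_cong[OF cnj_trace_coeff[of n], of Im] by simp

lemma trace_coeff_even: "even n \<Longrightarrow> complex_of_real (Im (trace_coeff n)) = - \<i> * trace_coeff n"
  using arg_cong[OF cnj_trace_coeff[of n], of Re] by (simp add: complex_eq_iff)

lemma iM_left: "iM * x = scal \<i> * (M * x)"
  by (simp add: iM_def mult.assoc)

lemma trace_coeff_0: "complex_of_real (Im (trace_coeff 0)) = tr (M * A)"
  unfolding trace_coeff_even[OF even_zero]
  by (simp add: trace_coeff_def X_0 iM_left tr_scal tc_mult tc_A)

text \<open>\<open>X 2\<close> contributes the word with three factors \<open>iM\<close>, where the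
  cube of \<i> gives the minus sign, and one copy of the trace of \<open>M * A * A\<close>; twice
  \<open>X 1\<close> adds two more copies by cyclicity, which makes the 3.\<close>

lemma trace_coeff_2:
  "complex_of_real (Im (trace_coeff 2)) =
    - tr (M * A * M * A * M * A) + 3 * tr (M * A * A)"
proof -
  have tc: "tc (M * A * M * A * M * A)" "tc (M * A * A)" "tc (A * M * A)"
    by (intro tc_mult tc_A)+
  have "iM * X 2 = scal (- \<i>) * (M * A * M * A * M * A) + scal \<i> * (M * A * A)"
    by (rule cbo_eqI)
      (simp add: numeral_2_eq_2 X_left X_0 X_1 iM_def cscale_cscale cscale_add_right
        cscale_minus_left cscale_one)
  then have 1: "tr (iM * X 2) = - \<i> * tr (M * A * M * A * M * A) + \<i> * tr (M * A * A)"
    by (simp add: tr_add tr_scal tc_mult tc)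
  have "X 1 = scal \<i> * (A * M * A)"
    by (rule cbo_eqI) (simp add: X_1 iM_def)
  then have "tr (X 1) = \<i> * tr (A * M * A)"
    by (simp only: tr_scal[OF tc(3)])
  also have "tr (A * M * A) = tr (M * A * A)"
    using tr_commute[OF tc_A, of "M * A"] by (simp only: mult.assoc)
  finally have 2: "tr (X 1) = \<i> * tr (M * A * A)" .
  have c: "trace_coeff 2 = tr (iM * X 2) + 2 * tr (X 1)"
    by (simp add: trace_coeff_def numeral_2_eq_2)
  show ?thesis
    unfolding trace_coeff_even[OF even_numeral] unfolding c 1 2 by (simp add: algebra_simps)
qed

lemma trace_series:
  fixes \<zeta> :: real
  assumes Y: "(\<lambda>n. \<zeta> ^ n *\<^sub>R neumann_coeff A (iM * A) n) sums Y"
  shows "(\<lambda>n. trace_coeff n * complex_of_real \<zeta> ^ n) sums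
    tr ((scal (2 * complex_of_real \<zeta>) + iM) * (A * Y))"
proof -
  let ?c = "neumann_coeff A (iM * A)"
  have 1: "(\<lambda>n. tr (iM * X n) * complex_of_real \<zeta> ^ n) sums tr (iM * (A * Y))"
  proof -
    have "(\<lambda>n. tr (iM * A * (\<zeta> ^ n *\<^sub>R ?c n))) sums tr (iM * A * Y)"
      by (rule bounded_linear.sums[OF bounded_linear_tr[OF tc_mult(1)[OF tc_A]] Y])
    moreover have "tr (iM * A * (\<zeta> ^ n *\<^sub>R ?c n)) = tr (iM * X n) * complex_of_real \<zeta> ^ n" for n
      using tr_scaleR[OF tc_X(2), of "\<zeta> ^ n" n] by (simp add: X_def mult.assoc mult.commute)
    ultimately show ?thesis by (simp add: mult.assoc)
  qed
  have 2: "(\<lambda>n. tr (X n) * complex_of_real \<zeta> ^ n) sums tr (A * Y)"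
  proof -
    have "(\<lambda>n. tr (A * (\<zeta> ^ n *\<^sub>R ?c n))) sums tr (A * Y)"
      by (rule bounded_linear.sums[OF bounded_linear_tr[OF tc_A] Y])
    moreover have "tr (A * (\<zeta> ^ n *\<^sub>R ?c n)) = tr (X n) * complex_of_real \<zeta> ^ n" for n
      using tr_scaleR[OF tc_X(1), of "\<zeta> ^ n" n] by (simp add: X_def mult.commute)
    ultimately show ?thesis by simp
  qed
  \<comment> \<open>The factor \<open>2 * \<zeta>\<close> raises the exponent by one, and the value
    0 at n = 0 fills the gap.\<close>
  have "(\<lambda>n. (case Suc n of 0 \<Rightarrow> 0 | Suc m \<Rightarrow> 2 * tr (X m)) * complex_of_real \<zeta> ^ Suc n) sums
      (2 * complex_of_real \<zeta> * tr (A * Y))"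
    using sums_mult[OF 2, of "2 * complex_of_real \<zeta>"] by (simp add: mult_ac)
  then have "(\<lambda>n. (case n of 0 \<Rightarrow> 0 | Suc m \<Rightarrow> 2 * tr (X m)) * complex_of_real \<zeta> ^ n) sums
      (2 * complex_of_real \<zeta> * tr (A * Y))"
    by (subst (asm) sums_Suc_iff) simp
  from sums_add[OF 1 this] have "(\<lambda>n. trace_coeff n * complex_of_real \<zeta> ^ n) sums
      (tr (iM * (A * Y)) + 2 * complex_of_real \<zeta> * tr (A * Y))"
    by (simp add: trace_coeff_def distrib_right)
  moreover have "tr ((scal (2 * complex_of_real \<zeta>) + iM) * (A * Y)) =
      tr (iM * (A * Y)) + 2 * complex_of_real \<zeta> * tr (A * Y)"
    unfolding distrib_right by (simp add: tr_add tr_scal tc_mult tc_A)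
  ultimately show ?thesis by simp
qed

lemma sums_Im_trace:
  assumes "(\<lambda>n. trace_coeff n * complex_of_real \<zeta> ^ n) sums s"
  shows "(\<lambda>m. Im (trace_coeff (2 * m)) * \<zeta> ^ (2 * m)) sums Im s"
proof -
  have "(\<lambda>n. Im (trace_coeff n) * \<zeta> ^ n) sums Im s"
    using sums_Im[OF assms] by (simp flip: of_real_power)
  moreover have "Im (trace_coeff n) * \<zeta> ^ n = 0" if "n \<notin> range (\<lambda>m. 2 * m)" for n
    using that Im_trace_coeff_odd[of n] by (auto elim: evenE)
  moreover have "strict_mono (\<lambda>m::nat. 2 * m)"
    by (simp add: strict_mono_def)
  ultimately show ?thesis
    using sums_mono_reindex[of "\<lambda>m. 2 * m" "\<lambda>n. Im (trace_coeff n) * \<zeta> ^ n"] by blast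
qed

theorem trace_formula:
  "\<exists>t :: nat \<Rightarrow> real.
    (\<exists>\<epsilon>>0. \<forall>\<zeta>::real. \<zeta> \<noteq> 0 \<and> \<bar>\<zeta>\<bar> < \<epsilon> \<longrightarrow>
      (let z = complex_of_real \<zeta>;
           D = block_op op_zero (adj_op ip T) T op_zero;
           B = block_op ((- \<i>) *\<^sub>o op_of M) op_zero op_zero op_zero;
           ImR = op_Im (ip2 ip) ((D +\<^sub>o B -\<^sub>o z *\<^sub>o Id)\<inverse>);
           K = (adj_op ip T \<circ>\<^sub>o T -\<^sub>o z\<^sup>2 *\<^sub>o Id -\<^sub>o (z * \<i>) *\<^sub>o op_of M)\<inverse>;
           S = ((2 * z) *\<^sub>o Id +\<^sub>o \<i> *\<^sub>o op_of M) \<circ>\<^sub>o K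
       in trace_class (ip2 ip) ImR \<and> bounded_op ip K \<and> trace_class ip S \<and>
          op_trace (ip2 ip) ImR = complex_of_real (Im (op_trace ip S)) \<and>
          (\<lambda>m. t (2 * m) * \<zeta> ^ (2 * m)) sums Im (op_trace ip S))) \<and>
    complex_of_real (t 0) = tr (M * A) \<and>
    complex_of_real (t 2) = - tr (M * A * M * A * M * A) + 3 * tr (M * A * A)"
proof (intro exI[of _ "\<lambda>n. Im (trace_coeff n)"] conjI allI impI)
  \<comment> \<open>Within radius \<open>1 / ?C\<close> the Neumann series is dominated by a
    geometric series.\<close>
  let ?C = "1 + norm A + norm (iM * A)"
  have C: "0 < ?C" by (simp add: add_pos_nonneg)
  show "\<exists>\<epsilon>>0. \<forall>\<zeta>::real. \<zeta> \<noteq> 0 \<and> \<bar>\<zeta>\<bar> < \<epsilon> \<longrightarrow>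
      (let z = complex_of_real \<zeta>;
           D = block_op op_zero (adj_op ip T) T op_zero;
           B = block_op ((- \<i>) *\<^sub>o op_of M) op_zero op_zero op_zero;
           ImR = op_Im (ip2 ip) ((D +\<^sub>o B -\<^sub>o z *\<^sub>o Id)\<inverse>);
           K = (adj_op ip T \<circ>\<^sub>o T -\<^sub>o z\<^sup>2 *\<^sub>o Id -\<^sub>o (z * \<i>) *\<^sub>o op_of M)\<inverse>;
           S = ((2 * z) *\<^sub>o Id +\<^sub>o \<i> *\<^sub>o op_of M) \<circ>\<^sub>o K
       in trace_class (ip2 ip) ImR \<and> bounded_op ip K \<and> trace_class ip S \<and>
          op_trace (ip2 ip) ImR = complex_of_real (Im (op_trace ip S)) \<and>
          (\<lambda>m. Im (trace_coeff (2 * m)) * \<zeta> ^ (2 * m)) sums Im (op_trace ip S))"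
  proof (intro exI[of _ "1 / ?C"] conjI allI impI)
    show "0 < 1 / ?C" using C by simp
    fix \<zeta> :: real
    assume \<zeta>: "\<zeta> \<noteq> 0 \<and> \<bar>\<zeta>\<bar> < 1 / ?C"
    then have "\<bar>\<zeta>\<bar> * ?C < 1" using C by (simp add: field_simps)
    then obtain Y where Y: "(\<lambda>n. \<zeta> ^ n *\<^sub>R neumann_coeff A (iM * A) n) sums Y"
      "(1 - \<zeta> *\<^sub>R (iM * A + \<zeta> *\<^sub>R A)) * Y = 1" "Y * (1 - \<zeta> *\<^sub>R (iM * A + \<zeta> *\<^sub>R A)) = 1"
      using neumann_series by blast
    interpret small_spectral_parameter V ip G P M T \<zeta> Y
      by unfold_locales (use Y in auto)
    interpret prod: hilbert_representation "map_prod V V" "ip2 ip"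
      by (rule representation_prod)
    have S: "((2 * complex_of_real \<zeta>) *\<^sub>o Id +\<^sub>o \<i> *\<^sub>o op_of M) \<circ>\<^sub>o op_of k =
        op_of ((scal (2 * complex_of_real \<zeta>) + iM) * k)"
      unfolding Id_op_of op_of_scale op_of_add op_of_comp by (simp add: iM_def)
    have tc_S: "tc ((scal (2 * complex_of_real \<zeta>) + iM) * k)"
      by (rule tc_mult(1)[OF tc_k])
    show "let z = complex_of_real \<zeta>;
           D = block_op op_zero (adj_op ip T) T op_zero;
           B = block_op ((- \<i>) *\<^sub>o op_of M) op_zero op_zero op_zero;
           ImR = op_Im (ip2 ip) ((D +\<^sub>o B -\<^sub>o z *\<^sub>o Id)\<inverse>);
           K = (adj_op ip T \<circ>\<^sub>o T -\<^sub>o z\<^sup>2 *\<^sub>o Id -\<^sub>o (z * \<i>) *\<^sub>o op_of M)\<inverse>;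
           S = ((2 * z) *\<^sub>o Id +\<^sub>o \<i> *\<^sub>o op_of M) \<circ>\<^sub>o K
       in trace_class (ip2 ip) ImR \<and> bounded_op ip K \<and> trace_class ip S \<and>
          op_trace (ip2 ip) ImR = complex_of_real (Im (op_trace ip S)) \<and>
          (\<lambda>m. Im (trace_coeff (2 * m)) * \<zeta> ^ (2 * m)) sums Im (op_trace ip S)"
      using \<zeta> sums_Im_trace[OF trace_series[OF Y(1)]]
      by (simp add: Let_def op_Im_resolvent inverse_K S bounded_op_of trace_class_op_of[OF tc_S]
          op_trace_op_of[OF tc_S] prod.trace_class_op_of[OF tc_Im] prod.op_trace_op_of[OF tc_Im]
          tr_Im_resolvent del: mult_1_right) (simp add: k_def)
  qed
qed (simp_all add: trace_coeff_0 trace_coeff_2)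

end

section \<open>The Hilbert space \<open>L\<^sup>2([0,1]; dx)\<close>\<close>

interpretation leb01: finite_measure leb01
  by (rule finite_measure_lebesgue_on) simp

interpretation leb01_pair: pair_sigma_finite leb01 leb01 ..

lemma measure_leb01 [simp]: "measure leb01 {0..1} = 1"
  by (simp add: measure_restrict_space)

lemma integrable_leb01_bounded:
  fixes f :: "real \<Rightarrow> 'a::{banach, second_countable_topology}"
  assumes "f \<in> borel_measurable leb01" "AE x in leb01. norm (f x) \<le> C"
  shows "integrable leb01 f"
  by (rule leb01.integrable_const_bound[OF assms(2,1)])

lemma sq_integrable_l2_fun: "sq_integrable (l2_fun F)"
  using Quotient3_rep_reflp[OF Quotient3_l2, of F] by (simp add: l2_eq_def)

lemma l2_of_l2_fun [simp]: "l2_of (l2_fun F) = F"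
  by (rule Quotient3_abs_rep[OF Quotient3_l2])

lemma l2_of_eqI:
  assumes "sq_integrable f" "sq_integrable g" "AE x in leb01. f x = g x"
  shows "l2_of f = l2_of g"
  using Quotient3_rel_abs[OF Quotient3_l2, of f g] assms by (simp add: l2_eq_def)

lemma l2_fun_l2_of:
  assumes "sq_integrable f"
  shows "AE x in leb01. l2_fun (l2_of f) x = f x"
proof -
  have "l2_eq (l2_fun (l2_of f)) f"
    using rep_abs_rsp_left[OF Quotient3_l2, of f f] assms by (simp add: l2_eq_def)
  then show ?thesis by (simp add: l2_eq_def)
qed

lemma l2_eqI:
  assumes "AE x in leb01. l2_fun F x = l2_fun G x"
  shows "F = G"
  using l2_of_eqI[OF sq_integrable_l2_fun sq_integrable_l2_fun assms] by simp

lemma sq_integrable_measurable: "sq_integrable f \<Longrightarrow> f \<in> borel_measurable leb01"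
  by (simp add: sq_integrable_def)

lemma measurable_l2_fun [measurable]: "l2_fun F \<in> borel_measurable leb01"
  by (rule sq_integrable_measurable[OF sq_integrable_l2_fun])

lemma l2_fun_add: "AE x in leb01. l2_fun (F + G) x = l2_fun F x + l2_fun G x"
proof -
  have "F + G = l2_of (\<lambda>x. l2_fun F x + l2_fun G x)"
    using plus_l2.abs_eq[of "l2_fun F" "l2_fun G"] by (simp add: l2_eq_def sq_integrable_l2_fun)
  then show ?thesis
    using l2_fun_l2_of[OF sq_integrable_add[OF sq_integrable_l2_fun sq_integrable_l2_fun]] by simp
qed

lemma l2_fun_cscale: "AE x in leb01. l2_fun (c *\<^sub>C F) x = c * l2_fun F x"
proof -
  have "c *\<^sub>C F = l2_of (\<lambda>x. c * l2_fun F x)"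
    using cscale_l2.abs_eq[of "l2_fun F" c] by (simp add: l2_eq_def sq_integrable_l2_fun)
  then show ?thesis
    using l2_fun_l2_of[OF sq_integrable_cmult[OF sq_integrable_l2_fun]] by simp
qed

lemma l2_fun_zero: "AE x in leb01. l2_fun 0 x = 0"
  unfolding zero_l2_def using l2_fun_l2_of[OF sq_integrable_zero] by simp

lemma l2_fun_diff: "AE x in leb01. l2_fun (F - G) x = l2_fun F x - l2_fun G x"
  unfolding minus_l2_def using l2_fun_add[of F "(- 1) *\<^sub>C G"] l2_fun_cscale[of "- 1" G]
  by eventually_elim simp

lemma integrable_mult_sq:
  assumes "sq_integrable f" "sq_integrable g"
  shows "integrable leb01 (\<lambda>x. cnj (f x) * g x)"
proof (rule Bochner_Integration.integrable_bound)
  show "integrable leb01 (\<lambda>x. (cmod (f x))\<^sup>2 + (cmod (g x))\<^sup>2)"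
    using assms by (simp add: sq_integrable_def)
  show "(\<lambda>x. cnj (f x) * g x) \<in> borel_measurable leb01"
    using assms[THEN sq_integrable_measurable]
    by (intro borel_measurable_times borel_measurable_continuous_on[OF continuous_on_cnj[OF continuous_on_id]])
  show "AE x in leb01. norm (cnj (f x) * g x) \<le> norm ((cmod (f x))\<^sup>2 + (cmod (g x))\<^sup>2)"
  proof (rule AE_I2)
    fix x
    show "norm (cnj (f x) * g x) \<le> norm ((cmod (f x))\<^sup>2 + (cmod (g x))\<^sup>2)"
      using sum_squares_bound[of "cmod (f x)" "cmod (g x)"]
        mult_nonneg_nonneg[OF norm_ge_zero[of "f x"] norm_ge_zero[of "g x"]]
      unfolding norm_mult complex_mod_cnj by (simp del: mult_nonneg_nonneg)
  qed
qed

lemma integrable_l2_fun_mult: "integrable leb01 (\<lambda>x. cnj (l2_fun F x) * l2_fun G x)"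
  by (intro integrable_mult_sq sq_integrable_l2_fun)

lemma sq_integrable_bounded:
  assumes "f \<in> borel_measurable leb01" "AE x in leb01. cmod (f x) \<le> C"
  shows "sq_integrable f"
  unfolding sq_integrable_def
proof (intro conjI assms(1) integrable_leb01_bounded)
  show "(\<lambda>x. (cmod (f x))\<^sup>2) \<in> borel_measurable leb01"
    using assms(1) by measurable
  show "AE x in leb01. norm ((cmod (f x))\<^sup>2) \<le> C\<^sup>2"
    using assms(2) by eventually_elim (simp add: power_mono)
qed

lemma sq_integrable_mult:
  assumes "m \<in> borel_measurable leb01" "AE x in leb01. cmod (m x) \<le> C" "sq_integrable f"
  shows "sq_integrable (\<lambda>x. m x * f x)"
proof -
  have meas: "(\<lambda>x. m x * f x) \<in> borel_measurable leb01"
    using assms(1) assms(3)[THEN sq_integrable_measurable] by measurable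
  have "integrable leb01 (\<lambda>x. (cmod (m x * f x))\<^sup>2)"
  proof (rule Bochner_Integration.integrable_bound)
    show "(\<lambda>x. (cmod (m x * f x))\<^sup>2) \<in> borel_measurable leb01"
      using meas by measurable
    show "integrable leb01 (\<lambda>x. C\<^sup>2 * (cmod (f x))\<^sup>2)"
      using assms(3) by (simp add: sq_integrable_def)
    show "AE x in leb01. norm ((cmod (m x * f x))\<^sup>2) \<le> norm (C\<^sup>2 * (cmod (f x))\<^sup>2)"
      using assms(2)
    proof eventually_elim
      fix x assume "cmod (m x) \<le> C"
      then have "(cmod (m x))\<^sup>2 * (cmod (f x))\<^sup>2 \<le> C\<^sup>2 * (cmod (f x))\<^sup>2"
        by (intro mult_right_mono power_mono) auto
      then show "norm ((cmod (m x * f x))\<^sup>2) \<le> norm (C\<^sup>2 * (cmod (f x))\<^sup>2)"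
        by (simp add: norm_mult power_mult_distrib)
    qed
  qed
  with meas show ?thesis by (simp add: sq_integrable_def)
qed

instantiation l2 :: real_vector
begin

definition scaleR_l2 :: "real \<Rightarrow> l2 \<Rightarrow> l2" where "scaleR_l2 r F = complex_of_real r *\<^sub>C F"

instance
  by standard (simp_all add: scaleR_l2_def cscale_add_right cscale_add_left cscale_cscale cscale_one)

end

text \<open>This is the unweighted inner product. The weighted ones depend on \<rho> and cannot be
  class instances; multiplication by \<rho> carries them to this one.\<close>

instantiation l2 :: real_inner
begin

definition inner_l2 :: "l2 \<Rightarrow> l2 \<Rightarrow> real"
  where "inner_l2 F G = Re (LINT x|leb01. cnj (l2_fun F x) * l2_fun G x)"
definition norm_l2 :: "l2 \<Rightarrow> real" where "norm_l2 F = sqrt (inner F F)"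
definition dist_l2 :: "l2 \<Rightarrow> l2 \<Rightarrow> real" where "dist_l2 F G = norm (F - G)"
definition sgn_l2 :: "l2 \<Rightarrow> l2" where "sgn_l2 F = inverse (norm F) *\<^sub>R F"
definition uniformity_l2 :: "(l2 \<times> l2) filter"
  where "uniformity_l2 = (INF e\<in>{0 <..}. principal {(x, y). dist x y < e})"
definition open_l2 :: "l2 set \<Rightarrow> bool"
  where "open_l2 S = (\<forall>x\<in>S. \<forall>\<^sub>F (x', y) in uniformity. x' = x \<longrightarrow> y \<in> S)"

lemma inner_l2_self: "inner F F = (LINT x|leb01. (cmod (l2_fun F x))\<^sup>2)"
proof -
  have "(LINT x|leb01. cnj (l2_fun F x) * l2_fun F x) =
      (LINT x|leb01. complex_of_real ((cmod (l2_fun F x))\<^sup>2))"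
    by (intro Bochner_Integration.integral_cong) (simp_all only: complex_norm_square mult.commute)
  then show ?thesis
    by (simp only: inner_l2_def integral_complex_of_real Re_complex_of_real)
qed

instance
proof
  fix F G H :: l2 and r :: real and S :: "l2 set"
  show "dist F G = norm (F - G)" "sgn F = F /\<^sub>R norm F" "norm F = sqrt (inner F F)"
    "uniformity = (INF e\<in>{0 <..}. principal {(x, y :: l2). dist x y < e})"
    "open S = (\<forall>x\<in>S. \<forall>\<^sub>F (x', y) in uniformity. x' = x \<longrightarrow> y \<in> S)"
    by (simp_all add: dist_l2_def sgn_l2_def norm_l2_def uniformity_l2_def open_l2_def)
  show "inner F G = inner G F"
  proof -
    have "(LINT x|leb01. cnj (l2_fun G x) * l2_fun F x) = cnj (LINT x|leb01. cnj (l2_fun F x) * l2_fun G x)"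
      by (subst Bochner_Integration.integral_cnj[symmetric]) (simp add: mult.commute)
    then show ?thesis by (simp add: inner_l2_def)
  qed
  show "inner (F + G) H = inner F H + inner G H"
  proof -
    have "(LINT x|leb01. cnj (l2_fun (F + G) x) * l2_fun H x) =
        (LINT x|leb01. cnj (l2_fun F x) * l2_fun H x + cnj (l2_fun G x) * l2_fun H x)"
      by (rule integral_cong_AE)
        (use l2_fun_add[of F G] in \<open>auto simp: distrib_right elim: eventually_mono
          intro!: borel_measurable_integrable integrable_l2_fun_mult Bochner_Integration.integrable_add\<close>)
    then show ?thesis
      by (simp add: inner_l2_def integrable_l2_fun_mult)
  qed
  show "inner (r *\<^sub>R F) G = r * inner F G"
  proof -
    have "(LINT x|leb01. cnj (l2_fun (r *\<^sub>R F) x) * l2_fun G x) =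
        (LINT x|leb01. complex_of_real r * (cnj (l2_fun F x) * l2_fun G x))"
      by (rule integral_cong_AE)
        (use l2_fun_cscale[of "complex_of_real r" F] in \<open>auto simp: scaleR_l2_def elim: eventually_mono
          intro!: borel_measurable_integrable integrable_l2_fun_mult integrable_mult_right\<close>)
    then show ?thesis
      by (simp add: inner_l2_def)
  qed
  show "0 \<le> inner F F"
    by (simp add: inner_l2_self)
  have "inner F F = 0 \<longleftrightarrow> (AE x in leb01. (cmod (l2_fun F x))\<^sup>2 = 0)"
    unfolding inner_l2_self
    using sq_integrable_l2_fun[of F]
    by (intro integral_nonneg_eq_0_iff_AE) (auto simp: sq_integrable_def)
  also have "\<dots> \<longleftrightarrow> F = 0"
    using l2_fun_zero by (auto intro!: l2_eqI elim: eventually_elim2)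
  finally show "inner F F = 0 \<longleftrightarrow> F = 0" .
qed

end

lemma norm_l2_square: "(norm (F::l2))\<^sup>2 = (LINT x|leb01. (cmod (l2_fun F x))\<^sup>2)"
  by (simp add: power2_norm_eq_inner inner_l2_self)

lemma norm_l2_of_square:
  assumes "sq_integrable f"
  shows "(norm (l2_of f))\<^sup>2 = (LINT x|leb01. (cmod (f x))\<^sup>2)"
  unfolding norm_l2_square
  by (rule integral_cong_AE)
    (use l2_fun_l2_of[OF assms] assms in \<open>auto elim: eventually_mono simp: sq_integrable_def\<close>)

section \<open>Completeness of the space of square integrable functions\<close>

lemma nn_integral_l2_fun:
  "(\<integral>\<^sup>+x. ennreal ((cmod (l2_fun F x))\<^sup>2) \<partial>leb01) = ennreal ((norm F)\<^sup>2)"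
  unfolding norm_l2_square using sq_integrable_l2_fun[of F]
  by (intro nn_integral_eq_integral) (auto simp: sq_integrable_def)

text \<open>With e = 2^(-n), the inequality h \<le> (e + h^2/e)/2 turns the bound e on the norm of
  an increment into the same bound on the integral of its modulus, as the interval has length 1. So
  the sum of the increments is integrable and finite almost everywhere.\<close>

lemma AE_convergent_of_summable:
  fixes f :: "nat \<Rightarrow> l2"
  assumes "\<And>n. norm (f (Suc n) - f n) \<le> (1/2) ^ n"
  shows "AE x in leb01. convergent (\<lambda>n. l2_fun (f n) x)"
proof -
  define h where "h n x = cmod (l2_fun (f (Suc n) - f n) x)" for n x
  have meas [measurable]: "(\<lambda>x. ennreal (h n x)) \<in> borel_measurable leb01" for n
    unfolding h_def by measurable
  have "(\<integral>\<^sup>+x. ennreal (h n x) \<partial>leb01) \<le> ennreal ((1/2) ^ n)" for n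
  proof -
    let ?e = "(1/2) ^ n :: real"
    have sq: "integrable leb01 (\<lambda>x. (h n x)\<^sup>2)"
      using sq_integrable_l2_fun by (simp add: h_def sq_integrable_def)
    have int: "integrable leb01 (\<lambda>x. (?e + (h n x)\<^sup>2 / ?e) / 2)"
      using sq by (intro integrable_divide Bochner_Integration.integrable_add leb01.integrable_const)
    have "(\<integral>\<^sup>+x. ennreal (h n x) \<partial>leb01) \<le> (\<integral>\<^sup>+x. ennreal ((?e + (h n x)\<^sup>2 / ?e) / 2) \<partial>leb01)"
    proof (intro nn_integral_mono ennreal_leI)
      fix x
      have "2 * ?e * h n x \<le> ?e\<^sup>2 + (h n x)\<^sup>2" by (rule sum_squares_bound)
      then show "h n x \<le> (?e + (h n x)\<^sup>2 / ?e) / 2"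
        by (simp add: field_simps power2_eq_square)
    qed
    also have "\<dots> = ennreal (LINT x|leb01. (?e + (h n x)\<^sup>2 / ?e) / 2)"
      using int by (intro nn_integral_eq_integral) (auto intro!: AE_I2 divide_nonneg_nonneg add_nonneg_nonneg)
    also have "(LINT x|leb01. (?e + (h n x)\<^sup>2 / ?e) / 2) = (?e + (LINT x|leb01. (h n x)\<^sup>2) / ?e) / 2"
      using sq by (simp add: Bochner_Integration.integral_add)
    also have "(LINT x|leb01. (h n x)\<^sup>2) \<le> ?e\<^sup>2"
      unfolding h_def norm_l2_square[symmetric] by (intro power_mono assms) auto
    also have "(?e + ?e\<^sup>2 / ?e) / 2 = ?e" by (simp add: power2_eq_square)
    finally show ?thesis by (simp add: divide_right_mono ennreal_leI)
  qed
  then have "(\<integral>\<^sup>+x. (\<Sum>n. ennreal (h n x)) \<partial>leb01) \<le> (\<Sum>n. ennreal ((1/2) ^ n))"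
    unfolding nn_integral_suminf[OF meas] by (intro suminf_le) auto
  also have "\<dots> = ennreal 2"
    by (subst suminf_ennreal2) (auto simp: suminf_geometric summable_geometric)
  finally have "(\<integral>\<^sup>+x. (\<Sum>n. ennreal (h n x)) \<partial>leb01) \<noteq> \<infinity>"
    by (auto simp: top_unique)
  then have "AE x in leb01. (\<Sum>n. ennreal (h n x)) \<noteq> \<infinity>"
    by (intro nn_integral_PInf_AE) measurable
  moreover have "AE x in leb01. \<forall>n. l2_fun (f (Suc n) - f n) x = l2_fun (f (Suc n)) x - l2_fun (f n) x"
    unfolding AE_all_countable using l2_fun_diff by blast
  ultimately show ?thesis
  proof eventually_elim
    fix x
    assume fin: "(\<Sum>n. ennreal (h n x)) \<noteq> \<infinity>"
      and diff: "\<forall>n. l2_fun (f (Suc n) - f n) x = l2_fun (f (Suc n)) x - l2_fun (f n) x"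
    have "summable (\<lambda>n. h n x)"
    proof (rule summable_suminf_not_top)
      show "0 \<le> h n x" for n by (simp add: h_def)
      show "(\<Sum>n. ennreal (h n x)) \<noteq> top" using fin by (simp only: infinity_ennreal_def not_False_eq_True)
    qed
    then have "summable (\<lambda>n. cmod (l2_fun (f (Suc n)) x - l2_fun (f n) x))"
      unfolding h_def using diff by simp
    then have "summable (\<lambda>n. l2_fun (f (Suc n)) x - l2_fun (f n) x)"
      by (rule summable_norm_cancel)
    then have "convergent (\<lambda>N. \<Sum>n<N. l2_fun (f (Suc n)) x - l2_fun (f n) x)"
      by (simp add: summable_iff_convergent)
    then have "convergent (\<lambda>N. l2_fun (f N) x - l2_fun (f 0) x)"
      unfolding sum_lessThan_telescope[of "\<lambda>n. l2_fun (f n) x"] .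
    then show "convergent (\<lambda>N. l2_fun (f N) x)"
      by (simp add: convergent_diff_const_right_iff)
  qed
qed

text \<open>A subsequence with geometrically small increments converges almost everywhere. Fatou's
  lemma bounds its distance to the pointwise limit, and a Cauchy sequence follows its convergent
  subsequence.\<close>

instance l2 :: complete_space
proof
  fix X :: "nat \<Rightarrow> l2"
  assume X: "Cauchy X"
  have "\<exists>N. \<forall>m\<ge>N. \<forall>n\<ge>N. norm (X m - X n) < (1/2) ^ k" for k
    using X unfolding Cauchy_iff by simp
  then obtain N where N: "\<And>k m n. N k \<le> m \<Longrightarrow> N k \<le> n \<Longrightarrow> norm (X m - X n) < (1/2) ^ k"
    by metis
  \<comment> \<open>The successor makes r strictly increasing, and the maximum keeps
    \<open>r k\<close> past \<open>N k\<close>.\<close>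
  define r where "r = rec_nat (N 0) (\<lambda>k rk. max (Suc rk) (N (Suc k)))"
  have r: "strict_mono r" "N k \<le> r k" for k
  proof -
    show "strict_mono r"
      by (rule strict_monoI_Suc) (simp add: r_def less_max_iff_disj)
    show "N k \<le> r k" by (cases k) (simp_all add: r_def)
  qed
  define f where "f k = X (r k)" for k
  have close: "norm (f m - f k) \<le> (1/2) ^ k" if "k \<le> m" for k m
  proof -
    have "r k \<le> r m" using r(1) that by (simp add: strict_mono_less_eq)
    then show ?thesis
      unfolding f_def using N[of k "r m" "r k"] r(2)[of k] by (simp add: less_imp_le)
  qed
  define g where "g x = lim (\<lambda>n. l2_fun (f n) x)" for x
  have g_meas [measurable]: "g \<in> borel_measurable leb01"
    unfolding g_def by measurable
  have conv: "AE x in leb01. (\<lambda>n. l2_fun (f n) x) \<longlonglongrightarrow> g x"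
    using AE_convergent_of_summable[of f] close
    by (auto simp: g_def convergent_LIMSEQ_iff elim: eventually_mono)
  have bound: "(\<integral>\<^sup>+x. ennreal ((cmod (g x - l2_fun (f k) x))\<^sup>2) \<partial>leb01) \<le> ennreal (((1/2) ^ k)\<^sup>2)" for k
  proof -
    have "AE x in leb01. \<forall>m. l2_fun (f m - f k) x = l2_fun (f m) x - l2_fun (f k) x"
      unfolding AE_all_countable using l2_fun_diff by blast
    then have "AE x in leb01. ennreal ((cmod (g x - l2_fun (f k) x))\<^sup>2) =
        liminf (\<lambda>m. ennreal ((cmod (l2_fun (f m - f k) x))\<^sup>2))"
      using conv
    proof eventually_elim
      fix x
      assume diff: "\<forall>m. l2_fun (f m - f k) x = l2_fun (f m) x - l2_fun (f k) x"
        and lim: "(\<lambda>n. l2_fun (f n) x) \<longlonglongrightarrow> g x"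
      have "(\<lambda>m. ennreal ((cmod (l2_fun (f m) x - l2_fun (f k) x))\<^sup>2)) \<longlonglongrightarrow>
          ennreal ((cmod (g x - l2_fun (f k) x))\<^sup>2)"
        by (intro tendsto_intros lim)
      then show "ennreal ((cmod (g x - l2_fun (f k) x))\<^sup>2) =
          liminf (\<lambda>m. ennreal ((cmod (l2_fun (f m - f k) x))\<^sup>2))"
        unfolding diff[rule_format] by (intro lim_imp_Liminf[symmetric]) simp_all
    qed
    then have "(\<integral>\<^sup>+x. ennreal ((cmod (g x - l2_fun (f k) x))\<^sup>2) \<partial>leb01) =
        (\<integral>\<^sup>+x. liminf (\<lambda>m. ennreal ((cmod (l2_fun (f m - f k) x))\<^sup>2)) \<partial>leb01)"
      by (rule nn_integral_cong_AE)
    also have "\<dots> \<le> liminf (\<lambda>m. \<integral>\<^sup>+x. ennreal ((cmod (l2_fun (f m - f k) x))\<^sup>2) \<partial>leb01)"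
      by (rule nn_integral_liminf) measurable
    also have "\<dots> = liminf (\<lambda>m. ennreal ((norm (f m - f k))\<^sup>2))"
      unfolding nn_integral_l2_fun ..
    also have "\<dots> \<le> ennreal (((1/2) ^ k)\<^sup>2)"
    proof (rule Liminf_le)
      show "\<forall>\<^sub>F m in sequentially. ennreal ((norm (f m - f k))\<^sup>2) \<le> ennreal (((1/2) ^ k)\<^sup>2)"
        unfolding eventually_sequentially
        by (intro exI[of _ k] allI impI ennreal_leI power_mono close) auto
    qed simp
    finally show ?thesis .
  qed
  have sq_diff: "sq_integrable (\<lambda>x. g x - l2_fun (f k) x)" for k
    unfolding sq_integrable_def
  proof
    show "(\<lambda>x. g x - l2_fun (f k) x) \<in> borel_measurable leb01" by measurable
    show "integrable leb01 (\<lambda>x. (cmod (g x - l2_fun (f k) x))\<^sup>2)"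
      unfolding integrable_iff_bounded
      using order.strict_trans1[OF bound[of k]] by auto
  qed
  have sq_g: "sq_integrable g"
    using sq_integrable_add[OF sq_diff[of 0] sq_integrable_l2_fun[of "f 0"]] by simp
  have "norm (f k - l2_of g) \<le> (1/2) ^ k" for k
  proof -
    have "AE x in leb01. cmod (l2_fun (l2_of g - f k) x) = cmod (g x - l2_fun (f k) x)"
      using l2_fun_diff[of "l2_of g" "f k"] l2_fun_l2_of[OF sq_g] by eventually_elim simp
    then have "(\<integral>\<^sup>+x. ennreal ((cmod (l2_fun (l2_of g - f k) x))\<^sup>2) \<partial>leb01) =
        (\<integral>\<^sup>+x. ennreal ((cmod (g x - l2_fun (f k) x))\<^sup>2) \<partial>leb01)"
      by (intro nn_integral_cong_AE) (auto elim: eventually_mono)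
    then have "ennreal ((norm (l2_of g - f k))\<^sup>2) \<le> ennreal (((1/2) ^ k)\<^sup>2)"
      using bound[of k] by (simp add: nn_integral_l2_fun)
    then have "(norm (l2_of g - f k))\<^sup>2 \<le> ((1/2) ^ k)\<^sup>2"
      by simp
    then show ?thesis
      by (simp add: norm_minus_commute power2_le_iff_abs_le)
  qed
  moreover have "(\<lambda>k. (1/2) ^ k :: real) \<longlonglongrightarrow> 0"
    by (intro LIMSEQ_power_zero) simp
  ultimately have "(\<lambda>k. f k - l2_of g) \<longlonglongrightarrow> 0"
    by (intro Lim_null_comparison[of "\<lambda>k. f k - l2_of g" "\<lambda>k. (1/2) ^ k"]) simp_all
  then have "(X \<circ> r) \<longlonglongrightarrow> l2_of g"
    by (simp add: LIM_zero_iff f_def o_def)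
  then show "convergent X"
    using Cauchy_converges_subseq[OF X r(1)] by (auto simp: convergent_def)
qed

instance l2 :: complex_hilbert
proof
  fix F G :: l2 and r :: real
  show "r *\<^sub>R F = complex_of_real r *\<^sub>C F" by (rule scaleR_l2_def)
  show "inner (\<i> *\<^sub>C F) (\<i> *\<^sub>C G) = inner F G"
  proof -
    have "(LINT x|leb01. cnj (l2_fun (\<i> *\<^sub>C F) x) * l2_fun (\<i> *\<^sub>C G) x) =
        (LINT x|leb01. cnj (l2_fun F x) * l2_fun G x)"
    proof (rule integral_cong_AE)
      show "AE x in leb01. cnj (l2_fun (\<i> *\<^sub>C F) x) * l2_fun (\<i> *\<^sub>C G) x = cnj (l2_fun F x) * l2_fun G x"
        using l2_fun_cscale[of \<i> F] l2_fun_cscale[of \<i> G]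
        by eventually_elim (simp add: complex_eq_iff)
    qed (intro borel_measurable_integrable integrable_l2_fun_mult)+
    then show ?thesis by (simp add: inner_l2_def)
  qed
  have one: "sq_integrable (\<lambda>x. 1)"
    by (rule sq_integrable_bounded[of _ 1]) auto
  have "(norm (l2_of (\<lambda>x. 1)))\<^sup>2 = 1"
    by (simp add: norm_l2_of_square[OF one])
  then have "l2_of (\<lambda>x. 1) \<noteq> 0" by force
  then show "\<exists>F::l2. F \<noteq> 0" by blast
qed

lemma cip_l2: "cip F G = (LINT x|leb01. cnj (l2_fun F x) * l2_fun G x)"
proof -
  have "(LINT x|leb01. cnj (l2_fun (\<i> *\<^sub>C F) x) * l2_fun G x) =
      (LINT x|leb01. - \<i> * (cnj (l2_fun F x) * l2_fun G x))"
  proof (rule integral_cong_AE)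
    show "AE x in leb01. cnj (l2_fun (\<i> *\<^sub>C F) x) * l2_fun G x = - \<i> * (cnj (l2_fun F x) * l2_fun G x)"
      using l2_fun_cscale[of \<i> F] by eventually_elim simp
  qed (intro borel_measurable_integrable integrable_l2_fun_mult integrable_mult_right)+
  then show ?thesis
    by (simp add: cip_def inner_l2_def complex_eq_iff)
qed

lemma cip_l2_of:
  assumes "sq_integrable f" "sq_integrable g"
  shows "cip (l2_of f) (l2_of g) = (LINT x|leb01. cnj (f x) * g x)"
  unfolding cip_l2
proof (rule integral_cong_AE)
  show "AE x in leb01. cnj (l2_fun (l2_of f) x) * l2_fun (l2_of g) x = cnj (f x) * g x"
    using l2_fun_l2_of[OF assms(1)] l2_fun_l2_of[OF assms(2)] by eventually_elim simp
qed (intro borel_measurable_integrable integrable_l2_fun_mult integrable_mult_sq assms)+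

lemma cip_l2_of_left:
  assumes "sq_integrable f"
  shows "cip (l2_of f) G = (LINT x|leb01. cnj (f x) * l2_fun G x)"
  using cip_l2_of[OF assms sq_integrable_l2_fun[of G]] by simp

section \<open>Multiplication and integral operators\<close>

lemma l2_of_add:
  assumes "sq_integrable f" "sq_integrable g" "sq_integrable h" "AE x in leb01. h x = f x + g x"
  shows "l2_of h = l2_of f + l2_of g"
proof -
  have "l2_of f + l2_of g = l2_of (\<lambda>x. f x + g x)"
    using plus_l2.abs_eq[of f g] assms by (simp add: l2_eq_def)
  then show ?thesis
    using l2_of_eqI[OF assms(3) sq_integrable_add[OF assms(1,2)] assms(4)] by simp
qed

lemma l2_of_scaleR:
  assumes "sq_integrable f" "sq_integrable h" "AE x in leb01. h x = complex_of_real r * f x"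
  shows "l2_of h = r *\<^sub>R l2_of f"
proof -
  have "r *\<^sub>R l2_of f = l2_of (\<lambda>x. complex_of_real r * f x)"
    using cscale_l2.abs_eq[of f "complex_of_real r"] assms by (simp add: l2_eq_def scaleR_l2_def)
  then show ?thesis
    using l2_of_eqI[OF assms(2) sq_integrable_cmult[OF assms(1)] assms(3)] by simp
qed

lemma l2_fun_scaleR: "AE x in leb01. l2_fun (r *\<^sub>R F) x = complex_of_real r * l2_fun F x"
  unfolding scaleR_l2_def by (rule l2_fun_cscale)

lemma norm_l2_of_le:
  assumes "sq_integrable f" "AE x in leb01. cmod (f x) \<le> C * cmod (l2_fun F x)" "0 \<le> C"
  shows "norm (l2_of f) \<le> C * norm F"
proof -
  have "(norm (l2_of f))\<^sup>2 \<le> (LINT x|leb01. C\<^sup>2 * (cmod (l2_fun F x))\<^sup>2)"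
    unfolding norm_l2_of_square[OF assms(1)]
  proof (rule integral_mono_AE)
    show "integrable leb01 (\<lambda>x. (cmod (f x))\<^sup>2)" "integrable leb01 (\<lambda>x. C\<^sup>2 * (cmod (l2_fun F x))\<^sup>2)"
      using assms(1) sq_integrable_l2_fun[of F] by (simp_all add: sq_integrable_def)
    show "AE x in leb01. (cmod (f x))\<^sup>2 \<le> C\<^sup>2 * (cmod (l2_fun F x))\<^sup>2"
      using assms(2)
      by eventually_elim (metis norm_ge_zero power_mono power_mult_distrib)
  qed
  also have "\<dots> = (C * norm F)\<^sup>2"
    by (simp add: norm_l2_square power_mult_distrib)
  finally show ?thesis
    using assms(3) by (simp add: power2_le_iff_abs_le abs_mult)
qed

definition mulop :: "(real \<Rightarrow> complex) \<Rightarrow> l2 cbo"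
  where "mulop m = cbo_of (\<lambda>F. l2_of (\<lambda>x. m x * l2_fun F x))"

lemma bounded_linear_mulop:
  assumes m: "m \<in> borel_measurable leb01" "\<And>x. cmod (m x) \<le> C"
  shows "bounded_linear (\<lambda>F. l2_of (\<lambda>x. m x * l2_fun F x))"
proof (rule bounded_linear_intro[of _ C])
  have sq: "sq_integrable (\<lambda>x. m x * l2_fun F x)" for F
    by (rule sq_integrable_mult[of _ C]) (use m sq_integrable_l2_fun in auto)
  show "l2_of (\<lambda>x. m x * l2_fun (F + G) x) = l2_of (\<lambda>x. m x * l2_fun F x) + l2_of (\<lambda>x. m x * l2_fun G x)"
    for F G
    using l2_fun_add[of F G]
    by (intro l2_of_add sq) (auto simp: distrib_left elim: eventually_mono)
  show "l2_of (\<lambda>x. m x * l2_fun (r *\<^sub>R F) x) = r *\<^sub>R l2_of (\<lambda>x. m x * l2_fun F x)" for r F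
    using l2_fun_scaleR[of r F] by (intro l2_of_scaleR sq) (auto elim: eventually_mono)
  have "0 \<le> C" using m(2)[of 0] norm_ge_zero order.trans by blast
  then show "norm (l2_of (\<lambda>x. m x * l2_fun F x)) \<le> norm F * C" for F
    using norm_l2_of_le[OF sq, of F C F] m(2) by (simp add: norm_mult mult_right_mono mult.commute)
qed

lemma app_mulop:
  assumes m: "m \<in> borel_measurable leb01" "\<And>x. cmod (m x) \<le> C"
  shows "app (mulop m) F = l2_of (\<lambda>x. m x * l2_fun F x)"
  unfolding mulop_def
proof (rule app_cbo_of)
  show "bounded_linear (\<lambda>F. l2_of (\<lambda>x. m x * l2_fun F x))"
    by (rule bounded_linear_mulop[OF m])
  have cm: "(\<lambda>x. cnj (m x)) \<in> borel_measurable leb01" "\<And>x. cmod (cnj (m x)) \<le> C"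
    using m by (auto intro: borel_measurable_continuous_on[OF continuous_on_cnj[OF continuous_on_id]])
  show "bounded_linear (\<lambda>F. l2_of (\<lambda>x. cnj (m x) * l2_fun F x))"
    by (rule bounded_linear_mulop[OF cm])
  show "cip (l2_of (\<lambda>x. cnj (m x) * l2_fun F x)) G = cip F (l2_of (\<lambda>x. m x * l2_fun G x))" for F G
  proof -
    have sq: "sq_integrable (\<lambda>x. m x * l2_fun G x)" "sq_integrable (\<lambda>x. cnj (m x) * l2_fun F x)"
      by (rule sq_integrable_mult[of _ C]; use m cm sq_integrable_l2_fun in auto)+
    show ?thesis
      using cip_l2_of[OF sq(2) sq_integrable_l2_fun[of G]] cip_l2_of[OF sq_integrable_l2_fun[of F] sq(1)]
      by (simp add: mult_ac)
  qed
qed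

lemma l2_fun_mulop:
  assumes m: "m \<in> borel_measurable leb01" "\<And>x. cmod (m x) \<le> C"
  shows "AE x in leb01. l2_fun (app (mulop m) F) x = m x * l2_fun F x"
  unfolding app_mulop[OF m]
  by (intro l2_fun_l2_of sq_integrable_mult[of _ C] AE_I2 m sq_integrable_l2_fun)

lemma star_mulop:
  assumes m: "m \<in> borel_measurable leb01" "\<And>x. cmod (m x) \<le> C" and real: "\<And>x. m x \<in> \<real>"
  shows "star (mulop m) = mulop m"
proof (rule star_unique)
  fix F G
  have sq: "sq_integrable (\<lambda>x. m x * l2_fun F x)" for F
    by (intro sq_integrable_mult[of _ C] AE_I2 m sq_integrable_l2_fun)
  have "cnj (m x) = m x" for x using real by (simp add: Reals_cnj_iff)
  then show "cip (app (mulop m) F) G = cip F (app (mulop m) G)"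
    unfolding app_mulop[OF m]
    using cip_l2_of[OF sq[of F] sq_integrable_l2_fun[of G]]
      cip_l2_of[OF sq_integrable_l2_fun[of F] sq[of G]]
    by (simp add: mult_ac)
qed

lemma sq_integrable_integrable:
  assumes "sq_integrable f"
  shows "integrable leb01 f"
proof -
  have "sq_integrable (\<lambda>x. 1)"
    by (rule sq_integrable_bounded[of _ 1]) auto
  from integrable_mult_sq[OF this assms] show ?thesis by simp
qed

section \<open>Integral operators with bounded kernels\<close>

locale bounded_kernel =
  fixes k :: "real \<Rightarrow> real \<Rightarrow> complex" and C :: real
  assumes measurable_k: "case_prod k \<in> borel_measurable (leb01 \<Otimes>\<^sub>M leb01)"
    and cmod_k: "cmod (k x t) \<le> C"
begin

lemma measurable_k' [measurable]: "(\<lambda>p. k (fst p) (snd p)) \<in> borel_measurable (leb01 \<Otimes>\<^sub>M leb01)"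
  using measurable_k by (simp add: case_prod_beta')

lemma C_nonneg: "0 \<le> C"
  using cmod_k[of 0 0] norm_ge_zero order.trans by blast

lemma measurable_section: "x \<in> {0..1} \<Longrightarrow> k x \<in> borel_measurable leb01"
  using measurable_Pair2[OF measurable_k, of x] by simp

lemma sq_integrable_section: "x \<in> {0..1} \<Longrightarrow> sq_integrable (\<lambda>t. cnj (k x t))"
  by (rule sq_integrable_bounded[of _ C])
    (auto simp: cmod_k intro!: measurable_section borel_measurable_continuous_on[OF continuous_on_cnj[OF continuous_on_id]])

text \<open>The conjugate makes integration against the kernel an inner product with
  \<open>row x\<close>, so that Bessel and Parseval apply at each x.\<close>

definition row :: "real \<Rightarrow> l2" where "row x = l2_of (\<lambda>t. cnj (k x t))"

lemma norm_row_square: "x \<in> {0..1} \<Longrightarrow> (norm (row x))\<^sup>2 = (LINT t|leb01. (cmod (k x t))\<^sup>2)"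
  unfolding row_def using norm_l2_of_square[OF sq_integrable_section, of x] by simp

lemma norm_row_le:
  assumes "x \<in> {0..1}"
  shows "norm (row x) \<le> C"
proof -
  have "(norm (row x))\<^sup>2 \<le> (LINT t|leb01. C\<^sup>2)"
    unfolding norm_row_square[OF assms]
    using sq_integrable_section[OF assms]
    by (intro integral_mono_AE leb01.integrable_const AE_I2 power_mono cmod_k) (simp_all add: sq_integrable_def)
  then show ?thesis
    using C_nonneg by (simp add: power2_le_iff_abs_le)
qed

definition kfun :: "l2 \<Rightarrow> real \<Rightarrow> complex"
  where "kfun F x = (LINT t|leb01. k x t * l2_fun F t)"

lemma kfun_row: "x \<in> {0..1} \<Longrightarrow> kfun F x = cip (row x) F"
  unfolding kfun_def row_def by (simp add: cip_l2_of_left sq_integrable_section)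

lemma measurable_kfun [measurable]: "kfun F \<in> borel_measurable leb01"
  unfolding kfun_def by (intro leb01.borel_measurable_lebesgue_integral) (simp add: case_prod_beta', measurable)

lemma cmod_kfun: "x \<in> {0..1} \<Longrightarrow> cmod (kfun F x) \<le> C * norm F"
  unfolding kfun_row
  by (rule order.trans[OF cmod_cip_le]) (intro mult_right_mono norm_row_le, auto)

lemma sq_integrable_kfun: "sq_integrable (kfun F)"
  by (rule sq_integrable_bounded[of _ "C * norm F"]) (auto intro!: AE_I2 cmod_kfun)

lemma bounded_linear_kfun: "bounded_linear (\<lambda>F. l2_of (kfun F))"
proof (rule bounded_linear_intro[of _ C])
  show "l2_of (kfun (F + G)) = l2_of (kfun F) + l2_of (kfun G)" for F G
    by (intro l2_of_add sq_integrable_kfun AE_I2) (simp add: kfun_row cip_add_right)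
  show "l2_of (kfun (r *\<^sub>R F)) = r *\<^sub>R l2_of (kfun F)" for r F
    by (intro l2_of_scaleR sq_integrable_kfun AE_I2) (simp add: kfun_row scaleR_cscale cip_cscale_right)
  show "norm (l2_of (kfun F)) \<le> norm F * C" for F
  proof -
    have "(norm (l2_of (kfun F)))\<^sup>2 \<le> (LINT x|leb01. (C * norm F)\<^sup>2)"
      unfolding norm_l2_of_square[OF sq_integrable_kfun]
      using sq_integrable_kfun[of F]
      by (intro integral_mono_AE leb01.integrable_const AE_I2 power_mono cmod_kfun)
        (simp_all add: sq_integrable_def)
    then show ?thesis
      using C_nonneg by (simp add: power2_le_iff_abs_le abs_mult mult.commute)
  qed
qed

definition kop :: "l2 cbo" where "kop = cbo_of (\<lambda>F. l2_of (kfun F))"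

lemma transpose: "bounded_kernel (\<lambda>x t. cnj (k t x)) C"
proof
  have "(\<lambda>(x, t). k t x) \<in> borel_measurable (leb01 \<Otimes>\<^sub>M leb01)"
    using measurable_compose[OF measurable_pair_swap' measurable_k] by (simp add: case_prod_beta')
  then show "(\<lambda>(x, t). cnj (k t x)) \<in> borel_measurable (leb01 \<Otimes>\<^sub>M leb01)"
    using borel_measurable_continuous_on[OF continuous_on_cnj[OF continuous_on_id]]
    by (simp add: case_prod_beta')
qed (simp add: cmod_k)

text \<open>Fubini's theorem: the integrand is dominated by C times the product of the moduli of F
  and G, which are integrable since the interval has finite measure.\<close>

lemma kernel_adjoint:
  "(LINT x|leb01. cnj (LINT t|leb01. cnj (k t x) * l2_fun F t) * l2_fun G x) =
    (LINT t|leb01. cnj (l2_fun F t) * kfun G t)"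
proof -
  let ?f = "\<lambda>t x. cnj (l2_fun F t) * k t x * l2_fun G x"
  have cnj_meas: "(\<lambda>t. cnj (l2_fun F t)) \<in> borel_measurable leb01"
    by (intro borel_measurable_continuous_on[OF continuous_on_cnj[OF continuous_on_id]] measurable_l2_fun)
  have int_G: "integrable leb01 (l2_fun G)" and int_F: "integrable leb01 (l2_fun F)"
    by (intro sq_integrable_integrable sq_integrable_l2_fun)+
  have meas [measurable]: "(\<lambda>p. ?f (fst p) (snd p)) \<in> borel_measurable (leb01 \<Otimes>\<^sub>M leb01)"
    using cnj_meas by measurable
  have row_int: "integrable leb01 (\<lambda>x. ?f t x)" if "t \<in> {0..1}" for t
  proof (rule Bochner_Integration.integrable_bound)
    show "integrable leb01 (\<lambda>x. cmod (l2_fun F t) * C * cmod (l2_fun G x))"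
      using int_G by (intro integrable_mult_right integrable_norm)
    show "(\<lambda>x. ?f t x) \<in> borel_measurable leb01"
      using measurable_section[OF that] by measurable
    show "AE x in leb01. norm (?f t x) \<le> norm (cmod (l2_fun F t) * C * cmod (l2_fun G x))"
      using C_nonneg by (intro AE_I2) (simp add: norm_mult abs_mult cmod_k mult_left_mono mult_right_mono)
  qed
  have "integrable (leb01 \<Otimes>\<^sub>M leb01) (case_prod ?f)"
  proof (rule leb01_pair.Fubini_integrable)
    show "case_prod ?f \<in> borel_measurable (leb01 \<Otimes>\<^sub>M leb01)"
      using meas by (simp add: case_prod_beta')
    show "AE t in leb01. integrable leb01 (\<lambda>x. case (t, x) of (t, x) \<Rightarrow> ?f t x)"
      using row_int by (intro AE_I2) simp
    show "integrable leb01 (\<lambda>t. LINT x|leb01. norm (case (t, x) of (t, x) \<Rightarrow> ?f t x))"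
    proof (rule Bochner_Integration.integrable_bound)
      show "integrable leb01 (\<lambda>t. cmod (l2_fun F t) * (C * (LINT x|leb01. cmod (l2_fun G x))))"
        using int_F by (intro integrable_mult_left integrable_norm)
      show "(\<lambda>t. LINT x|leb01. norm (case (t, x) of (t, x) \<Rightarrow> ?f t x)) \<in> borel_measurable leb01"
        by (intro leb01.borel_measurable_lebesgue_integral) (simp add: case_prod_beta', measurable)
      show "AE t in leb01. norm (LINT x|leb01. norm (case (t, x) of (t, x) \<Rightarrow> ?f t x)) \<le>
          norm (cmod (l2_fun F t) * (C * (LINT x|leb01. cmod (l2_fun G x))))"
      proof (rule AE_I2)
        fix t assume "t \<in> space leb01"
        then have t: "t \<in> {0..1}" by simp
        have "(LINT x|leb01. norm (?f t x)) \<le> (LINT x|leb01. cmod (l2_fun F t) * C * cmod (l2_fun G x))"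
          using row_int[OF t] int_G C_nonneg
          by (intro integral_mono_AE AE_I2 integrable_norm integrable_mult_right)
            (auto simp: norm_mult cmod_k intro!: mult_right_mono mult_left_mono)
        then show "norm (LINT x|leb01. norm (case (t, x) of (t, x) \<Rightarrow> ?f t x)) \<le>
          norm (cmod (l2_fun F t) * (C * (LINT x|leb01. cmod (l2_fun G x))))"
          by (simp add: mult.assoc)
      qed
    qed
  qed
  from leb01_pair.Fubini_integral[OF this]
  have swap: "(LINT x|leb01. LINT t|leb01. ?f t x) = (LINT t|leb01. LINT x|leb01. ?f t x)" .
  have inner_t: "(LINT t|leb01. ?f t x) = cnj (LINT t|leb01. cnj (k t x) * l2_fun F t) * l2_fun G x" for x
    by (subst Bochner_Integration.integral_cnj[symmetric]) (simp add: mult.commute)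
  have inner_x: "(LINT x|leb01. ?f t x) = cnj (l2_fun F t) * kfun G t" for t
    by (simp add: kfun_def mult.assoc)
  show ?thesis
    using swap unfolding inner_t inner_x .
qed

lemma cip_kfun:
  "cip (l2_of (bounded_kernel.kfun (\<lambda>x t. cnj (k t x)) F)) G = cip F (l2_of (kfun G))"
proof -
  interpret t: bounded_kernel "\<lambda>x t. cnj (k t x)" C by (rule transpose)
  show ?thesis
    unfolding cip_l2_of_left[OF t.sq_integrable_kfun]
    using cip_l2_of[OF sq_integrable_l2_fun sq_integrable_kfun, of F G] kernel_adjoint[of F G]
    by (simp add: t.kfun_def)
qed

lemma app_kop: "app kop F = l2_of (kfun F)"
  unfolding kop_def
  by (rule app_cbo_of[OF bounded_linear_kfun bounded_kernel.bounded_linear_kfun[OF transpose]])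
    (rule cip_kfun)

lemma l2_fun_kop: "AE x in leb01. l2_fun (app kop F) x = kfun F x"
  unfolding app_kop by (rule l2_fun_l2_of[OF sq_integrable_kfun])

lemma integrable_kfun_square: "integrable leb01 (\<lambda>x. (cmod (kfun F x))\<^sup>2)"
  using sq_integrable_kfun[of F] by (simp add: sq_integrable_def)

text \<open>Bessel's inequality at each x bounds the sum of squares by the squared norm of the row;
  integrating in x gives a bound independent of the orthonormal set.\<close>

lemma hs_kop: "hs kop"
  unfolding hs_def
proof (intro exI[of _ "C\<^sup>2"] allI impI)
  fix E :: "l2 set"
  assume E: "finite E \<and> orthonormal E"
  have "(\<Sum>e\<in>E. (norm (app kop e))\<^sup>2) = (LINT x|leb01. (\<Sum>e\<in>E. (cmod (kfun e x))\<^sup>2))"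
    by (subst Bochner_Integration.integral_sum)
      (simp_all add: integrable_kfun_square app_kop norm_l2_of_square sq_integrable_kfun)
  also have "\<dots> \<le> (LINT x|leb01. C\<^sup>2)"
  proof (intro integral_mono_AE leb01.integrable_const AE_I2 Bochner_Integration.integrable_sum integrable_kfun_square)
    fix x assume "x \<in> space leb01"
    then have x: "x \<in> {0..1}" by simp
    have "cmod (kfun e x) = cmod (cip e (row x))" for e
      unfolding kfun_row[OF x] by (metis cip_commute complex_mod_cnj)
    then have "(\<Sum>e\<in>E. (cmod (kfun e x))\<^sup>2) \<le> (norm (row x))\<^sup>2"
      using bessel_finite[of E "row x"] E by simp
    also have "\<dots> \<le> C\<^sup>2"
      by (intro power_mono norm_row_le x) simp
    finally show "(\<Sum>e\<in>E. (cmod (kfun e x))\<^sup>2) \<le> C\<^sup>2" .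
  qed
  finally show "(\<Sum>e\<in>E. (norm (app kop e))\<^sup>2) \<le> C\<^sup>2" by simp
qed

text \<open>The trace is a sum over e of integrals of m times the squared coefficients of the rows,
  and Parseval evaluates it once sum and integral are exchanged. Dominated convergence works along a
  sequence, whereas the basis may be uncountable; \<open>countable\<close> provides one countable
  part of the basis that serves all x at once.\<close>

lemma tr_mulop_kop:
  assumes m: "m \<in> borel_measurable leb01" "\<And>x. cmod (m x) \<le> D"
    and countable: "\<And>E. is_onb cip E \<Longrightarrow> countable {e \<in> E. \<exists>x\<in>{0..1}. cip (row x) e \<noteq> 0}"
  shows "tr (mulop m * kop * star kop) =
    (LINT x|leb01. m x * complex_of_real (LINT t|leb01. (cmod (k x t))\<^sup>2))"
proof -
  let ?E0 = "{e \<in> some_onb. \<exists>x\<in>{0..1}. cip (row x) e \<noteq> 0}"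
  define g where "g e = cip e (app (star kop * (mulop m * kop)) e)" for e
  have tr: "tr (mulop m * kop * star kop) = tr (star kop * (mulop m * kop))"
    by (rule tr_commute_hs[OF hs_mult_left[OF hs_kop] hs_star[OF hs_kop]])
  have g_eq: "g e = (LINT x|leb01. m x * complex_of_real ((cmod (kfun e x))\<^sup>2))" for e
  proof -
    have sq: "sq_integrable (\<lambda>x. m x * kfun e x)"
      by (intro sq_integrable_mult[of _ D] AE_I2 m sq_integrable_kfun)
    have "app (mulop m) (l2_of (kfun e)) = l2_of (\<lambda>x. m x * kfun e x)"
      unfolding app_mulop[OF m]
    proof (rule l2_of_eqI[OF _ sq])
      show "sq_integrable (\<lambda>x. m x * l2_fun (l2_of (kfun e)) x)"
        by (intro sq_integrable_mult[of _ D] AE_I2 m sq_integrable_l2_fun)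
      show "AE x in leb01. m x * l2_fun (l2_of (kfun e)) x = m x * kfun e x"
        using l2_fun_l2_of[OF sq_integrable_kfun, of e] by eventually_elim simp
    qed
    then have "g e = cip (l2_of (kfun e)) (l2_of (\<lambda>x. m x * kfun e x))"
      by (simp add: g_def cip_star_right app_kop)
    then show ?thesis
      unfolding cip_l2_of[OF sq_integrable_kfun sq] complex_norm_square by (simp add: mult_ac)
  qed
  have zero: "kfun e x = 0" if "e \<in> some_onb" "e \<notin> ?E0" "x \<in> {0..1}" for e x
    using that by (simp add: kfun_row)
  have g_zero: "g e = 0" if "e \<in> some_onb - ?E0" for e
  proof -
    have "g e = (LINT x|leb01. 0)"
      unfolding g_eq by (intro Bochner_Integration.integral_cong) (use zero[of e] that in auto)
    then show ?thesis by simp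
  qed
  have "(g has_sum tr (star kop * (mulop m * kop))) some_onb"
    unfolding g_def
    by (intro tr_has_sum tcI hs_star hs_mult_left hs_kop is_onb_some_onb)
  then have sum_g: "(g has_sum tr (star kop * (mulop m * kop))) ?E0"
    by (subst has_sum_cong_neutral[where g = g and T = some_onb]) (use g_zero in auto)
  from countable_finite_exhaustion[OF countable[OF is_onb_some_onb]]
  obtain F where F': "\<forall>n. finite (F n)" "\<forall>n. F n \<subseteq> ?E0" "incseq F" "(\<Union>n. F n) = ?E0"
    by (elim exE conjE)
  note F = F'(1,2)[rule_format] F'(3,4)
  \<comment> \<open>Converts a sum over the directed set of finite subsets into the limit of a
    sequence.\<close>
  have lim_F: "filterlim F (finite_subsets_at_top ?E0) sequentially"
    unfolding filterlim_finite_subsets_at_top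
  proof (intro allI impI)
    fix X assume X: "finite X \<and> X \<subseteq> ?E0"
    have "finite X \<Longrightarrow> X \<subseteq> (\<Union>n. F n) \<Longrightarrow> \<exists>n. X \<subseteq> F n"
    proof (induction X rule: finite_induct)
      case (insert e X)
      then obtain m n where mn: "X \<subseteq> F n" "e \<in> F m" by auto
      moreover have "F n \<subseteq> F (max m n)" "F m \<subseteq> F (max m n)"
        by (simp_all add: incseqD[OF F(3)])
      ultimately have "insert e X \<subseteq> F (max m n)" by blast
      then show ?case ..
    qed simp
    with X F(4) have "\<exists>n. X \<subseteq> F n" by simp
    then obtain N where "X \<subseteq> F N" ..
    then show "\<forall>\<^sub>F n in sequentially. finite (F n) \<and> X \<subseteq> F n \<and> F n \<subseteq> ?E0"
      unfolding eventually_sequentially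
      using F(1,2) incseqD[OF F(3)] by (intro exI[of _ N]) blast
  qed
  have "(\<lambda>n. sum g (F n)) \<longlonglongrightarrow> tr (star kop * (mulop m * kop))"
    using sum_g lim_F unfolding has_sum_def by (rule filterlim_compose)
  moreover have "(\<lambda>n. sum g (F n)) \<longlonglongrightarrow>
      (LINT x|leb01. m x * complex_of_real (LINT t|leb01. (cmod (k x t))\<^sup>2))"
  proof -
    have "sum g (F n) = (LINT x|leb01. m x * complex_of_real (\<Sum>e\<in>F n. (cmod (kfun e x))\<^sup>2))" for n
    proof -
      have "integrable leb01 (\<lambda>x. m x * complex_of_real ((cmod (kfun e x))\<^sup>2))" for e
        by (rule integrable_leb01_bounded[of _ "D * (C * norm e)\<^sup>2"])
          (use m in \<open>auto simp: norm_mult norm_power intro!: AE_I2 mult_mono power_mono cmod_kfun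
            order.trans[OF norm_ge_zero m(2)]\<close>)
      then show ?thesis
        unfolding g_eq of_real_sum sum_distrib_left by (simp add: Bochner_Integration.integral_sum)
    qed
    moreover have "(\<lambda>n. LINT x|leb01. m x * complex_of_real (\<Sum>e\<in>F n. (cmod (kfun e x))\<^sup>2)) \<longlonglongrightarrow>
      (LINT x|leb01. m x * complex_of_real (LINT t|leb01. (cmod (k x t))\<^sup>2))"
    proof (rule integral_dominated_convergence[where w = "\<lambda>x. D * C\<^sup>2"])
      have [measurable]: "m \<in> borel_measurable leb01" by (rule m(1))
      have [measurable]: "(\<lambda>x. LINT t|leb01. (cmod (k x t))\<^sup>2) \<in> borel_measurable leb01"
        by (intro leb01.borel_measurable_lebesgue_integral) (simp add: case_prod_beta', measurable)
      show "(\<lambda>x. m x * complex_of_real (LINT t|leb01. (cmod (k x t))\<^sup>2)) \<in> borel_measurable leb01"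
        by measurable
      show "(\<lambda>x. m x * complex_of_real (\<Sum>e\<in>F n. (cmod (kfun e x))\<^sup>2)) \<in> borel_measurable leb01" for n
        by measurable
      show "integrable leb01 (\<lambda>x. D * C\<^sup>2)" by (rule leb01.integrable_const)
      have cmod_eq: "cmod (kfun e x) = cmod (cip e (row x))" if "x \<in> {0..1}" for e x
        unfolding kfun_row[OF that] by (metis cip_commute complex_mod_cnj)
      show "AE x in leb01. (\<lambda>n. m x * complex_of_real (\<Sum>e\<in>F n. (cmod (kfun e x))\<^sup>2)) \<longlonglongrightarrow>
          m x * complex_of_real (LINT t|leb01. (cmod (k x t))\<^sup>2)"
      proof (rule AE_I2)
        fix x assume "x \<in> space leb01"
        then have x: "x \<in> {0..1}" by simp
        have "((\<lambda>e. (cmod (kfun e x))\<^sup>2) has_sum (norm (row x))\<^sup>2) some_onb"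
          unfolding cmod_eq[OF x] by (rule parseval[OF is_onb_some_onb])
        then have "((\<lambda>e. (cmod (kfun e x))\<^sup>2) has_sum (norm (row x))\<^sup>2) ?E0"
          by (subst has_sum_cong_neutral[where g = "\<lambda>e. (cmod (kfun e x))\<^sup>2" and T = some_onb])
            (use zero[OF _ _ x] in auto)
        then have "(\<lambda>n. \<Sum>e\<in>F n. (cmod (kfun e x))\<^sup>2) \<longlonglongrightarrow> (norm (row x))\<^sup>2"
          using lim_F unfolding has_sum_def by (rule filterlim_compose)
        then show "(\<lambda>n. m x * complex_of_real (\<Sum>e\<in>F n. (cmod (kfun e x))\<^sup>2)) \<longlonglongrightarrow>
            m x * complex_of_real (LINT t|leb01. (cmod (k x t))\<^sup>2)"
          unfolding norm_row_square[OF x] by (intro tendsto_intros)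
      qed
      show "AE x in leb01. norm (m x * complex_of_real (\<Sum>e\<in>F n. (cmod (kfun e x))\<^sup>2)) \<le> D * C\<^sup>2" for n
      proof (rule AE_I2)
        fix x assume "x \<in> space leb01"
        then have x: "x \<in> {0..1}" by simp
        have "orthonormal (F n)"
          using F(2)[of n] by (intro orthonormal_subset[OF is_onb_orthonormal[OF is_onb_some_onb]]) auto
        then have "(\<Sum>e\<in>F n. (cmod (kfun e x))\<^sup>2) \<le> (norm (row x))\<^sup>2"
          unfolding cmod_eq[OF x] using bessel_finite F(1) by blast
        also have "\<dots> \<le> C\<^sup>2"
          by (intro power_mono norm_row_le x) simp
        finally have "(\<Sum>e\<in>F n. (cmod (kfun e x))\<^sup>2) \<le> C\<^sup>2" .
        moreover have "0 \<le> (\<Sum>e\<in>F n. (cmod (kfun e x))\<^sup>2)"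
          by (intro sum_nonneg) simp
        ultimately show "norm (m x * complex_of_real (\<Sum>e\<in>F n. (cmod (kfun e x))\<^sup>2)) \<le> D * C\<^sup>2"
          unfolding norm_mult norm_of_real
          by (intro mult_mono m(2) order.trans[OF norm_ge_zero m(2)]) simp_all
      qed
    qed
    ultimately show ?thesis by simp
  qed
  ultimately show ?thesis
    unfolding tr using LIMSEQ_unique by blast
qed

end

section \<open>Absolutely continuous functions\<close>

lemma AE_leb01_iff: "(AE x in leb01. Q x) \<longleftrightarrow> negligible {x \<in> {0..1}. \<not> Q x}"
proof -
  have "(AE x in leb01. Q x) \<longleftrightarrow> (AE x in lebesgue. x \<in> {0..1} \<longrightarrow> Q x)"
    by (subst AE_restrict_space_iff) simp_all
  also have "\<dots> \<longleftrightarrow> {x \<in> space lebesgue. \<not> (x \<in> {0..1} \<longrightarrow> Q x)} \<in> null_sets lebesgue"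
    by (rule completion.AE_iff_null_sets)
  also have "{x \<in> space lebesgue. \<not> (x \<in> {0..1} \<longrightarrow> Q x)} = {x \<in> {0..1}. \<not> Q x}" by auto
  finally show ?thesis by (simp add: negligible_iff_null_sets)
qed

text \<open>The intervals of a partial tagged division have disjoint interiors, so their endpoints
  form an admissible family for absolute continuity, with total length at most the measure of
  U.\<close>

lemma AC01_fine_sum_le:
  fixes g :: "real \<Rightarrow> complex" and U :: "real set"
  assumes AC: "\<And>J :: (real \<times> real) set. finite J \<Longrightarrow> (\<forall>(a, b)\<in>J. 0 \<le> a \<and> a < b \<and> b \<le> 1) \<Longrightarrow>
      pairwise (\<lambda>(a, b) (c, d). {a<..<b} \<inter> {c<..<d} = {}) J \<Longrightarrow>
      (\<Sum>(a, b)\<in>J. b - a) < \<delta> \<Longrightarrow> (\<Sum>(a, b)\<in>J. cmod (g b - g a)) < \<epsilon>"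
    and U: "U \<in> lmeasurable" "measure lebesgue U < \<delta>"
    and p: "p tagged_partial_division_of {0..1}" "\<And>x K. (x, K) \<in> p \<Longrightarrow> K \<subseteq> U"
  shows "(\<Sum>(x, K)\<in>p. cmod (g (Sup K) - g (Inf K))) < \<epsilon>"
proof -
  \<comment> \<open>Degenerate intervals contribute 0 and violate the condition a < b in
    \<open>AC01\<close>.\<close>
  define q where "q = {(x, K) \<in> p. Inf K < Sup K}"
  define J where "J = (\<lambda>(x, K). (Inf K, Sup K)) ` q"
  have fin_p: "finite p" using p(1) by (simp add: tagged_partial_division_of_def)
  then have fin_q: "finite q" unfolding q_def by (rule rev_finite_subset) auto
  have K: "\<exists>u v. K = {u..v} \<and> Inf K = u \<and> Sup K = v \<and> u \<le> v \<and> 0 \<le> u \<and> v \<le> 1 \<and> x \<in> K"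
    if xK: "(x, K) \<in> p" for x K
  proof -
    obtain u v where uv: "K = cbox u v" "x \<in> K" "K \<subseteq> {0..1}"
      using tagged_partial_division_ofD(2-4)[OF p(1) xK] by blast
    then have "u \<le> v" by auto
    then show ?thesis using uv by (intro exI[of _ u] exI[of _ v]) auto
  qed
  have Kq: "K = {Inf K..Sup K}" "interior K = {Inf K<..<Sup K}" "0 \<le> Inf K" "Sup K \<le> 1" "Inf K < Sup K"
    if xK: "(x, K) \<in> q" for x K
  proof -
    have xK': "(x, K) \<in> p" "Inf K < Sup K" using xK by (auto simp: q_def)
    obtain u v where uv: "K = {u..v}" "Inf K = u" "Sup K = v" "0 \<le> u" "v \<le> 1"
      using K[OF xK'(1)] by blast
    show "K = {Inf K..Sup K}" "0 \<le> Inf K" "Sup K \<le> 1" "Inf K < Sup K"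
      using uv xK'(2) by simp_all
    show "interior K = {Inf K<..<Sup K}"
      unfolding uv(2,3) unfolding uv(1) by (rule interior_atLeastAtMost_real)
  qed
  have disj: "{Inf K<..<Sup K} \<inter> {Inf L<..<Sup L} = {}"
    if "(x, K) \<in> q" "(y, L) \<in> q" "(x, K) \<noteq> (y, L)" for x K y L
  proof -
    have "interior K \<inter> interior L = {}"
      by (rule tagged_partial_division_ofD(5)[OF p(1), of x _ y]) (use that in \<open>auto simp: q_def\<close>)
    then show ?thesis using Kq(2)[OF that(1)] Kq(2)[OF that(2)] by simp
  qed
  have inj: "inj_on (\<lambda>(x, K). (Inf K, Sup K)) q"
  proof (rule inj_onI, clarsimp)
    fix x K y L
    assume q: "(x, K) \<in> q" "(y, L) \<in> q" and eq: "Inf K = Inf L" "Sup K = Sup L"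
    show "x = y \<and> K = L"
    proof (rule ccontr)
      assume "\<not> (x = y \<and> K = L)"
      then have "{Inf K<..<Sup K} = {}" using disj[OF q] eq by auto
      then show False using Kq(5)[OF q(1)] by simp
    qed
  qed
  have sum_J: "(\<Sum>(a, b)\<in>J. f a b) = (\<Sum>(x, K)\<in>q. f (Inf K) (Sup K))" for f :: "real \<Rightarrow> real \<Rightarrow> real"
    unfolding J_def by (subst sum.reindex[OF inj]) (simp add: case_prod_beta')
  have "(\<Sum>(x, K)\<in>p. cmod (g (Sup K) - g (Inf K))) = (\<Sum>(x, K)\<in>q. cmod (g (Sup K) - g (Inf K)))"
  proof (rule sum.mono_neutral_right[OF fin_p])
    show "\<forall>i\<in>p - q. (case i of (x, K) \<Rightarrow> cmod (g (Sup K) - g (Inf K))) = 0"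
    proof safe
      fix x K assume "(x, K) \<in> p" "(x, K) \<notin> q"
      then have "Inf K = Sup K" using K[of x K] by (auto simp: q_def)
      then show "cmod (g (Sup K) - g (Inf K)) = 0" by simp
    qed
  qed (auto simp: q_def)
  also have "\<dots> = (\<Sum>(a, b)\<in>J. cmod (g b - g a))" by (simp add: sum_J)
  also have "\<dots> < \<epsilon>"
  proof (rule AC)
    show "finite J" unfolding J_def using fin_q by simp
    show "\<forall>(a, b)\<in>J. 0 \<le> a \<and> a < b \<and> b \<le> 1" unfolding J_def using Kq by auto
    show "pairwise (\<lambda>(a, b) (c, d). {a<..<b} \<inter> {c<..<d} = {}) J"
      unfolding J_def pairwise_def using disj by fastforce
    have "(\<Sum>(a, b)\<in>J. b - a) = (\<Sum>i\<in>q. measure lebesgue {Inf (snd i)<..<Sup (snd i)})"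
      unfolding sum_J by (intro sum.cong) (auto dest: Kq(5))
    also have "\<dots> = measure lebesgue (\<Union>i\<in>q. {Inf (snd i)<..<Sup (snd i)})"
    proof (rule measure_UNION'[symmetric, OF fin_q])
      show "{Inf (snd i)<..<Sup (snd i)} \<in> lmeasurable" for i :: "real \<times> real set"
        by (metis box_real(1) lmeasurable_box)
      show "pairwise (\<lambda>i j. disjnt {Inf (snd i)<..<Sup (snd i)} {Inf (snd j)<..<Sup (snd j)}) q"
        unfolding pairwise_def disjnt_def using disj by force
    qed
    also have "\<dots> \<le> measure lebesgue U"
    proof (rule measure_mono_fmeasurable[OF _ _ U(1)])
      show "(\<Union>i\<in>q. {Inf (snd i)<..<Sup (snd i)}) \<subseteq> U"
      proof clarify
        fix t x K assume "(x, K) \<in> q" "t \<in> {Inf (snd (x, K))<..<Sup (snd (x, K))}"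
        then show "t \<in> U" using Kq(1)[of x K] p(2)[of x K] by (auto simp: q_def)
      qed
      show "(\<Union>i\<in>q. {Inf (snd i)<..<Sup (snd i)}) \<in> sets lebesgue"
        using fin_q by (intro sets.finite_UN) auto
    qed
    finally show "(\<Sum>(a, b)\<in>J. b - a) < \<delta>" using U(2) by simp
  qed
  finally show ?thesis .
qed

text \<open>The tags in the exceptional null set are kept in an open set of small measure, where
  absolute continuity applies.\<close>

lemma AC01_has_integral:
  assumes AC: "AC01 g"
    and deriv: "AE x in leb01. (g has_vector_derivative g' x) (at x within {0..1})"
    and ab: "0 \<le> a" "a \<le> b" "b \<le> 1"
  shows "(g' has_integral (g b - g a)) {a..b}"
proof -
  define N where "N = {x \<in> {0..1}. \<not> (g has_vector_derivative g' x) (at x within {0..1})}"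
  have N: "negligible N"
    using deriv unfolding AE_leb01_iff N_def .
  \<comment> \<open>Setting the derivative to 0 on the null set leaves the integral unchanged and
    removes the Riemann terms of the tags there.\<close>
  define h where "h x = (if x \<in> N then 0 else g' x)" for x
  have "(h has_integral (g b - g a)) {a..b}"
    unfolding has_integral_real
  proof (intro allI impI)
    fix e :: real assume e: "0 < e"
    then have "0 < e / 2" by simp
    with AC obtain \<delta> where \<delta>: "0 < \<delta>"
      "\<And>J :: (real \<times> real) set. finite J \<Longrightarrow> (\<forall>(a, b)\<in>J. 0 \<le> a \<and> a < b \<and> b \<le> 1) \<Longrightarrow>
      pairwise (\<lambda>(a, b) (c, d). {a<..<b} \<inter> {c<..<d} = {}) J \<Longrightarrow>
      (\<Sum>(a, b)\<in>J. b - a) < \<delta> \<Longrightarrow> (\<Sum>(a, b)\<in>J. cmod (g b - g a)) < e / 2"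
      unfolding AC01_def by meson
    obtain U where U: "open U" "N \<subseteq> U" "U \<in> lmeasurable" "measure lebesgue U < \<delta>"
    proof -
      have N_sets: "N \<in> sets lebesgue" using N by (simp add: negligible_imp_sets)
      obtain U where U: "open U" "N \<subseteq> U" "U - N \<in> lmeasurable" "emeasure lebesgue (U - N) < ennreal \<delta>"
        using sets_lebesgue_outer_open[OF N_sets \<delta>(1)] by blast
      have "U = (U - N) \<union> N" using U(2) by blast
      moreover have "N \<in> lmeasurable" using N by (simp add: negligible_imp_measurable)
      ultimately have U_meas: "U \<in> lmeasurable" using fmeasurable.Un[OF U(3)] by metis
      have "measure lebesgue (U - N) < \<delta>"
        using U(3,4) \<delta>(1) by (simp add: emeasure_eq_measure2 ennreal_less_iff)
      then have "measure lebesgue U < \<delta>"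
        using N U_meas by (simp add: measure_Diff_null_set negligible_iff_null_sets fmeasurableD)
      with U(1,2) U_meas show ?thesis by (rule that)
    qed
    have "\<exists>d>0. \<forall>y\<in>{0..1}. \<bar>y - x\<bar> < d \<longrightarrow>
        cmod (g y - g x - (y - x) *\<^sub>R g' x) \<le> (e / 4) * \<bar>y - x\<bar>" if "x \<in> {0..1} - N" for x
    proof -
      have "(g has_derivative (\<lambda>h. h *\<^sub>R g' x)) (at x within {0..1})"
        using that by (auto simp: N_def has_vector_derivative_def)
      then show ?thesis
        unfolding has_derivative_within_alt using e by (auto dest!: spec[of _ "e / 4"])
    qed
    then obtain d where d: "\<And>x. x \<in> {0..1} - N \<Longrightarrow> 0 < d x" "\<And>x y. x \<in> {0..1} - N \<Longrightarrow> y \<in> {0..1} \<Longrightarrow>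
        \<bar>y - x\<bar> < d x \<Longrightarrow> cmod (g y - g x - (y - x) *\<^sub>R g' x) \<le> (e / 4) * \<bar>y - x\<bar>"
      by metis
    \<comment> \<open>An interval tagged in the exceptional set must stay in U; one tagged elsewhere
      in [0,1] must stay where linear approximation has error rate e/4.\<close>
    define \<gamma> where "\<gamma> x = (if x \<in> N then U else if x \<in> {0..1} then ball x (d x) else ball x 1)" for x
    show "\<exists>\<gamma>. gauge \<gamma> \<and> (\<forall>p. p tagged_division_of {a..b} \<and> \<gamma> fine p \<longrightarrow>
        norm ((\<Sum>(x, K)\<in>p. measure lborel K *\<^sub>R h x) - (g b - g a)) < e)"
    proof (intro exI[of _ \<gamma>] conjI allI impI)
      show "gauge \<gamma>"
        using U d(1) by (auto simp: gauge_def \<gamma>_def)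
      fix p assume "p tagged_division_of {a..b} \<and> \<gamma> fine p"
      then have p: "p tagged_division_of {a..b}" and fine: "\<gamma> fine p" by auto
      have fin: "finite p" using p by (simp add: tagged_division_of)
      have K: "\<exists>u v. K = {u..v} \<and> u \<le> v \<and> u \<in> {0..1} \<and> v \<in> {0..1} \<and> x \<in> {u..v} \<and> {u..v} \<subseteq> \<gamma> x"
        if xK: "(x, K) \<in> p" for x K
      proof -
        obtain u v where uv: "K = cbox u v" "x \<in> K" "K \<subseteq> {a..b}"
          using tagged_division_ofD(2-4)[OF p xK] by blast
        then have "u \<le> v" by auto
        moreover have "K \<subseteq> \<gamma> x" using fine xK unfolding fine_def by blast
        ultimately show ?thesis using uv ab by (intro exI[of _ u] exI[of _ v]) auto
      qed
      let ?t = "\<lambda>(x, K). measure lborel K *\<^sub>R h x - (g (Sup K) - g (Inf K))"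
      let ?bad = "{(x, K) \<in> p. x \<in> N}"
      \<comment> \<open>The tag lies between the endpoints, so the two one-sided errors add up to
        e/4 times the length. All good intervals together cost at most e/4, the bad ones less than
        e/2.\<close>
      have good_le: "cmod (?t (x, K)) \<le> (e / 4) * (Sup K - Inf K)" if xK: "(x, K) \<in> p" "x \<notin> N" for x K
      proof -
        obtain u v where uv: "K = {u..v}" "u \<le> v" "u \<in> {0..1}" "v \<in> {0..1}" "x \<in> {u..v}" "{u..v} \<subseteq> \<gamma> x"
          using K[OF xK(1)] by blast
        then have x: "x \<in> {0..1} - N" using xK(2) by auto
        then have "{u..v} \<subseteq> ball x (d x)" using uv(6) by (auto simp: \<gamma>_def)
        moreover have "u \<in> {u..v}" "v \<in> {u..v}" using uv(2) by auto
        ultimately have "u \<in> ball x (d x)" "v \<in> ball x (d x)" by blast+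
        then have near: "\<bar>u - x\<bar> < d x" "\<bar>v - x\<bar> < d x" by (auto simp: dist_real_def)
        have "?t (x, K) = (g u - g x - (u - x) *\<^sub>R g' x) - (g v - g x - (v - x) *\<^sub>R g' x)"
          using uv(1,2) x by (simp add: h_def content_real algebra_simps)
        also have "cmod \<dots> \<le> (e / 4) * \<bar>u - x\<bar> + (e / 4) * \<bar>v - x\<bar>"
          using norm_triangle_ineq4 d(2)[OF x uv(3) near(1)] d(2)[OF x uv(4) near(2)]
          by (meson add_mono order.trans)
        also have "\<dots> = (e / 4) * (v - u)"
        proof -
          have "\<bar>u - x\<bar> = x - u" "\<bar>v - x\<bar> = v - x" using uv(5) by auto
          then show ?thesis by (simp flip: distrib_left)
        qed
        finally show ?thesis using uv(1,2) by simp
      qed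
      have bad_sum: "(\<Sum>i\<in>?bad. cmod (?t i)) < e / 2"
      proof -
        have "(\<Sum>i\<in>?bad. cmod (?t i)) = (\<Sum>(x, K)\<in>?bad. cmod (g (Sup K) - g (Inf K)))"
          by (intro sum.cong) (auto simp: h_def norm_minus_commute)
        also have "\<dots> < e / 2"
        proof (rule AC01_fine_sum_le[OF \<delta>(2) U(3,4)])
          have "p tagged_partial_division_of {0..1}"
            unfolding tagged_partial_division_of_def
          proof (intro conjI allI impI)
            fix x K assume xK: "(x, K) \<in> p"
            then show "x \<in> K" "\<exists>a b. K = cbox a b"
              using tagged_division_ofD(2,4)[OF p xK] by auto
            have "{a..b} \<subseteq> {0..1}" using ab by auto
            with tagged_division_ofD(3)[OF p xK] show "K \<subseteq> {0..1}" by (rule subset_trans)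
          next
            fix x1 K1 x2 K2 assume "(x1, K1) \<in> p \<and> (x2, K2) \<in> p \<and> (x1, K1) \<noteq> (x2, K2)"
            then have "(x1, K1) \<in> p" "(x2, K2) \<in> p" "(x1, K1) \<noteq> (x2, K2)" by blast+
            then show "interior K1 \<inter> interior K2 = {}"
              by (rule tagged_division_ofD(5)[OF p])
          qed (rule fin)
          then show "?bad tagged_partial_division_of {0..1}"
            by (rule tagged_partial_division_subset) auto
          show "K \<subseteq> U" if "(x, K) \<in> ?bad" for x K
            using K[of x K] that by (auto simp: \<gamma>_def)
        qed
        finally show ?thesis .
      qed
      have "(\<Sum>(x, K)\<in>p. measure lborel K *\<^sub>R h x) - (g b - g a) = (\<Sum>i\<in>p. ?t i)"
        using additive_tagged_division_1[OF ab(2) p, of g]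
        by (simp add: case_prod_beta' sum_subtractf)
      also have "cmod \<dots> \<le> (\<Sum>i\<in>p. cmod (?t i))" by (rule norm_sum)
      also have "\<dots> = (\<Sum>i\<in>?bad. cmod (?t i)) + (\<Sum>i\<in>p - ?bad. cmod (?t i))"
        using fin by (subst sum.subset_diff[of ?bad p]) auto
      also have "(\<Sum>i\<in>p - ?bad. cmod (?t i)) \<le> (\<Sum>i\<in>p - ?bad. (e / 4) * (case i of (x, K) \<Rightarrow> Sup K - Inf K))"
        using good_le by (intro sum_mono) auto
      also have "\<dots> \<le> (\<Sum>i\<in>p. (e / 4) * (case i of (x, K) \<Rightarrow> Sup K - Inf K))"
      proof (rule sum_mono2[OF fin])
        fix i assume "i \<in> p - (p - ?bad)"
        then show "0 \<le> (e / 4) * (case i of (x, K) \<Rightarrow> Sup K - Inf K)"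
          using K[of "fst i" "snd i"] e by (auto simp: case_prod_beta')
      qed auto
      also have "\<dots> = (e / 4) * (b - a)"
        unfolding sum_distrib_left[symmetric]
        using additive_tagged_division_1[OF ab(2) p, of "\<lambda>x. x"] by simp
      also have "\<dots> \<le> (e / 4) * 1"
        using ab e by (intro mult_left_mono) auto
      finally show "norm ((\<Sum>(x, K)\<in>p. measure lborel K *\<^sub>R h x) - (g b - g a)) < e"
        using bad_sum e by simp
    qed
  qed
  then show ?thesis
    by (rule has_integral_spike[OF N, rotated]) (simp add: h_def)
qed

section \<open>Differentiation of primitives almost everywhere\<close>

lemma primitive_diff:
  fixes f :: "real \<Rightarrow> complex"
  assumes "f integrable_on {0..1}" "0 \<le> x" "x \<le> y" "y \<le> 1"
  shows "integral {0..y} f - integral {0..x} f = integral {x..y} f"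
proof -
  have "f integrable_on {0..y}"
    by (rule integrable_subinterval_real[OF assms(1)]) (use assms in auto)
  from Henstock_Kurzweil_Integration.integral_combine[OF assms(2,3) this] show ?thesis
    by (simp add: algebra_simps)
qed

text \<open>Every point of the set is an endpoint of arbitrarily short intervals on which the
  increment misses its linear approximation by more than e times the length. Vitali's theorem
  selects disjoint ones covering almost all of the set, and Henstock's lemma with tolerance
  \<open>e * \<eta>\<close> bounds their total length by \<eta>.\<close>

lemma negligible_bad_difference_quotients:
  fixes f :: "real \<Rightarrow> complex"
  assumes f: "f integrable_on {0..1}" and e: "0 < e"
  defines "F \<equiv> \<lambda>x. integral {0..x} f"
  shows "negligible {x \<in> {0..1}. \<forall>d>0. \<exists>y\<in>{0..1}. \<bar>y - x\<bar> < d \<and>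
    e * \<bar>y - x\<bar> < cmod (F y - F x - (y - x) *\<^sub>R f x)}" (is "negligible ?S")
  unfolding negligible_outer_le
proof (intro allI impI)
  fix \<eta> :: real assume \<eta>: "0 < \<eta>"
  have "f integrable_on cbox 0 1" using f by simp
  moreover have "0 < e * \<eta>" using e \<eta> by simp
  ultimately obtain \<gamma> where \<gamma>: "gauge \<gamma>"
    "\<And>p. p tagged_partial_division_of (cbox 0 1) \<Longrightarrow> \<gamma> fine p \<Longrightarrow>
      (\<Sum>(x, K)\<in>p. norm (measure lborel K *\<^sub>R f x - integral K f)) < e * \<eta>"
    by (rule Henstock_lemma) blast
  \<comment> \<open>An interval is recorded as its tag x and its other endpoint y, which may lie on
    either side; c and r present it as a ball for Vitali's theorem.\<close>
  define I where "I = {(x, y). x \<in> {0..1} \<and> y \<in> {0..1} \<and> {min x y..max x y} \<subseteq> \<gamma> x \<and>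
    e * \<bar>y - x\<bar> < cmod (F y - F x - (y - x) *\<^sub>R f x)}"
  define c where "c = (\<lambda>(x::real, y). (x + y) / 2)"
  define r where "r = (\<lambda>(x::real, y). \<bar>x - y\<bar> / 2)"
  have cball: "cball (c (x, y)) (r (x, y)) = {min x y..max x y}" for x y
    by (auto simp: c_def r_def cball_eq_atLeastAtMost min_def max_def field_simps)
  have ne: "x \<noteq> y" if "(x, y) \<in> I" for x y using that by (auto simp: I_def)
  have "0 < r i" if "i \<in> I" for i
    using ne[of "fst i" "snd i"] that by (simp add: r_def case_prod_beta')
  moreover have "\<exists>i. i \<in> I \<and> x \<in> cball (c i) (r i) \<and> r i < d" if x: "x \<in> ?S" and "0 < d" for x d
  proof -
    obtain \<epsilon> where \<epsilon>: "0 < \<epsilon>" "ball x \<epsilon> \<subseteq> \<gamma> x"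
      using \<gamma>(1) unfolding gauge_def by (metis open_contains_ball)
    obtain y where y: "y \<in> {0..1}" "\<bar>y - x\<bar> < min d \<epsilon>"
      "e * \<bar>y - x\<bar> < cmod (F y - F x - (y - x) *\<^sub>R f x)"
      using x \<epsilon>(1) \<open>0 < d\<close> by (auto dest!: spec[of _ "min d \<epsilon>"])
    have "{min x y..max x y} \<subseteq> ball x \<epsilon>"
      using y(2) by (auto simp: dist_real_def)
    then have "(x, y) \<in> I"
      using x y \<epsilon>(2) by (auto simp: I_def)
    moreover have "x \<in> cball (c (x, y)) (r (x, y))" unfolding cball by auto
    moreover have "r (x, y) < d" using y(2) \<open>0 < d\<close> by (auto simp: r_def)
    ultimately show ?thesis by blast
  qed
  ultimately obtain C where C: "countable C" "C \<subseteq> I"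
     "pairwise (\<lambda>i j. disjnt (cball (c i) (r i)) (cball (c j) (r j))) C"
     "negligible (?S - (\<Union>i\<in>C. cball (c i) (r i)))"
    using Vitali_covering_theorem_cballs[of I r ?S c] by blast
  let ?K = "\<lambda>i. cball (c i) (r i)"
  have K_meas: "?K i \<in> lmeasurable" for i by simp
  \<comment> \<open>Henstock's lemma speaks of finite partial divisions, so the bound is shown for
    finite subfamilies and then passes to the countable union.\<close>
  have fin_bound: "measure lebesgue (\<Union>i\<in>C'. ?K i) \<le> \<eta>" if C': "finite C'" "C' \<subseteq> C" for C'
  proof -
    define p where "p = (\<lambda>i. (fst i, ?K i)) ` C'"
    have nonempty: "?K i \<noteq> {}" for i by (simp add: r_def case_prod_beta')
    have disj: "?K i \<inter> ?K j = {}" if "i \<in> C'" "j \<in> C'" "i \<noteq> j" for i j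
      using C(3) C'(2) that unfolding pairwise_def disjnt_def by blast
    have inj: "inj_on (\<lambda>i. (fst i, ?K i)) C'"
    proof (rule inj_onI)
      fix i j assume "i \<in> C'" "j \<in> C'" "(fst i, ?K i) = (fst j, ?K j)"
      then show "i = j" using disj[of i j] nonempty[of i] by auto
    qed
    have I: "i \<in> I" if "i \<in> C'" for i using that C' C(2) by blast
    have K_i: "?K i = {min (fst i) (snd i)..max (fst i) (snd i)}" for i
      using cball[of "fst i" "snd i"] by simp
    have "p tagged_partial_division_of cbox 0 1"
      unfolding tagged_partial_division_of_def
    proof (intro conjI allI impI)
      show "finite p" using C'(1) by (simp add: p_def)
      fix x K assume "(x, K) \<in> p"
      then obtain i where i: "i \<in> C'" "x = fst i" "K = ?K i" by (auto simp: p_def)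
      show "x \<in> K" "K \<subseteq> cbox 0 1" "\<exists>a b. K = cbox a b"
        using I[OF i(1)] unfolding i K_i by (auto simp: I_def)
    next
      fix x1 K1 x2 K2
      assume "(x1, K1) \<in> p \<and> (x2, K2) \<in> p \<and> (x1, K1) \<noteq> (x2, K2)"
      then obtain i j where "i \<in> C'" "K1 = ?K i" "j \<in> C'" "K2 = ?K j" "i \<noteq> j"
        by (auto simp: p_def)
      then show "interior K1 \<inter> interior K2 = {}"
        using disj[of i j] interior_subset by blast
    qed
    moreover have "\<gamma> fine p"
      unfolding fine_def
    proof clarify
      fix x K t assume "(x, K) \<in> p" "t \<in> K"
      then obtain i where i: "i \<in> C'" "x = fst i" "K = ?K i" by (auto simp: p_def)
      have "{min (fst i) (snd i)..max (fst i) (snd i)} \<subseteq> \<gamma> (fst i)"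
        using I[OF i(1)] by (simp only: I_def mem_Collect_eq case_prod_beta')
      then show "t \<in> \<gamma> x" using \<open>t \<in> K\<close> unfolding i K_i by blast
    qed
    ultimately have "(\<Sum>(x, K)\<in>p. norm (measure lborel K *\<^sub>R f x - integral K f)) < e * \<eta>"
      by (rule \<gamma>(2))
    then have sum_lt: "(\<Sum>i\<in>C'. norm (measure lborel (?K i) *\<^sub>R f (fst i) - integral (?K i) f)) < e * \<eta>"
      unfolding p_def by (subst (asm) sum.reindex[OF inj]) (simp add: o_def)
    have le: "e * measure lebesgue (?K i) \<le> norm (measure lborel (?K i) *\<^sub>R f (fst i) - integral (?K i) f)"
      if "i \<in> C'" for i
    proof -
      obtain x y where i: "i = (x, y)" by fastforce
      have xy: "x \<in> {0..1}" "y \<in> {0..1}" "e * \<bar>y - x\<bar> < cmod (F y - F x - (y - x) *\<^sub>R f x)"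
        using I[OF that] by (auto simp: i I_def)
      show ?thesis
      proof (cases "x \<le> y")
        case True
        then have K: "?K i = {x..y}" by (simp add: K_i i)
        have "integral {x..y} f = F y - F x"
          unfolding F_def using primitive_diff[OF f, of x y] xy True by simp
        then show ?thesis
          using xy(3) True unfolding K by (simp add: i norm_minus_commute content_real)
      next
        case False
        then have K: "?K i = {y..x}" by (simp add: K_i i)
        have int: "integral {y..x} f = F x - F y"
          unfolding F_def using primitive_diff[OF f, of y x] xy False by simp
        have "cmod ((x - y) *\<^sub>R f x - (F x - F y)) = cmod (F y - F x - (y - x) *\<^sub>R f x)"
          by (rule arg_cong[of _ _ cmod]) (simp add: algebra_simps)
        then show ?thesis
          using xy(3) False unfolding K int by (simp add: i content_real)
      qed
    qed
    have "e * measure lebesgue (\<Union>i\<in>C'. ?K i) \<le> e * (\<Sum>i\<in>C'. measure lebesgue (?K i))"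
      using e C'(1) by (intro mult_left_mono measure_UNION_le) auto
    also have "\<dots> \<le> (\<Sum>i\<in>C'. norm (measure lborel (?K i) *\<^sub>R f (fst i) - integral (?K i) f))"
      unfolding sum_distrib_left by (intro sum_mono le)
    also have "\<dots> < e * \<eta>" by (rule sum_lt)
    finally show ?thesis using e by simp
  qed
  have U: "(\<Union>i\<in>C. ?K i) \<in> lmeasurable" "measure lebesgue (\<Union>i\<in>C. ?K i) \<le> \<eta>"
    using fmeasurable_UN_bound[OF C(1) K_meas fin_bound] measure_UN_bound[OF C(1) K_meas fin_bound]
    by blast+
  show "\<exists>T. ?S \<subseteq> T \<and> T \<in> lmeasurable \<and> measure lebesgue T \<le> \<eta>"
  proof (intro exI conjI)
    let ?R = "?S - (\<Union>i\<in>C. ?K i)"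
    show "?S \<subseteq> (\<Union>i\<in>C. ?K i) \<union> ?R" by blast
    have R: "?R \<in> lmeasurable" "measure lebesgue ?R = 0"
      using C(4) by (auto simp: negligible_iff_measure)
    then show "(\<Union>i\<in>C. ?K i) \<union> ?R \<in> lmeasurable" using U(1) by blast
    have "measure lebesgue ((\<Union>i\<in>C. ?K i) \<union> ?R) \<le> measure lebesgue (\<Union>i\<in>C. ?K i) + measure lebesgue ?R"
      by (intro measure_Un_le) (use U(1) R(1) in auto)
    then show "measure lebesgue ((\<Union>i\<in>C. ?K i) \<union> ?R) \<le> \<eta>"
      using U(2) R(2) by linarith
  qed
qed

text \<open>Where the derivative fails, the difference quotient is bad at some rate 1/(n+1); the
  exceptional set is thus covered by countably many of the negligible sets above.\<close>

lemma primitive_has_vector_derivative_AE: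
  fixes f :: "real \<Rightarrow> complex"
  assumes f: "f integrable_on {0..1}"
  shows "AE x in leb01. ((\<lambda>x. integral {0..x} f) has_vector_derivative f x) (at x within {0..1})"
  unfolding AE_leb01_iff
proof (rule negligible_subset)
  let ?F = "\<lambda>x. integral {0..x} f"
  let ?S = "\<lambda>e. {x \<in> {0..1}. \<forall>d>0. \<exists>y\<in>{0..1}. \<bar>y - x\<bar> < d \<and>
    e * \<bar>y - x\<bar> < cmod (?F y - ?F x - (y - x) *\<^sub>R f x)}"
  show "negligible (\<Union>n. ?S (1 / real (Suc n)))"
  proof (rule negligible_countable_Union)
    have "negligible (?S (1 / real (Suc n)))" for n
      by (rule negligible_bad_difference_quotients[OF f]) simp
    then show "\<And>A. A \<in> range (\<lambda>n. ?S (1 / real (Suc n))) \<Longrightarrow> negligible A" by blast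
  qed simp
  show "{x \<in> {0..1}. \<not> (?F has_vector_derivative f x) (at x within {0..1})} \<subseteq> (\<Union>n. ?S (1 / real (Suc n)))"
  proof (rule subsetI, rule ccontr)
    fix x
    assume x: "x \<in> {x \<in> {0..1}. \<not> (?F has_vector_derivative f x) (at x within {0..1})}"
      and "x \<notin> (\<Union>n. ?S (1 / real (Suc n)))"
    then have "\<not> (\<forall>d>0. \<exists>y\<in>{0..1}. \<bar>y - x\<bar> < d \<and>
        1 / real (Suc n) * \<bar>y - x\<bar> < cmod (?F y - ?F x - (y - x) *\<^sub>R f x))" for n
      by blast
    then have good: "\<exists>d>0. \<forall>y\<in>{0..1}. \<bar>y - x\<bar> < d \<longrightarrow>
        cmod (?F y - ?F x - (y - x) *\<^sub>R f x) \<le> 1 / real (Suc n) * \<bar>y - x\<bar>" for n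
      by (meson not_less)
    have "(?F has_vector_derivative f x) (at x within {0..1})"
      unfolding has_vector_derivative_def has_derivative_within_alt
    proof (intro conjI allI impI)
      show "bounded_linear (\<lambda>h. h *\<^sub>R f x)" by (rule bounded_linear_scaleR_left)
      fix e :: real assume "0 < e"
      then obtain n where n: "1 / real (Suc n) < e"
        using reals_Archimedean[of e] by (auto simp: inverse_eq_divide)
      obtain d where d: "0 < d" "\<And>y. y \<in> {0..1} \<Longrightarrow> \<bar>y - x\<bar> < d \<Longrightarrow>
          cmod (?F y - ?F x - (y - x) *\<^sub>R f x) \<le> 1 / real (Suc n) * \<bar>y - x\<bar>"
        using good[of n] by blast
      have "cmod (?F y - ?F x - (y - x) *\<^sub>R f x) \<le> e * \<bar>y - x\<bar>"
        if "y \<in> {0..1}" "\<bar>y - x\<bar> < d" for y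
        using d(2)[OF that] mult_right_mono[OF less_imp_le[OF n], of "\<bar>y - x\<bar>"] by linarith
      then show "\<exists>d>0. \<forall>y\<in>{0..1}. norm (y - x) < d \<longrightarrow>
          norm (?F y - ?F x - (y - x) *\<^sub>R f x) \<le> e * norm (y - x)"
        using d(1) by auto
    qed
    then show False using x by simp
  qed
qed

section \<open>Absolute continuity of primitives\<close>

lemma sum_disjoint_intervals_le:
  assumes "finite J" "pairwise (\<lambda>(a, b) (c, d). {a<..<b} \<inter> {c<..<d} = {}) J" "0 \<le> w"
  shows "(\<Sum>(a, b)\<in>J. if x \<in> {a<..<b} then w else 0) \<le> (w::real)"
proof -
  let ?J = "{i \<in> J. x \<in> {fst i<..<snd i}}"
  have "i = j" if "i \<in> ?J" "j \<in> ?J" for i j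
    using assms(2) that unfolding pairwise_def by (fastforce simp: case_prod_beta')
  then have "card ?J \<le> 1"
    using assms(1) by (auto simp: card_le_Suc0_iff_eq)
  have "(\<Sum>(a, b)\<in>J. if x \<in> {a<..<b} then w else 0) = (\<Sum>i\<in>?J. w)"
    using assms(1) by (subst sum.inter_filter) (auto simp: case_prod_beta' intro!: sum.cong)
  also have "\<dots> = real (card ?J) * w" by simp
  also have "\<dots> \<le> 1 * w"
    using \<open>card ?J \<le> 1\<close> assms(3) by (intro mult_right_mono) auto
  finally show ?thesis by simp
qed

text \<open>The modulus of f is at most c/2 plus its square divided by 2c. Over a disjoint family
  the first part integrates to c/2 times the total length, and the second to at most W/(2c), however
  the family is chosen.\<close>

lemma AC01_primitive:
  assumes f: "sq_integrable f"
  shows "AC01 (\<lambda>x. integral {0..x} f)"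
  unfolding AC01_def
proof (intro allI impI)
  fix \<epsilon> :: real assume \<epsilon>: "0 < \<epsilon>"
  have f_int: "f integrable_on {0..1}"
    by (rule integrable_on_lebesgue_on[OF sq_integrable_integrable[OF f]]) simp
  define w where "w x = (cmod (f x))\<^sup>2" for x
  have w_int: "w integrable_on {0..1}"
    unfolding w_def by (rule integrable_on_lebesgue_on) (use f in \<open>simp_all add: sq_integrable_def\<close>)
  define W where "W = integral {0..1} w"
  have W: "0 \<le> W" unfolding W_def by (rule integral_nonneg[OF w_int]) (simp add: w_def)
  \<comment> \<open>This makes W/(2c) at most \<epsilon>/2, and with total length below \<epsilon>/c
    the other part is below \<epsilon>/2. The added 1 keeps c positive when W = 0.\<close>
  define c where "c = (W + 1) / \<epsilon>"
  have c: "0 < c" using W \<epsilon> by (simp add: c_def)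
  show "\<exists>\<delta>>0. \<forall>J. finite J \<and> (\<forall>(a, b)\<in>J. 0 \<le> a \<and> a < b \<and> b \<le> 1) \<and>
      pairwise (\<lambda>(a, b) (c, d). {a<..<b} \<inter> {c<..<d} = {}) J \<and> (\<Sum>(a, b)\<in>J. b - a) < \<delta> \<longrightarrow>
      (\<Sum>(a, b)\<in>J. cmod (integral {0..b} f - integral {0..a} f)) < \<epsilon>"
  proof (intro exI[of _ "\<epsilon> / c"] conjI allI impI)
    show "0 < \<epsilon> / c" using \<epsilon> c by simp
    fix J :: "(real \<times> real) set"
    assume "finite J \<and> (\<forall>(a, b)\<in>J. 0 \<le> a \<and> a < b \<and> b \<le> 1) \<and>
      pairwise (\<lambda>(a, b) (c, d). {a<..<b} \<inter> {c<..<d} = {}) J \<and> (\<Sum>(a, b)\<in>J. b - a) < \<epsilon> / c"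
    then have J: "finite J" "\<And>a b. (a, b) \<in> J \<Longrightarrow> 0 \<le> a \<and> a < b \<and> b \<le> 1"
      "pairwise (\<lambda>(a, b) (c, d). {a<..<b} \<inter> {c<..<d} = {}) J" "(\<Sum>(a, b)\<in>J. b - a) < \<epsilon> / c"
      by auto
    have each: "cmod (integral {0..b} f - integral {0..a} f) \<le> c / 2 * (b - a) + 1 / (2 * c) * integral {a..b} w"
      if "(a, b) \<in> J" for a b
    proof -
      have ab: "0 \<le> a" "a \<le> b" "b \<le> 1" using J(2)[OF that] by auto
      have w_ab: "w integrable_on {a..b}"
        by (rule integrable_subinterval_real[OF w_int]) (use ab in auto)
      have "cmod (integral {a..b} f) \<le> integral {a..b} (\<lambda>x. c / 2 + 1 / (2 * c) * w x)"
      proof (rule integral_norm_bound_integral)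
        show "f integrable_on {a..b}"
          by (rule integrable_subinterval_real[OF f_int]) (use ab in auto)
        show "(\<lambda>x. c / 2 + 1 / (2 * c) * w x) integrable_on {a..b}"
          by (intro integrable_add integrable_on_mult_right w_ab integrable_const_ivl)
        show "cmod (f x) \<le> c / 2 + 1 / (2 * c) * w x" for x
          using sum_squares_bound[of c "cmod (f x)"] c by (simp add: w_def field_simps power2_eq_square)
      qed
      also have "\<dots> = c / 2 * (b - a) + 1 / (2 * c) * integral {a..b} w"
        using w_ab ab by (subst Henstock_Kurzweil_Integration.integral_add) (auto intro: integrable_on_divide)
      finally show ?thesis
        using primitive_diff[OF f_int ab] by simp
    qed
    have "(\<Sum>(a, b)\<in>J. integral {a..b} w) \<le> W"
    proof -
      \<comment> \<open>Intervals of J may share endpoints, so disjointness is available for the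
        open intervals only.\<close>
      have box: "integral {a..b} w = integral {0..1} (\<lambda>x. if x \<in> {a<..<b} then w x else 0)"
        "(\<lambda>x. if x \<in> {a<..<b} then w x else 0) integrable_on {0..1}" if "(a, b) \<in> J" for a b
      proof -
        have ab: "0 \<le> a" "a \<le> b" "b \<le> 1" using J(2)[OF that] by auto
        have "w integrable_on {a..b}"
          by (rule integrable_subinterval_real[OF w_int]) (use ab in auto)
        then have box: "w integrable_on {a<..<b}"
          using integrable_on_open_interval[of w a b] by simp
        have sub: "{a<..<b} \<inter> {0..1} = {a<..<b}" using ab by auto
        have "integral {a..b} w = integral {a<..<b} w"
          using integral_open_interval[of a b w] by simp
        then show "integral {a..b} w = integral {0..1} (\<lambda>x. if x \<in> {a<..<b} then w x else 0)"
          using integral_restrict_Int[of "{0..1}" "{a<..<b}" w] sub by (simp add: Int_commute)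
        show "(\<lambda>x. if x \<in> {a<..<b} then w x else 0) integrable_on {0..1}"
          using integrable_restrict_Int[of "{a<..<b}" w "{0..1}"] box sub by (simp add: Int_commute)
      qed
      have "(\<Sum>(a, b)\<in>J. integral {a..b} w) =
          (\<Sum>i\<in>J. integral {0..1} (\<lambda>x. if x \<in> {fst i<..<snd i} then w x else 0))"
        using box(1) by (intro sum.cong) auto
      also have "\<dots> = integral {0..1} (\<lambda>x. \<Sum>i\<in>J. if x \<in> {fst i<..<snd i} then w x else 0)"
        using box(2) J(1) by (intro Henstock_Kurzweil_Integration.integral_sum[symmetric]) auto
      also have "\<dots> \<le> W"
        unfolding W_def
      proof (rule integral_le)
        show "(\<lambda>x. \<Sum>i\<in>J. if x \<in> {fst i<..<snd i} then w x else 0) integrable_on {0..1}"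
          using box(2) J(1) by (intro Henstock_Kurzweil_Integration.integrable_sum) auto
        show "(\<Sum>i\<in>J. if x \<in> {fst i<..<snd i} then w x else 0) \<le> w x" for x
          using sum_disjoint_intervals_le[OF J(1,3), of "w x" x] by (simp add: w_def case_prod_beta')
      qed (rule w_int)
      finally show ?thesis .
    qed
    then have W_sum: "1 / (2 * c) * (\<Sum>(a, b)\<in>J. integral {a..b} w) \<le> 1 / (2 * c) * W"
      using c by (intro mult_left_mono) auto
    have "(\<Sum>(a, b)\<in>J. cmod (integral {0..b} f - integral {0..a} f)) \<le>
        (\<Sum>(a, b)\<in>J. c / 2 * (b - a) + 1 / (2 * c) * integral {a..b} w)"
      using each by (intro sum_mono) auto
    also have "\<dots> = c / 2 * (\<Sum>(a, b)\<in>J. b - a) + 1 / (2 * c) * (\<Sum>(a, b)\<in>J. integral {a..b} w)"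
      by (simp add: case_prod_beta' sum.distrib sum_distrib_left)
    also have "\<dots> < c / 2 * (\<epsilon> / c) + 1 / (2 * c) * W"
      using J(4) c W_sum by (intro add_less_le_mono mult_strict_left_mono) auto
    also have "\<dots> \<le> \<epsilon>"
    proof -
      have "W * \<epsilon> \<le> (W + 1) * \<epsilon>" using \<epsilon> by simp
      then have "1 / (2 * c) * W \<le> \<epsilon> / 2"
        using W by (simp add: c_def field_simps)
      then show ?thesis using c by simp
    qed
    finally show "(\<Sum>(a, b)\<in>J. cmod (integral {0..b} f - integral {0..a} f)) < \<epsilon>" .
  qed
qed

section \<open>The differential operators as inverses of integral operators\<close>

lemma measurable_leb01_id [measurable]: "(\<lambda>x. x) \<in> borel_measurable leb01"
  by (intro measurable_restrict_space1 measurable_completion) simp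

lemma integral_leb01_le:
  fixes f :: "real \<Rightarrow> 'a::euclidean_space"
  assumes f: "integrable leb01 f" and x: "x \<in> {0..1}"
  shows "(LINT t|leb01. (if t \<le> x then f t else 0)) = integral {0..x} f"
proof -
  have "integrable leb01 (\<lambda>t. if t \<le> x then f t else 0)"
  proof (rule Bochner_Integration.integrable_bound[OF f])
    have [measurable]: "f \<in> borel_measurable leb01" using f by simp
    show "(\<lambda>t. if t \<le> x then f t else 0) \<in> borel_measurable leb01" by measurable
  qed auto
  then have "(LINT t|leb01. (if t \<le> x then f t else 0)) = integral {0..1} (\<lambda>t. if t \<le> x then f t else 0)"
    by (rule lebesgue_integral_eq_integral) simp
  also have "\<dots> = integral {0..1} (\<lambda>t. if t \<in> {0..x} then f t else 0)"
    by (rule integral_cong) auto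
  also have "\<dots> = integral {0..x} f"
    using integral_restrict_Int[of "{0..1}" "{0..x}" f] x
    by (simp add: Int_absorb2 atLeastatMost_subset_iff)
  finally show ?thesis .
qed

text \<open>If h = (i/\<rho>) g' and F is \<rho> h, then g' = -i F; so this is g up to the constant
  g(0).\<close>

definition prim :: "l2 \<Rightarrow> real \<Rightarrow> complex"
  where "prim F x = integral {0..x} (\<lambda>t. - \<i> * l2_fun F t)"

lemma sq_integrable_l2_fun_cmult: "sq_integrable (\<lambda>t. c * l2_fun F t)"
  by (intro sq_integrable_cmult sq_integrable_l2_fun)

lemma prim_integrable: "(\<lambda>t. - \<i> * l2_fun F t) integrable_on {0..1}"
  by (rule integrable_on_lebesgue_on[OF sq_integrable_integrable[OF sq_integrable_l2_fun_cmult]]) simp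

lemma prim_eq_LINT:
  assumes "x \<in> {0..1}"
  shows "prim F x = - \<i> * (LINT t|leb01. (if t \<le> x then l2_fun F t else 0))"
proof -
  have "prim F x = (LINT t|leb01. (if t \<le> x then - \<i> * l2_fun F t else 0))"
    unfolding prim_def
    by (rule integral_leb01_le[OF sq_integrable_integrable[OF sq_integrable_l2_fun_cmult] assms, symmetric])
  also have "\<dots> = (LINT t|leb01. - \<i> * (if t \<le> x then l2_fun F t else 0))"
    by (rule Bochner_Integration.integral_cong) auto
  finally show ?thesis by simp
qed

lemma continuous_on_prim: "continuous_on {0..1} (prim F)"
  unfolding prim_def by (rule indefinite_integral_continuous_1[OF prim_integrable])

lemma sq_integrable_indicator_le: "sq_integrable (\<lambda>t. if t \<le> (x::real) then 1 else 0)"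
  by (rule sq_integrable_bounded[of _ 1]) auto

lemma prim_eq_cip:
  assumes "x \<in> {0..1}"
  shows "prim F x = - \<i> * cip (l2_of (\<lambda>t. if t \<le> x then 1 else 0)) F"
  unfolding prim_eq_LINT[OF assms] cip_l2_of_left[OF sq_integrable_indicator_le]
  by (intro arg_cong[of _ _ "\<lambda>z. - \<i> * z"] Bochner_Integration.integral_cong) auto

lemma sq_integrable_prim: "sq_integrable (prim F)"
proof -
  have "bounded (prim F ` {0..1})"
    by (intro compact_imp_bounded compact_continuous_image continuous_on_prim) simp
  then obtain C where C: "\<forall>x\<in>{0..1}. cmod (prim F x) \<le> C"
    unfolding bounded_iff by blast
  show ?thesis
  proof (rule sq_integrable_bounded)
    show "prim F \<in> borel_measurable leb01"
      by (rule continuous_imp_measurable_on_sets_lebesgue[OF continuous_on_prim]) simp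
    show "AE x in leb01. cmod (prim F x) \<le> C" using C by (intro AE_I2) simp
  qed
qed

text \<open>Primitives are continuous, so one that is nonzero somewhere is nonzero at a rational
  point. At a fixed point its value is, up to conjugation and a factor, the coefficient of an
  indicator function, and by Bessel's inequality only countably many of these are nonzero.\<close>

lemma countable_prim_nonzero:
  assumes E: "orthonormal E"
  shows "countable {e \<in> E. \<exists>x\<in>{0..1}. prim e x \<noteq> 0}"
proof (rule countable_subset)
  let ?E = "\<lambda>q. {e \<in> E. prim e q \<noteq> 0}"
  have "countable (?E q)" if q: "q \<in> {0..1}" for q
  proof -
    have "countable {e \<in> E. (cmod (cip e (l2_of (\<lambda>t. if t \<le> q then 1 else 0))))\<^sup>2 \<noteq> 0}"
      by (intro summable_countable_real bessel_summable(1)[OF E])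
    then show ?thesis
      by (rule countable_subset[rotated])
        (auto simp: prim_eq_cip[OF q] cip_commute[of "l2_of (\<lambda>t. if t \<le> q then 1 else 0)"])
  qed
  then show "countable (\<Union>q\<in>\<rat> \<inter> {0..1}. ?E q)"
    by (intro countable_UN countable_subset[OF Int_lower1 countable_rat]) auto
  show "{e \<in> E. \<exists>x\<in>{0..1}. prim e x \<noteq> 0} \<subseteq> (\<Union>q\<in>\<rat> \<inter> {0..1}. ?E q)"
  proof safe
    fix e x assume e: "e \<in> E" and x: "x \<in> {0..1::real}" and ne: "prim e x \<noteq> 0"
    obtain d where d: "0 < d" "\<And>y. y \<in> {0..1} \<Longrightarrow> dist y x < d \<Longrightarrow> dist (prim e y) (prim e x) < cmod (prim e x)"
      using continuous_on_prim[of e] x ne unfolding continuous_on_iff by (metis zero_less_norm_iff)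
    have "max 0 (x - d) < min 1 (x + d)" using x d(1) by auto
    then obtain q where q: "q \<in> \<rat>" "max 0 (x - d) < q" "q < min 1 (x + d)"
      using Rats_dense_in_real by blast
    then have "q \<in> {0..1}" "dist q x < d" by (auto simp: dist_real_def)
    then have "dist (prim e q) (prim e x) < cmod (prim e x)" by (rule d(2))
    then have "prim e q \<noteq> 0" by auto
    then show "e \<in> (\<Union>q\<in>\<rat> \<inter> {0..1}. ?E q)"
      using e q(1) \<open>q \<in> {0..1}\<close> by blast
  qed
qed

section \<open>The projection that belongs to the minimal operator\<close>

definition one_l2 :: l2 where "one_l2 = l2_of (\<lambda>x. 1)"

lemma sq_integrable_one: "sq_integrable (\<lambda>x. 1)"
  by (rule sq_integrable_bounded[of _ 1]) auto

lemma norm_one_l2: "norm one_l2 = 1"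
proof -
  have "(norm one_l2)\<^sup>2 = 1"
    unfolding one_l2_def norm_l2_of_square[OF sq_integrable_one] by simp
  then show ?thesis by (simp add: power2_eq_1_iff) (smt (verit) norm_ge_zero)
qed

lemma prim_1: "prim F 1 = - \<i> * cip one_l2 F"
proof -
  have "l2_of (\<lambda>t. if t \<le> 1 then 1 else 0) = one_l2"
    unfolding one_l2_def by (intro l2_of_eqI sq_integrable_indicator_le sq_integrable_one AE_I2) simp
  then show ?thesis using prim_eq_cip[of 1 F] by simp
qed

lemma prim_one_l2:
  assumes x: "x \<in> {0..1}"
  shows "prim one_l2 x = - \<i> * complex_of_real x"
proof -
  have "(LINT t|leb01. (if t \<le> x then l2_fun one_l2 t else 0)) = (LINT t|leb01. (if t \<le> x then 1 else 0))"
  proof (rule integral_cong_AE)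
    show "AE t in leb01. (if t \<le> x then l2_fun one_l2 t else 0) = (if t \<le> x then 1 else 0)"
      using l2_fun_l2_of[OF sq_integrable_one] unfolding one_l2_def by eventually_elim simp
  qed measurable
  also have "\<dots> = integral {0..x} (\<lambda>t. 1)"
    by (rule integral_leb01_le[OF leb01.integrable_const x])
  also have "\<dots> = complex_of_real x"
    using x by (simp add: scaleR_conv_of_real)
  finally show ?thesis by (simp add: prim_eq_LINT[OF x])
qed

text \<open>A function vanishing at both ends has a derivative of mean zero. After multiplication by
  \<rho>, the range of \<open>T_min\<close> is therefore the orthogonal complement of the constants,
  with projection \<open>1 - mean_projection\<close>.\<close>

definition mean_projection :: "l2 cbo"
  where "mean_projection = cbo_of (\<lambda>F. cip one_l2 F *\<^sub>C one_l2)"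

lemma app_mean_projection: "app mean_projection F = cip one_l2 F *\<^sub>C one_l2"
  unfolding mean_projection_def
proof (rule app_cbo_of)
  show "bounded_linear (\<lambda>F. cip one_l2 F *\<^sub>C one_l2)"
  proof (rule bounded_linear_intro[of _ 1])
    show "norm (cip one_l2 F *\<^sub>C one_l2) \<le> norm F * 1" for F
      using cmod_cip_le[of one_l2 F] by (simp add: norm_cscale norm_one_l2)
  qed (simp_all add: cip_add_right cscale_add_left scaleR_cscale cip_cscale_right cscale_cscale)
  then show "bounded_linear (\<lambda>F. cip one_l2 F *\<^sub>C one_l2)" .
  show "cip (cip one_l2 F *\<^sub>C one_l2) G = cip F (cip one_l2 G *\<^sub>C one_l2)" for F G
    by (simp add: cip_cscale_left cip_cscale_right cip_commute[of F one_l2])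
qed

lemma star_mean_projection: "star mean_projection = mean_projection"
  by (rule star_unique)
    (simp add: app_mean_projection cip_cscale_left cip_cscale_right cip_commute[of _ one_l2])

lemma mean_projection_idem: "mean_projection * mean_projection = mean_projection"
  by (rule cbo_eqI) (simp add: app_mean_projection cip_cscale_right cip_self norm_one_l2 cscale_one)

section \<open>The weighted space and the graphs of the differential operators\<close>

locale weight =
  fixes \<rho> :: "real \<Rightarrow> real" and c C :: real
  assumes measurable_rho [measurable]: "\<rho> \<in> borel_measurable leb01"
    and c_pos: "0 < c" and c_le: "c \<le> \<rho> x" and le_C: "\<rho> x \<le> C"
begin

lemma rho_pos: "0 < \<rho> x"
  using c_pos c_le[of x] by linarith

lemma rho_nonzero: "complex_of_real (\<rho> x) \<noteq> 0"
  using rho_pos[of x] by simp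

lemma cmod_inverse_rho: "cmod (z / complex_of_real (\<rho> x)) \<le> cmod z * (1 / c)"
proof -
  have "1 / \<rho> x \<le> 1 / c" using c_pos c_le[of x] by (intro divide_left_mono) auto
  then have "cmod z * (1 / \<rho> x) \<le> cmod z * (1 / c)" by (intro mult_left_mono) auto
  then show ?thesis using rho_pos[of x] by (simp add: norm_divide)
qed

lemma coefficient_bounded_measurable:
  assumes \<alpha>: "\<alpha> \<in> borel_measurable leb01" "\<And>x. cmod (\<alpha> x) \<le> K"
  shows "(\<lambda>x. \<alpha> x / complex_of_real ((\<rho> x)\<^sup>2)) \<in> borel_measurable leb01"
    and "cmod (\<alpha> x / complex_of_real ((\<rho> x)\<^sup>2)) \<le> K * (1 / c) * (1 / c)"
proof -
  show "(\<lambda>x. \<alpha> x / complex_of_real ((\<rho> x)\<^sup>2)) \<in> borel_measurable leb01"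
    using \<alpha>(1) by measurable
  have "cmod (\<alpha> x / complex_of_real ((\<rho> x)\<^sup>2)) =
      cmod (\<alpha> x / complex_of_real (\<rho> x) / complex_of_real (\<rho> x))"
    by (simp add: power2_eq_square)
  also have "\<dots> \<le> cmod (\<alpha> x / complex_of_real (\<rho> x)) * (1 / c)"
    by (rule cmod_inverse_rho)
  also have "\<dots> \<le> cmod (\<alpha> x) * (1 / c) * (1 / c)"
    using c_pos by (intro mult_right_mono cmod_inverse_rho) auto
  also have "\<dots> \<le> K * (1 / c) * (1 / c)"
    using c_pos \<alpha>(2) by (intro mult_right_mono) auto
  finally show "cmod (\<alpha> x / complex_of_real ((\<rho> x)\<^sup>2)) \<le> K * (1 / c) * (1 / c)" .
qed

definition V :: "l2 \<Rightarrow> l2" where "V = app (mulop (\<lambda>x. complex_of_real (\<rho> x)))"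

lemma rho_bounded_measurable:
  "(\<lambda>x. complex_of_real (\<rho> x)) \<in> borel_measurable leb01" "cmod (complex_of_real (\<rho> x)) \<le> C"
  using rho_pos[of x] le_C[of x] by auto

lemma inverse_rho_bounded_measurable:
  "(\<lambda>x. 1 / complex_of_real (\<rho> x)) \<in> borel_measurable leb01" "cmod (1 / complex_of_real (\<rho> x)) \<le> 1 / c"
  using cmod_inverse_rho[of 1 x] by auto

lemma l2_fun_V: "AE x in leb01. l2_fun (V F) x = complex_of_real (\<rho> x) * l2_fun F x"
  unfolding V_def by (rule l2_fun_mulop[OF rho_bounded_measurable])

sublocale hilbert_representation V "wip \<rho>"
proof
  let ?W = "app (mulop (\<lambda>x. 1 / complex_of_real (\<rho> x)))"
  have W: "AE x in leb01. l2_fun (?W F) x = 1 / complex_of_real (\<rho> x) * l2_fun F x" for F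
    by (rule l2_fun_mulop[OF inverse_rho_bounded_measurable])
  have "V (?W F) = F" for F
  proof (rule l2_eqI)
    show "AE x in leb01. l2_fun (V (?W F)) x = l2_fun F x"
      using l2_fun_V[of "?W F"] W[of F] by eventually_elim (use rho_nonzero in simp)
  qed
  moreover have "?W (V F) = F" for F
  proof (rule l2_eqI)
    show "AE x in leb01. l2_fun (?W (V F)) x = l2_fun F x"
      using l2_fun_V[of F] W[of "V F"] by eventually_elim (use rho_nonzero in simp)
  qed
  ultimately show "bij V"
    by (intro o_bij[of ?W]) (auto simp: fun_eq_iff)
  show "V (F + G) = V F + V G" "V (a *\<^sub>C F) = a *\<^sub>C V F" for F G a
    by (simp_all add: V_def)
  show "wip \<rho> F G = cip (V F) (V G)" for F G
    unfolding wip_def cip_l2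
  proof (rule integral_cong_AE)
    show "AE x in leb01. cnj (l2_fun F x) * l2_fun G x * complex_of_real ((\<rho> x)\<^sup>2) =
        cnj (l2_fun (V F) x) * l2_fun (V G) x"
      using l2_fun_V[of F] l2_fun_V[of G] by eventually_elim (simp add: power2_eq_square)
    have "(\<lambda>x. cnj (l2_fun F x) * l2_fun G x) \<in> borel_measurable leb01" for F G
      by (rule borel_measurable_integrable[OF integrable_l2_fun_mult])
    then show "(\<lambda>x. cnj (l2_fun (V F) x) * l2_fun (V G) x) \<in> borel_measurable leb01"
      "(\<lambda>x. cnj (l2_fun F x) * l2_fun G x * complex_of_real ((\<rho> x)\<^sup>2)) \<in> borel_measurable leb01"
      by measurable
  qed
qed

text \<open>Multiplication operators commute with \<open>V\<close>, so the same function represents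
  them on both sides.\<close>

lemma mult_op_eq_op_of:
  assumes "m \<in> borel_measurable leb01" "\<And>x. cmod (m x) \<le> D"
  shows "mult_op m = op_of (mulop m)"
proof (rule op_eqI)
  fix F G
  have "(F, G) \<in> mult_op m \<longleftrightarrow> (AE x in leb01. l2_fun G x = m x * l2_fun F x)"
    by (simp add: mult_op_def)
  also have "\<dots> \<longleftrightarrow> (AE x in leb01. l2_fun (V G) x = l2_fun (app (mulop m) (V F)) x)"
  proof -
    have "AE x in leb01. (l2_fun G x = m x * l2_fun F x) \<longleftrightarrow>
        (l2_fun (V G) x = l2_fun (app (mulop m) (V F)) x)"
      using l2_fun_V[of G] l2_fun_V[of F] l2_fun_mulop[OF assms, of "V F"]
      by eventually_elim (use rho_nonzero in \<open>simp add: mult.left_commute\<close>)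
    then show ?thesis by (rule eventually_subst)
  qed
  also have "\<dots> \<longleftrightarrow> V G = app (mulop m) (V F)"
    using l2_eqI by auto
  finally show "(F, G) \<in> mult_op m \<longleftrightarrow> V G = app (mulop m) (V F)" .
qed

lemma sq_integrable_over_rho:
  assumes "sq_integrable g"
  shows "sq_integrable (\<lambda>x. \<i> / complex_of_real (\<rho> x) * g x)"
  by (intro sq_integrable_mult[of _ "1 / c"] AE_I2 assms) (use cmod_inverse_rho[of \<i>] in auto)

lemma AC01_add_const: "AC01 g \<Longrightarrow> AC01 (\<lambda>x. a + g x)"
  by (simp add: AC01_def)

text \<open>The fundamental theorem of calculus in both directions, with a as the value at 0. The
  boundary condition becomes a relation between a and \<open>prim (V h) 1\<close>.\<close>

lemma diff_op_iff:
  "(f, h) \<in> diff_op \<rho> bc \<longleftrightarrow>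
    (\<exists>a. bc a (a + prim (V h) 1) \<and> f = l2_of (\<lambda>x. a + prim (V h) x))"
proof
  assume "(f, h) \<in> diff_op \<rho> bc"
  then obtain g g' where g: "f = l2_of g" "h = l2_of (\<lambda>x. \<i> / complex_of_real (\<rho> x) * g' x)" "AC01 g"
      "AE x in leb01. (g has_vector_derivative g' x) (at x within {0..1})" "sq_integrable g'"
      "bc (g 0) (g 1)"
    unfolding diff_op_def by blast
  have "AE x in leb01. g' x = - \<i> * l2_fun (V h) x"
    using l2_fun_V[of h] l2_fun_l2_of[OF sq_integrable_over_rho[OF g(5)]] unfolding g(2)[symmetric]
  proof eventually_elim
    fix x
    assume "l2_fun (V h) x = complex_of_real (\<rho> x) * l2_fun h x"
      "l2_fun h x = \<i> / complex_of_real (\<rho> x) * g' x"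
    then have "l2_fun (V h) x = \<i> * g' x" using rho_nonzero[of x] by simp
    then show "g' x = - \<i> * l2_fun (V h) x" by simp
  qed
  then have neg: "negligible {x \<in> {0..1}. g' x \<noteq> - \<i> * l2_fun (V h) x}"
    unfolding AE_leb01_iff .
  have eq: "g x = g 0 + prim (V h) x" if x: "x \<in> {0..1}" for x
  proof -
    have "(g' has_integral (g x - g 0)) {0..x}"
      using AC01_has_integral[OF g(3,4), of 0 x] x by simp
    then have "g x - g 0 = integral {0..x} g'" by (simp add: integral_unique)
    also have "\<dots> = prim (V h) x"
      unfolding prim_def using x by (intro integral_spike[OF neg]) auto
    finally show ?thesis by (metis diff_add_cancel add.commute)
  qed
  have sq: "sq_integrable (\<lambda>x. g 0 + prim (V h) x)"
    using sq_integrable_add[OF sq_integrable_cmult[OF sq_integrable_one, of "g 0"] sq_integrable_prim] by simp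
  have "sq_integrable g"
  proof -
    have "g \<in> borel_measurable leb01 \<longleftrightarrow> (\<lambda>x. g 0 + prim (V h) x) \<in> borel_measurable leb01"
      by (rule measurable_cong) (rule eq, simp)
    moreover have "integrable leb01 (\<lambda>x. (cmod (g x))\<^sup>2) \<longleftrightarrow>
        integrable leb01 (\<lambda>x. (cmod (g 0 + prim (V h) x))\<^sup>2)"
      by (rule Bochner_Integration.integrable_cong[OF refl])
        (rule arg_cong[OF eq, of _ "\<lambda>z. (cmod z)\<^sup>2"], simp)
    ultimately show ?thesis using sq by (simp add: sq_integrable_def)
  qed
  then have "f = l2_of (\<lambda>x. g 0 + prim (V h) x)"
    unfolding g(1) by (intro l2_of_eqI sq AE_I2 eq) simp_all
  moreover have "bc (g 0) (g 0 + prim (V h) 1)"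
    using g(6) eq[of 1] by simp
  ultimately show "\<exists>a. bc a (a + prim (V h) 1) \<and> f = l2_of (\<lambda>x. a + prim (V h) x)" by blast
next
  assume "\<exists>a. bc a (a + prim (V h) 1) \<and> f = l2_of (\<lambda>x. a + prim (V h) x)"
  then obtain a where a: "bc a (a + prim (V h) 1)" "f = l2_of (\<lambda>x. a + prim (V h) x)" by blast
  let ?g' = "\<lambda>x. - \<i> * l2_fun (V h) x"
  have sq: "sq_integrable ?g'" by (rule sq_integrable_l2_fun_cmult)
  have "AC01 (\<lambda>x. a + prim (V h) x)"
    unfolding prim_def by (intro AC01_add_const AC01_primitive sq)
  moreover have "AE x in leb01. ((\<lambda>x. a + prim (V h) x) has_vector_derivative ?g' x) (at x within {0..1})"
    using primitive_has_vector_derivative_AE[OF prim_integrable[of "V h"]]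
    unfolding prim_def[symmetric]
  proof eventually_elim
    fix x assume "(prim (V h) has_vector_derivative ?g' x) (at x within {0..1})"
    from has_vector_derivative_add[OF has_vector_derivative_const[of a] this]
    show "((\<lambda>x. a + prim (V h) x) has_vector_derivative ?g' x) (at x within {0..1})"
      by (simp only: add_0_left)
  qed
  moreover have "h = l2_of (\<lambda>x. \<i> / complex_of_real (\<rho> x) * ?g' x)"
  proof (rule l2_eqI)
    show "AE x in leb01. l2_fun h x = l2_fun (l2_of (\<lambda>x. \<i> / complex_of_real (\<rho> x) * ?g' x)) x"
      using l2_fun_V[of h] l2_fun_l2_of[OF sq_integrable_over_rho[OF sq]]
      by eventually_elim (use rho_nonzero in simp)
  qed
  moreover have "prim (V h) 0 = 0" by (simp add: prim_def)
  ultimately show "(f, h) \<in> diff_op \<rho> bc"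
    unfolding diff_op_def using a sq by fastforce
qed

end

text \<open>The kernel of \<open>V G V\<^sup>-\<^sup>1\<close>, where \<open>G\<close> is the inverse of the differential operator and
  \<open>V\<close> is multiplication by \<open>\<rho>\<close>. The function \<open>\<kappa>\<close> depends on the boundary condition.\<close>

definition green_kernel :: "(real \<Rightarrow> real) \<Rightarrow> (real \<Rightarrow> complex) \<Rightarrow> real \<Rightarrow> real \<Rightarrow> complex"
  where "green_kernel \<rho> \<kappa> x t = - \<i> * complex_of_real (\<rho> x) * ((if t \<le> x then 1 else 0) + \<kappa> x)"

section \<open>Green kernels and the integral for the leading coefficient\<close>

locale green = weight +
  fixes \<kappa> :: "real \<Rightarrow> complex" and D :: real
  assumes measurable_kappa [measurable]: "\<kappa> \<in> borel_measurable leb01" and kappa_le: "cmod (\<kappa> x) \<le> D"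
begin

sublocale kernel: bounded_kernel "green_kernel \<rho> \<kappa>" "C * (1 + D)"
proof
  have [measurable]: "fst \<in> borel_measurable (leb01 \<Otimes>\<^sub>M leb01)" "snd \<in> borel_measurable (leb01 \<Otimes>\<^sub>M leb01)"
    using measurable_compose[OF measurable_fst measurable_leb01_id]
      measurable_compose[OF measurable_snd measurable_leb01_id] by simp_all
  show "case_prod (green_kernel \<rho> \<kappa>) \<in> borel_measurable (leb01 \<Otimes>\<^sub>M leb01)"
    unfolding green_kernel_def case_prod_beta' by measurable
  fix x t
  have "cmod ((if t \<le> x then 1 else 0) + \<kappa> x) \<le> 1 + D"
    using norm_triangle_ineq[of "if t \<le> x then 1 else 0" "\<kappa> x"] kappa_le[of x] by auto
  then show "cmod (green_kernel \<rho> \<kappa> x t) \<le> C * (1 + D)"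
    unfolding green_kernel_def norm_mult using rho_bounded_measurable(2)[of x]
    by (simp add: mult_mono)
qed

lemma kfun_green:
  assumes x: "x \<in> {0..1}"
  shows "kernel.kfun F x = complex_of_real (\<rho> x) * (prim F x + \<kappa> x * prim F 1)"
proof -
  have int: "integrable leb01 (l2_fun F)"
    by (rule sq_integrable_integrable[OF sq_integrable_l2_fun])
  have int_le: "integrable leb01 (\<lambda>t. if t \<le> x then l2_fun F t else 0)"
    by (rule Bochner_Integration.integrable_bound[OF int]) auto
  have "kernel.kfun F x = (LINT t|leb01. - \<i> * complex_of_real (\<rho> x) *
      ((if t \<le> x then l2_fun F t else 0) + \<kappa> x * l2_fun F t))"
    unfolding kernel.kfun_def green_kernel_def
    by (rule Bochner_Integration.integral_cong) (auto simp: algebra_simps)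
  also have "\<dots> = - \<i> * complex_of_real (\<rho> x) *
      ((LINT t|leb01. (if t \<le> x then l2_fun F t else 0)) + \<kappa> x * (LINT t|leb01. l2_fun F t))"
    using int int_le by simp
  also have "(LINT t|leb01. l2_fun F t) = (LINT t|leb01. (if t \<le> 1 then l2_fun F t else 0))"
    by (rule Bochner_Integration.integral_cong) auto
  finally show ?thesis
    using prim_eq_LINT[OF x, of F] prim_eq_LINT[of 1 F] by (simp add: algebra_simps)
qed

text \<open>Brings the integral operator into the shape of \<open>diff_op_iff\<close>: for constant
  \<kappa> the term \<open>\<kappa> x * prim F 1\<close> is the initial value a.\<close>

lemma V_eq_kop_iff: "V f = app kernel.kop F \<longleftrightarrow> f = l2_of (\<lambda>x. prim F x + \<kappa> x * prim F 1)"
proof -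
  have sq: "sq_integrable (\<lambda>x. prim F x + \<kappa> x * prim F 1)"
  proof (rule sq_integrable_add[OF sq_integrable_prim])
    show "sq_integrable (\<lambda>x. \<kappa> x * prim F 1)"
    proof (rule sq_integrable_bounded)
      show "(\<lambda>x. \<kappa> x * prim F 1) \<in> borel_measurable leb01" by measurable
      show "AE x in leb01. cmod (\<kappa> x * prim F 1) \<le> D * cmod (prim F 1)"
        using kappa_le by (intro AE_I2) (simp add: norm_mult mult_right_mono)
    qed
  qed
  have "V (l2_of (\<lambda>x. prim F x + \<kappa> x * prim F 1)) = app kernel.kop F"
  proof (rule l2_eqI)
    have "AE x in leb01. kernel.kfun F x = complex_of_real (\<rho> x) * (prim F x + \<kappa> x * prim F 1)"
      using kfun_green by (intro AE_I2) simp
    then show "AE x in leb01. l2_fun (V (l2_of (\<lambda>x. prim F x + \<kappa> x * prim F 1))) x =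
        l2_fun (app kernel.kop F) x"
      using l2_fun_V[of "l2_of (\<lambda>x. prim F x + \<kappa> x * prim F 1)"] l2_fun_l2_of[OF sq]
        kernel.l2_fun_kop[of F] by eventually_elim simp
  qed
  then show ?thesis by (metis V_eq_iff)
qed

lemma tr_mulop_green:
  assumes \<alpha>: "\<alpha> \<in> borel_measurable leb01" "\<And>x. cmod (\<alpha> x) \<le> K"
  shows "tr (mulop (\<lambda>x. \<alpha> x / complex_of_real ((\<rho> x)\<^sup>2)) * kernel.kop * star kernel.kop) =
    (LINT x|leb01. complex_of_real (x * (cmod (1 + \<kappa> x))\<^sup>2 + (1 - x) * (cmod (\<kappa> x))\<^sup>2) * \<alpha> x)"
proof -
  let ?m = "\<lambda>x. \<alpha> x / complex_of_real ((\<rho> x)\<^sup>2)"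
  note m = coefficient_bounded_measurable[OF \<alpha>]
  \<comment> \<open>A row can meet e only if the primitive of e is nonzero at x or at 1.\<close>
  have "countable {e \<in> E. \<exists>x\<in>{0..1}. cip (kernel.row x) e \<noteq> 0}" if "is_onb cip E" for E
  proof (rule countable_subset[OF _ countable_prim_nonzero[OF is_onb_orthonormal[OF that]]])
    show "{e \<in> E. \<exists>x\<in>{0..1}. cip (kernel.row x) e \<noteq> 0} \<subseteq> {e \<in> E. \<exists>x\<in>{0..1}. prim e x \<noteq> 0}"
    proof safe
      fix e x assume x: "x \<in> {0..1::real}" and ne: "cip (kernel.row x) e \<noteq> 0"
      have "kernel.kfun e x \<noteq> 0" using ne by (simp add: kernel.kfun_row[OF x])
      then have "prim e x \<noteq> 0 \<or> prim e 1 \<noteq> 0" unfolding kfun_green[OF x] by auto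
      then show "\<exists>x\<in>{0..1}. prim e x \<noteq> 0" using x by (metis atLeastAtMost_iff order.refl zero_le_one)
    qed
  qed
  then have "tr (mulop ?m * kernel.kop * star kernel.kop) =
      (LINT x|leb01. ?m x * complex_of_real (LINT t|leb01. (cmod (green_kernel \<rho> \<kappa> x t))\<^sup>2))"
    by (rule kernel.tr_mulop_kop[OF m])
  also have "\<dots> = (LINT x|leb01. complex_of_real (x * (cmod (1 + \<kappa> x))\<^sup>2 + (1 - x) * (cmod (\<kappa> x))\<^sup>2) * \<alpha> x)"
  proof (rule Bochner_Integration.integral_cong)
    fix x assume "x \<in> space leb01"
    then have x: "x \<in> {0..1}" by simp
    \<comment> \<open>As a function of t the modulus of the kernel has two values, \<rho> |1 +
      \<kappa>| up to x and \<rho> |\<kappa>| beyond. The factor \<rho>^2 cancels against the one in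
      \<alpha>/\<rho>^2.\<close>
    have "(LINT t|leb01. (cmod (green_kernel \<rho> \<kappa> x t))\<^sup>2) =
        (LINT t|leb01. (\<rho> x)\<^sup>2 * ((cmod (\<kappa> x))\<^sup>2 +
          ((cmod (1 + \<kappa> x))\<^sup>2 - (cmod (\<kappa> x))\<^sup>2) * (if t \<le> x then 1 else 0)))"
      by (rule Bochner_Integration.integral_cong)
        (auto simp: green_kernel_def norm_mult power_mult_distrib)
    also have "\<dots> = (\<rho> x)\<^sup>2 * ((cmod (\<kappa> x))\<^sup>2 +
          ((cmod (1 + \<kappa> x))\<^sup>2 - (cmod (\<kappa> x))\<^sup>2) * (LINT t|leb01. (if t \<le> x then 1 else 0)))"
    proof -
      have "integrable leb01 (\<lambda>t. if t \<le> x then 1 else (0::real))"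
        by (rule integrable_leb01_bounded[of _ 1]) auto
      then show ?thesis by simp
    qed
    also have "(LINT t|leb01. (if t \<le> x then 1 else (0::real))) = x"
      using integral_leb01_le[OF leb01.integrable_const x, of "1::real"] x by simp
    finally have "(LINT t|leb01. (cmod (green_kernel \<rho> \<kappa> x t))\<^sup>2) =
        (\<rho> x)\<^sup>2 * (x * (cmod (1 + \<kappa> x))\<^sup>2 + (1 - x) * (cmod (\<kappa> x))\<^sup>2)"
      by (simp add: algebra_simps)
    then show "?m x * complex_of_real (LINT t|leb01. (cmod (green_kernel \<rho> \<kappa> x t))\<^sup>2) =
        complex_of_real (x * (cmod (1 + \<kappa> x))\<^sup>2 + (1 - x) * (cmod (\<kappa> x))\<^sup>2) * \<alpha> x"
      using rho_nonzero[of x] by simp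
  qed simp
  finally show ?thesis .
qed

end

section \<open>Independence of the representatives of \<rho> and \<alpha>\<close>

lemma sq_integrable_cong_AE:
  assumes "sq_integrable f" "g \<in> borel_measurable leb01" "AE x in leb01. g x = f x"
  shows "sq_integrable g"
proof -
  have "integrable leb01 (\<lambda>x. (cmod (g x))\<^sup>2) \<longleftrightarrow> integrable leb01 (\<lambda>x. (cmod (f x))\<^sup>2)"
  proof (rule integrable_cong_AE)
    show "(\<lambda>x. (cmod (g x))\<^sup>2) \<in> borel_measurable leb01" "(\<lambda>x. (cmod (f x))\<^sup>2) \<in> borel_measurable leb01"
      using assms(2) sq_integrable_measurable[OF assms(1)] by measurable
    show "AE x in leb01. (cmod (g x))\<^sup>2 = (cmod (f x))\<^sup>2"
      using assms(3) by eventually_elim simp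
  qed
  then show ?thesis using assms(1,2) by (simp add: sq_integrable_def)
qed

lemma wip_cong:
  assumes [measurable]: "\<rho> \<in> borel_measurable leb01" "\<rho>' \<in> borel_measurable leb01"
    and eq: "AE x in leb01. \<rho>' x = \<rho> x"
  shows "wip \<rho>' = wip \<rho>"
proof (intro ext)
  fix F G
  have [measurable]: "(\<lambda>x. cnj (l2_fun F x) * l2_fun G x) \<in> borel_measurable leb01"
    by (rule borel_measurable_integrable[OF integrable_l2_fun_mult])
  show "wip \<rho>' F G = wip \<rho> F G"
    unfolding wip_def
  proof (rule integral_cong_AE)
    show "AE x in leb01. cnj (l2_fun F x) * l2_fun G x * complex_of_real ((\<rho>' x)\<^sup>2) =
        cnj (l2_fun F x) * l2_fun G x * complex_of_real ((\<rho> x)\<^sup>2)"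
      using eq by eventually_elim simp
  qed measurable
qed

lemma mult_op_cong:
  assumes "AE x in leb01. m' x = m x"
  shows "mult_op m' = mult_op m"
proof -
  have "(AE x in leb01. l2_fun G x = m' x * l2_fun F x) \<longleftrightarrow> (AE x in leb01. l2_fun G x = m x * l2_fun F x)"
    for F G
    by (rule eventually_subst) (use assms in \<open>eventually_elim, simp\<close>)
  then show ?thesis by (simp add: mult_op_def)
qed

lemma (in weight) diff_op_cong:
  assumes [measurable]: "\<rho>' \<in> borel_measurable leb01" and eq: "AE x in leb01. \<rho> x = \<rho>' x"
  shows "diff_op \<rho> bc = diff_op \<rho>' bc"
proof -
  have l2_eq: "l2_of (\<lambda>x. \<i> / complex_of_real (\<rho> x) * g x) = l2_of (\<lambda>x. \<i> / complex_of_real (\<rho>' x) * g x)"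
    if g: "sq_integrable g" for g
  proof (rule l2_of_eqI[OF sq_integrable_over_rho[OF g]])
    show eq': "AE x in leb01. \<i> / complex_of_real (\<rho> x) * g x = \<i> / complex_of_real (\<rho>' x) * g x"
      using eq by eventually_elim simp
    show "sq_integrable (\<lambda>x. \<i> / complex_of_real (\<rho>' x) * g x)"
    proof (rule sq_integrable_cong_AE[OF sq_integrable_over_rho[OF g]])
      show "(\<lambda>x. \<i> / complex_of_real (\<rho>' x) * g x) \<in> borel_measurable leb01"
        using sq_integrable_measurable[OF g] by measurable
      show "AE x in leb01. \<i> / complex_of_real (\<rho>' x) * g x = \<i> / complex_of_real (\<rho> x) * g x"
        using eq by eventually_elim simp
    qed
  qed
  show ?thesis
    unfolding diff_op_def
    by (rule Collect_cong, rule ex_cong1, rule ex_cong1) (intro iffI; elim conjE; simp only: l2_eq simp_thms)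
qed

text \<open>Changing \<open>\<rho>\<close> and \<open>\<alpha>\<close> on null sets, one may assume that all bounds hold everywhere.\<close>

lemma weight_representative:
  assumes "AE x in leb01. 0 < \<rho> x" "Linfty \<rho>" "Linfty (\<lambda>x. 1 / \<rho> x)"
  obtains \<rho>' c C where "weight \<rho>' c C" "AE x in leb01. \<rho>' x = \<rho> x"
proof -
  obtain C1 C2 where C12: "AE x in leb01. norm (\<rho> x) \<le> C1" "AE x in leb01. norm (1 / \<rho> x) \<le> C2"
    using assms(2,3) unfolding Linfty_def by blast
  have meas [measurable]: "\<rho> \<in> borel_measurable leb01"
    using assms(2) by (simp add: Linfty_def)
  \<comment> \<open>At least 1, so that 1/C \<le> C and \<rho> can be clamped between them without a
    change outside a null set.\<close>
  define C where "C = max 1 (max C1 C2)"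
  have C: "1 \<le> C" "C1 \<le> C" "C2 \<le> C" by (auto simp: C_def)
  define \<rho>' where "\<rho>' x = max (1 / C) (min C (\<rho> x))" for x
  have "weight \<rho>' (1 / C) C"
  proof
    show "\<rho>' \<in> borel_measurable leb01" unfolding \<rho>'_def by measurable
    show "0 < 1 / C" "1 / C \<le> \<rho>' x" for x using C by (auto simp: \<rho>'_def)
    have "1 / C \<le> 1" using C(1) by simp
    then have "1 / C \<le> C" using C(1) by linarith
    then show "\<rho>' x \<le> C" for x by (simp add: \<rho>'_def)
  qed
  moreover have "AE x in leb01. \<rho>' x = \<rho> x"
    using assms(1) C12
  proof eventually_elim
    fix x assume x: "0 < \<rho> x" "norm (\<rho> x) \<le> C1" "norm (1 / \<rho> x) \<le> C2"
    then have "1 / \<rho> x \<le> C" using C(3) by simp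
    then have "1 / C \<le> \<rho> x" using x(1) C(1) by (simp add: field_simps)
    then show "\<rho>' x = \<rho> x" using x C(2) by (simp add: \<rho>'_def)
  qed
  ultimately show ?thesis by (rule that)
qed

lemma real_bounded_representative:
  assumes "Linfty \<alpha>" "AE x in leb01. \<alpha> x \<in> \<real>"
  obtains \<alpha>' :: "real \<Rightarrow> complex" and K where "\<alpha>' \<in> borel_measurable leb01" "\<And>x. cmod (\<alpha>' x) \<le> K"
    "\<And>x. \<alpha>' x \<in> \<real>" "AE x in leb01. \<alpha>' x = \<alpha> x"
proof -
  obtain K where K: "AE x in leb01. cmod (\<alpha> x) \<le> K"
    using assms(1) unfolding Linfty_def by blast
  have meas [measurable]: "\<alpha> \<in> borel_measurable leb01"
    using assms(1) by (simp add: Linfty_def)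
  define \<alpha>' where "\<alpha>' x = complex_of_real (max (- \<bar>K\<bar>) (min \<bar>K\<bar> (Re (\<alpha> x))))" for x
  show ?thesis
  proof
    show "\<alpha>' \<in> borel_measurable leb01" unfolding \<alpha>'_def by measurable
    show "cmod (\<alpha>' x) \<le> \<bar>K\<bar>" "\<alpha>' x \<in> \<real>" for x
      by (auto simp: \<alpha>'_def)
    show "AE x in leb01. \<alpha>' x = \<alpha> x"
      using K assms(2)
    proof eventually_elim
      fix x assume "cmod (\<alpha> x) \<le> K" "\<alpha> x \<in> \<real>"
      then obtain r where "\<alpha> x = complex_of_real r" "\<bar>r\<bar> \<le> K" by (auto elim!: Reals_cases)
      then show "\<alpha>' x = \<alpha> x" by (simp add: \<alpha>'_def)
    qed
  qed
qed

text \<open>With g(1) = g(0) + p the boundary condition says g(0) = a p, which is the constant term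
  of the kernel. The values 0, -1 and 1/(\<omega> - 1) of a give \<open>T_0\<close>,
  \<open>T_1\<close> and \<open>T_omega\<close>; these are onto, so \<open>P\<close> is 1.\<close>

lemma (in green) factored_operator_const:
  assumes "star M = M" and \<kappa>: "\<And>x. \<kappa> x = a"
  shows "factored_operator V (wip \<rho>) kernel.kop 1 M (diff_op \<rho> (\<lambda>g0 g1. a * g1 = (1 + a) * g0))"
proof
  show "hs kernel.kop" by (rule kernel.hs_kop)
  fix f h
  have "(f, h) \<in> diff_op \<rho> (\<lambda>g0 g1. a * g1 = (1 + a) * g0) \<longleftrightarrow>
      (\<exists>b. b = a * prim (V h) 1 \<and> f = l2_of (\<lambda>x. b + prim (V h) x))"
    unfolding diff_op_iff by (simp add: algebra_simps)
  also have "\<dots> \<longleftrightarrow> V f = app kernel.kop (V h)"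
    unfolding V_eq_kop_iff \<kappa> by (simp add: add.commute)
  finally show "(f, h) \<in> diff_op \<rho> (\<lambda>g0 g1. a * g1 = (1 + a) * g0) \<longleftrightarrow>
      app 1 (V h) = V h \<and> V f = app kernel.kop (V h)"
    by simp
qed (simp_all add: assms)

text \<open>For \<kappa>(x) = -x the kernel subtracts from the primitive the linear function that
  vanishes at 0 and agrees with it at 1. So it annihilates constants, and on functions of mean zero
  it is the plain primitive.\<close>

lemma (in green) factored_operator_min:
  assumes "star M = M" and \<kappa>: "\<And>x. x \<in> {0..1} \<Longrightarrow> \<kappa> x = - complex_of_real x"
  shows "factored_operator V (wip \<rho>) kernel.kop (1 - mean_projection) M (diff_op \<rho> (\<lambda>g0 g1. g0 = 0 \<and> g1 = 0))"
proof
  show "hs kernel.kop" by (rule kernel.hs_kop)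
  show "star (1 - mean_projection) = 1 - mean_projection"
    by (simp add: star_mean_projection)
  show "(1 - mean_projection) * (1 - mean_projection) = 1 - mean_projection"
    by (simp add: algebra_simps mean_projection_idem)
  have "app kernel.kop one_l2 = l2_of (\<lambda>x. 0)"
    unfolding kernel.app_kop
    by (intro l2_of_eqI kernel.sq_integrable_kfun sq_integrable_zero AE_I2)
      (use prim_one_l2[of 1] in \<open>simp add: kfun_green \<kappa> prim_one_l2\<close>)
  then have "app kernel.kop one_l2 = 0" by (simp add: zero_l2_def)
  then show "kernel.kop * (1 - mean_projection) = kernel.kop"
    by (intro cbo_eqI) (simp add: app_mean_projection)
  fix f h
  have one: "one_l2 \<noteq> 0" using norm_one_l2 by force
  have "app (1 - mean_projection) (V h) = V h \<longleftrightarrow> cip one_l2 (V h) *\<^sub>C one_l2 = 0"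
    by (simp add: app_mean_projection)
  also have "\<dots> \<longleftrightarrow> norm (cip one_l2 (V h) *\<^sub>C one_l2) = 0"
    by simp
  also have "\<dots> \<longleftrightarrow> prim (V h) 1 = 0"
    unfolding norm_cscale prim_1 by (simp add: norm_one_l2)
  finally have P: "app (1 - mean_projection) (V h) = V h \<longleftrightarrow> prim (V h) 1 = 0" .
  show "(f, h) \<in> diff_op \<rho> (\<lambda>g0 g1. g0 = 0 \<and> g1 = 0) \<longleftrightarrow>
      app (1 - mean_projection) (V h) = V h \<and> V f = app kernel.kop (V h)"
    unfolding P V_eq_kop_iff diff_op_iff by auto
qed (simp add: assms(1))

lemma (in green) trace_formula_green:
  assumes \<alpha>: "\<alpha> \<in> borel_measurable leb01" "\<And>x. cmod (\<alpha> x) \<le> K"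
    and fac: "factored_operator V (wip \<rho>) kernel.kop P (mulop (\<lambda>x. \<alpha> x / complex_of_real ((\<rho> x)\<^sup>2))) T"
  defines "ip \<equiv> wip \<rho>" and "M\<alpha> \<equiv> mult_op (\<lambda>x. \<alpha> x / complex_of_real ((\<rho> x)\<^sup>2))"
    and "A \<equiv> (adj_op (wip \<rho>) T \<circ>\<^sub>o T)\<inverse>"
  shows "\<exists>t :: nat \<Rightarrow> real.
    (\<exists>\<epsilon>>0. \<forall>\<zeta>::real. \<zeta> \<noteq> 0 \<and> \<bar>\<zeta>\<bar> < \<epsilon> \<longrightarrow>
      (let z = complex_of_real \<zeta>;
           D = block_op op_zero (adj_op ip T) T op_zero;
           B = block_op ((- \<i>) *\<^sub>o M\<alpha>) op_zero op_zero op_zero;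
           ImR = op_Im (ip2 ip) ((D +\<^sub>o B -\<^sub>o z *\<^sub>o Id)\<inverse>);
           K = (adj_op ip T \<circ>\<^sub>o T -\<^sub>o z\<^sup>2 *\<^sub>o Id -\<^sub>o (z * \<i>) *\<^sub>o M\<alpha>)\<inverse>;
           S = ((2 * z) *\<^sub>o Id +\<^sub>o \<i> *\<^sub>o M\<alpha>) \<circ>\<^sub>o K
       in trace_class (ip2 ip) ImR \<and> bounded_op ip K \<and> trace_class ip S \<and>
          op_trace (ip2 ip) ImR = complex_of_real (Im (op_trace ip S)) \<and>
          (\<lambda>m. t (2 * m) * \<zeta> ^ (2 * m)) sums Im (op_trace ip S))) \<and>
    bounded_op ip A \<and>
    trace_class ip (M\<alpha> \<circ>\<^sub>o A) \<and>
    trace_class ip (M\<alpha> \<circ>\<^sub>o A \<circ>\<^sub>o M\<alpha> \<circ>\<^sub>o A \<circ>\<^sub>o M\<alpha> \<circ>\<^sub>o A) \<and>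
    trace_class ip (M\<alpha> \<circ>\<^sub>o A \<circ>\<^sub>o A) \<and>
    complex_of_real (t 0) = op_trace ip (M\<alpha> \<circ>\<^sub>o A) \<and>
    complex_of_real (t 2) =
      - op_trace ip (M\<alpha> \<circ>\<^sub>o A \<circ>\<^sub>o M\<alpha> \<circ>\<^sub>o A \<circ>\<^sub>o M\<alpha> \<circ>\<^sub>o A) + 3 * op_trace ip (M\<alpha> \<circ>\<^sub>o A \<circ>\<^sub>o A)" (is ?formula)
    and "op_trace ip (M\<alpha> \<circ>\<^sub>o A) =
      (LINT x|leb01. complex_of_real (x * (cmod (1 + \<kappa> x))\<^sup>2 + (1 - x) * (cmod (\<kappa> x))\<^sup>2) * \<alpha> x)"
proof -
  let ?M = "mulop (\<lambda>x. \<alpha> x / complex_of_real ((\<rho> x)\<^sup>2))"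
  interpret f: factored_operator V "wip \<rho>" kernel.kop P ?M T by (rule fac)
  let ?A = "kernel.kop * star kernel.kop"
  have A: "A = op_of ?A"
    unfolding A_def f.inverse_T_star_T f.A_def ..
  have M: "M\<alpha> = op_of ?M"
    unfolding M\<alpha>_def by (rule mult_op_eq_op_of[OF coefficient_bounded_measurable[OF \<alpha>]])
  have tcA: "tc ?A" using f.tc_A unfolding f.A_def .
  have tc: "tc (?M * ?A)" "tc (?M * ?A * ?M * ?A * ?M * ?A)" "tc (?M * ?A * ?A)"
    by (intro tc_mult tcA)+
  have ops: "M\<alpha> \<circ>\<^sub>o A = op_of (?M * ?A)"
    "M\<alpha> \<circ>\<^sub>o A \<circ>\<^sub>o M\<alpha> \<circ>\<^sub>o A \<circ>\<^sub>o M\<alpha> \<circ>\<^sub>o A = op_of (?M * ?A * ?M * ?A * ?M * ?A)"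
    "M\<alpha> \<circ>\<^sub>o A \<circ>\<^sub>o A = op_of (?M * ?A * ?A)"
    by (simp_all only: A M op_of_comp)
  show ?formula
    using f.trace_formula
    unfolding f.A_def ip_def A M op_of_comp op_trace_op_of[OF tc(1)] op_trace_op_of[OF tc(2)]
      op_trace_op_of[OF tc(3)]
    by (simp only: bounded_op_of trace_class_op_of[OF tc(1)] trace_class_op_of[OF tc(2)]
        trace_class_op_of[OF tc(3)] simp_thms)
  show "op_trace ip (M\<alpha> \<circ>\<^sub>o A) =
      (LINT x|leb01. complex_of_real (x * (cmod (1 + \<kappa> x))\<^sup>2 + (1 - x) * (cmod (\<kappa> x))\<^sup>2) * \<alpha> x)"
    unfolding ops ip_def op_trace_op_of[OF tc(1)]
    using tr_mulop_green[OF \<alpha>] by (simp only: mult.assoc)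
qed

theorem theorem5p4:
  fixes \<alpha> :: "real \<Rightarrow> complex" and \<rho> :: "real \<Rightarrow> real"
    and T A M\<alpha> :: "l2 operator" and D B :: "(l2 \<times> l2) operator"
    and ip :: "l2 \<Rightarrow> l2 \<Rightarrow> complex"
  assumes alpha_bdd: "Linfty \<alpha>" and alpha_real: "AE x in leb01. \<alpha> x \<in> \<real>"
    and rho_pos: "AE x in leb01. 0 < \<rho> x"
    and rho_bdd: "Linfty \<rho>" and rho_inv_bdd: "Linfty (\<lambda>x. 1 / \<rho> x)"
    and T: "T \<in> {T_min \<rho>, T_0 \<rho>, T_1 \<rho>} \<union> {T_omega \<rho> \<omega> | \<omega>. \<omega> \<notin> {0, 1}}"
    and ip_eq: "ip = wip \<rho>"
    and M\<alpha>_eq: "M\<alpha> = mult_op (\<lambda>x. \<alpha> x / complex_of_real ((\<rho> x)\<^sup>2))"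
    and A_eq: "A = (adj_op ip T \<circ>\<^sub>o T)\<inverse>"
    and D_eq: "D = block_op op_zero (adj_op ip T) T op_zero"
    and B_eq: "B = block_op ((- \<i>) *\<^sub>o M\<alpha>) op_zero op_zero op_zero"
  shows "\<exists>t :: nat \<Rightarrow> real.
    (\<exists>\<epsilon>>0. \<forall>\<zeta>::real. \<zeta> \<noteq> 0 \<and> \<bar>\<zeta>\<bar> < \<epsilon> \<and> complex_of_real \<zeta> \<in> resolvent_set (ip2 ip) (D +\<^sub>o B) \<longrightarrow>
      (let z = complex_of_real \<zeta>;
           ImR = op_Im (ip2 ip) ((D +\<^sub>o B -\<^sub>o z *\<^sub>o Id)\<inverse>);
           K = (adj_op ip T \<circ>\<^sub>o T -\<^sub>o z\<^sup>2 *\<^sub>o Id -\<^sub>o (z * \<i>) *\<^sub>o M\<alpha>)\<inverse>;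
           S = ((2 * z) *\<^sub>o Id +\<^sub>o \<i> *\<^sub>o M\<alpha>) \<circ>\<^sub>o K
       in trace_class (ip2 ip) ImR \<and> bounded_op ip K \<and> trace_class ip S \<and>
          op_trace (ip2 ip) ImR = complex_of_real (Im (op_trace ip S)) \<and>
          (\<lambda>m. t (2 * m) * \<zeta> ^ (2 * m)) sums Im (op_trace ip S))) \<and>
    bounded_op ip A \<and>
    trace_class ip (M\<alpha> \<circ>\<^sub>o A) \<and>
    trace_class ip (M\<alpha> \<circ>\<^sub>o A \<circ>\<^sub>o M\<alpha> \<circ>\<^sub>o A \<circ>\<^sub>o M\<alpha> \<circ>\<^sub>o A) \<and>
    trace_class ip (M\<alpha> \<circ>\<^sub>o A \<circ>\<^sub>o A) \<and>
    complex_of_real (t 0) = op_trace ip (M\<alpha> \<circ>\<^sub>o A) \<and>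
    complex_of_real (t 2) =
      - op_trace ip (M\<alpha> \<circ>\<^sub>o A \<circ>\<^sub>o M\<alpha> \<circ>\<^sub>o A \<circ>\<^sub>o M\<alpha> \<circ>\<^sub>o A) + 3 * op_trace ip (M\<alpha> \<circ>\<^sub>o A \<circ>\<^sub>o A) \<and>
    (T = T_min \<rho> \<longrightarrow>
      complex_of_real (t 0) = (LINT x|leb01. complex_of_real (x * (1 - x)) * \<alpha> x)) \<and>
    (T = T_0 \<rho> \<longrightarrow>
      complex_of_real (t 0) = (LINT x|leb01. complex_of_real x * \<alpha> x)) \<and>
    (T = T_1 \<rho> \<longrightarrow>
      complex_of_real (t 0) = (LINT x|leb01. complex_of_real (1 - x) * \<alpha> x)) \<and>
    (\<forall>\<omega>. \<omega> \<notin> {0, 1} \<and> T = T_omega \<rho> \<omega> \<longrightarrow>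
      complex_of_real (t 0) = complex_of_real (1 / (cmod (1 - \<omega>))\<^sup>2) *
        (LINT x|leb01. complex_of_real (1 - (1 - (cmod \<omega>)\<^sup>2) * x) * \<alpha> x))"
proof -
  have rho_meas: "\<rho> \<in> borel_measurable leb01" and alpha_meas [measurable]: "\<alpha> \<in> borel_measurable leb01"
    using rho_bdd alpha_bdd by (simp_all add: Linfty_def)
  obtain \<rho>' c C where weight: "weight \<rho>' c C" and rho': "AE x in leb01. \<rho>' x = \<rho> x"
    using weight_representative[OF rho_pos rho_bdd rho_inv_bdd] by blast
  obtain \<alpha>' K where \<alpha>': "\<alpha>' \<in> borel_measurable leb01" "\<And>x. cmod (\<alpha>' x) \<le> K" "\<And>x. \<alpha>' x \<in> \<real>"
      and alpha': "AE x in leb01. \<alpha>' x = \<alpha> x"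
    using real_bounded_representative[OF alpha_bdd alpha_real] by blast
  have [measurable]: "\<alpha>' \<in> borel_measurable leb01" by (rule \<alpha>'(1))
  interpret weight \<rho>' c C by (rule weight)
  have ip: "ip = wip \<rho>'"
    unfolding ip_eq by (rule wip_cong[OF rho_meas measurable_rho rho', symmetric])
  let ?m = "\<lambda>x. \<alpha>' x / complex_of_real ((\<rho>' x)\<^sup>2)"
  have M: "M\<alpha> = mult_op ?m"
    unfolding M\<alpha>_eq by (rule mult_op_cong[symmetric]) (use rho' alpha' in \<open>eventually_elim, simp\<close>)
  have star_M: "star (mulop ?m) = mulop ?m"
    by (rule star_mulop[OF coefficient_bounded_measurable[OF \<alpha>'(1,2)]]) (simp add: \<alpha>'(3))
  have diff_op: "diff_op \<rho> bc = diff_op \<rho>' bc" for bc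
    by (rule diff_op_cong[OF rho_meas rho', symmetric])
  let ?formula = "\<lambda>t :: nat \<Rightarrow> real.
    (\<exists>\<epsilon>>0. \<forall>\<zeta>::real. \<zeta> \<noteq> 0 \<and> \<bar>\<zeta>\<bar> < \<epsilon> \<longrightarrow>
      (let z = complex_of_real \<zeta>;
           ImR = op_Im (ip2 ip) ((D +\<^sub>o B -\<^sub>o z *\<^sub>o Id)\<inverse>);
           K = (adj_op ip T \<circ>\<^sub>o T -\<^sub>o z\<^sup>2 *\<^sub>o Id -\<^sub>o (z * \<i>) *\<^sub>o M\<alpha>)\<inverse>;
           S = ((2 * z) *\<^sub>o Id +\<^sub>o \<i> *\<^sub>o M\<alpha>) \<circ>\<^sub>o K
       in trace_class (ip2 ip) ImR \<and> bounded_op ip K \<and> trace_class ip S \<and>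
          op_trace (ip2 ip) ImR = complex_of_real (Im (op_trace ip S)) \<and>
          (\<lambda>m. t (2 * m) * \<zeta> ^ (2 * m)) sums Im (op_trace ip S))) \<and>
    bounded_op ip A \<and>
    trace_class ip (M\<alpha> \<circ>\<^sub>o A) \<and>
    trace_class ip (M\<alpha> \<circ>\<^sub>o A \<circ>\<^sub>o M\<alpha> \<circ>\<^sub>o A \<circ>\<^sub>o M\<alpha> \<circ>\<^sub>o A) \<and>
    trace_class ip (M\<alpha> \<circ>\<^sub>o A \<circ>\<^sub>o A) \<and>
    complex_of_real (t 0) = op_trace ip (M\<alpha> \<circ>\<^sub>o A) \<and>
    complex_of_real (t 2) =
      - op_trace ip (M\<alpha> \<circ>\<^sub>o A \<circ>\<^sub>o M\<alpha> \<circ>\<^sub>o A \<circ>\<^sub>o M\<alpha> \<circ>\<^sub>o A) + 3 * op_trace ip (M\<alpha> \<circ>\<^sub>o A \<circ>\<^sub>o A)"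
  have integral_alpha: "(LINT x|leb01. complex_of_real (w x) * \<alpha>' x) =
      (LINT x|leb01. complex_of_real (v x) * \<alpha> x)"
    if [measurable]: "v \<in> borel_measurable leb01" and wv: "\<And>x. x \<in> {0..1} \<Longrightarrow> w x = v x" for w v
  proof -
    have "(LINT x|leb01. complex_of_real (w x) * \<alpha>' x) = (LINT x|leb01. complex_of_real (v x) * \<alpha>' x)"
      by (rule Bochner_Integration.integral_cong) (use wv in auto)
    also have "\<dots> = (LINT x|leb01. complex_of_real (v x) * \<alpha> x)"
    proof (rule integral_cong_AE)
      show "AE x in leb01. complex_of_real (v x) * \<alpha>' x = complex_of_real (v x) * \<alpha> x"
        using alpha' by eventually_elim simp
    qed measurable
    finally show ?thesis .
  qed
  \<comment> \<open>The parameter a treats \<open>T_0\<close>, \<open>T_1\<close> and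
    \<open>T_omega\<close> at once.\<close>
  have const: "Ex ?formula \<and> op_trace ip (M\<alpha> \<circ>\<^sub>o A) = (LINT x|leb01. complex_of_real (v x) * \<alpha> x)"
    if T_eq: "T = diff_op \<rho> (\<lambda>g0 g1. a * g1 = (1 + a) * g0)" and v: "v \<in> borel_measurable leb01"
      and v_eq: "\<And>x. x * (cmod (1 + a))\<^sup>2 + (1 - x) * (cmod a)\<^sup>2 = v x" for a v
  proof -
    interpret green \<rho>' c C "\<lambda>x. a" "cmod a"
      by unfold_locales simp_all
    note formula = trace_formula_green[OF \<alpha>'(1,2) factored_operator_const[OF star_M refl],
        folded diff_op, folded T_eq ip M]
    show ?thesis
      using formula(1) formula(2) integral_alpha[OF v v_eq]
      unfolding A_eq D_eq B_eq by simp
  qed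
  have min: "Ex ?formula \<and> op_trace ip (M\<alpha> \<circ>\<^sub>o A) = (LINT x|leb01. complex_of_real (x * (1 - x)) * \<alpha> x)"
    if T_eq: "T = T_min \<rho>"
  proof -
    \<comment> \<open>Equal to -x on [0,1]; the clamping bounds it on the whole line, as the locale
      demands.\<close>
    let ?\<kappa> = "\<lambda>x. - complex_of_real (max 0 (min 1 x))"
    interpret green \<rho>' c C ?\<kappa> 1
    proof
      show "?\<kappa> \<in> borel_measurable leb01" by measurable
      show "cmod (?\<kappa> x) \<le> 1" for x by simp
    qed
    have \<kappa>: "?\<kappa> x = - complex_of_real x" if "x \<in> {0..1}" for x
      using that by simp
    note formula = trace_formula_green[OF \<alpha>'(1,2) factored_operator_min[OF star_M \<kappa>],
        folded diff_op, folded T_min_def, folded T_eq ip M]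
    have v: "(\<lambda>x::real. x * (1 - x)) \<in> borel_measurable leb01" by measurable
    have v_eq: "x * (cmod (1 + ?\<kappa> x))\<^sup>2 + (1 - x) * (cmod (?\<kappa> x))\<^sup>2 = x * (1 - x)"
      if x: "x \<in> {0..1}" for x
    proof -
      have "1 + ?\<kappa> x = complex_of_real (1 - x)" using x by simp
      then have cmod: "(cmod (1 + ?\<kappa> x))\<^sup>2 = (1 - x)\<^sup>2" "(cmod (?\<kappa> x))\<^sup>2 = x\<^sup>2"
        unfolding \<kappa>[OF x] by (simp_all only: norm_of_real norm_minus_cancel power2_abs)
      show ?thesis unfolding cmod by (simp add: power2_eq_square algebra_simps)
    qed
    show ?thesis
      using formula(1) formula(2) integral_alpha[OF v v_eq]
      unfolding A_eq D_eq B_eq by simp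
  qed
  have zero: "Ex ?formula \<and> op_trace ip (M\<alpha> \<circ>\<^sub>o A) = (LINT x|leb01. complex_of_real x * \<alpha> x)"
    if "T = T_0 \<rho>"
    by (rule const[of 0]) (use that in \<open>simp_all add: T_0_def\<close>)
  have one: "Ex ?formula \<and> op_trace ip (M\<alpha> \<circ>\<^sub>o A) = (LINT x|leb01. complex_of_real (1 - x) * \<alpha> x)"
    if "T = T_1 \<rho>"
    by (rule const[of "- 1"]) (use that in \<open>simp_all add: T_1_def\<close>)
  have omega: "Ex ?formula \<and> op_trace ip (M\<alpha> \<circ>\<^sub>o A) = complex_of_real (1 / (cmod (1 - \<omega>))\<^sup>2) *
      (LINT x|leb01. complex_of_real (1 - (1 - (cmod \<omega>)\<^sup>2) * x) * \<alpha> x)"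
    if \<omega>: "\<omega> \<notin> {0, 1}" and T_eq: "T = T_omega \<rho> \<omega>" for \<omega>
  proof -
    \<comment> \<open>The solution of a \<omega> = 1 + a, which turns the general boundary condition
      into g(1) = \<omega> g(0).\<close>
    let ?a = "1 / (\<omega> - 1)" and ?r = "1 / (cmod (1 - \<omega>))\<^sup>2"
    have ne: "\<omega> - 1 \<noteq> 0" using \<omega> by auto
    have bc: "(\<lambda>g0 g1. g1 = \<omega> * g0) = (\<lambda>g0 g1. ?a * g1 = (1 + ?a) * g0)"
      using ne by (auto simp: fun_eq_iff field_simps)
    have "1 + ?a = \<omega> / (\<omega> - 1)" using ne by (simp add: field_simps)
    then have v: "x * (cmod (1 + ?a))\<^sup>2 + (1 - x) * (cmod ?a)\<^sup>2 = ?r * (1 - (1 - (cmod \<omega>)\<^sup>2) * x)" for x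
      by (simp add: norm_divide power_divide norm_minus_commute[of \<omega> 1] diff_divide_distrib
          add_divide_distrib algebra_simps)
    have eq: "(LINT x|leb01. complex_of_real (?r * (1 - (1 - (cmod \<omega>)\<^sup>2) * x)) * \<alpha> x) =
        complex_of_real ?r * (LINT x|leb01. complex_of_real (1 - (1 - (cmod \<omega>)\<^sup>2) * x) * \<alpha> x)"
      unfolding of_real_mult mult.assoc by (rule integral_mult_right_zero)
    show ?thesis
      unfolding eq[symmetric] by (rule const[OF _ _ v]) (simp_all add: T_eq T_omega_def bc)
  qed
  \<comment> \<open>One t serves all explicit formulas, because \<open>t 0\<close> is the trace of
    \<open>M\<alpha> \<circ>\<^sub>o A\<close>, which every case evaluates.\<close>
  have "Ex ?formula" using T min zero one omega by blast
  then obtain t where t: "?formula t" ..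
  then have t0: "complex_of_real (t 0) = op_trace ip (M\<alpha> \<circ>\<^sub>o A)" by blast
  show ?thesis
  proof (intro exI[of _ t] conjI impI allI)
    show "complex_of_real (t 0) = (LINT x|leb01. complex_of_real (x * (1 - x)) * \<alpha> x)" if "T = T_min \<rho>"
      using min[OF that] t0 by simp
    show "complex_of_real (t 0) = (LINT x|leb01. complex_of_real x * \<alpha> x)" if "T = T_0 \<rho>"
      using zero[OF that] t0 by simp
    show "complex_of_real (t 0) = (LINT x|leb01. complex_of_real (1 - x) * \<alpha> x)" if "T = T_1 \<rho>"
      using one[OF that] t0 by simp
    show "complex_of_real (t 0) = complex_of_real (1 / (cmod (1 - \<omega>))\<^sup>2) *
        (LINT x|leb01. complex_of_real (1 - (1 - (cmod \<omega>)\<^sup>2) * x) * \<alpha> x)"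
      if "\<omega> \<notin> {0, 1} \<and> T = T_omega \<rho> \<omega>" for \<omega>
      using omega[of \<omega>] that t0 by simp
    show "\<exists>\<epsilon>>0. \<forall>\<zeta>::real. \<zeta> \<noteq> 0 \<and> \<bar>\<zeta>\<bar> < \<epsilon> \<and> complex_of_real \<zeta> \<in> resolvent_set (ip2 ip) (D +\<^sub>o B) \<longrightarrow>
      (let z = complex_of_real \<zeta>;
           ImR = op_Im (ip2 ip) ((D +\<^sub>o B -\<^sub>o z *\<^sub>o Id)\<inverse>);
           K = (adj_op ip T \<circ>\<^sub>o T -\<^sub>o z\<^sup>2 *\<^sub>o Id -\<^sub>o (z * \<i>) *\<^sub>o M\<alpha>)\<inverse>;
           S = ((2 * z) *\<^sub>o Id +\<^sub>o \<i> *\<^sub>o M\<alpha>) \<circ>\<^sub>o K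
       in trace_class (ip2 ip) ImR \<and> bounded_op ip K \<and> trace_class ip S \<and>
          op_trace (ip2 ip) ImR = complex_of_real (Im (op_trace ip S)) \<and>
          (\<lambda>m. t (2 * m) * \<zeta> ^ (2 * m)) sums Im (op_trace ip S))"
      using t by blast
  qed (use t in blast)+
qed

end
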